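(* Let $K$ be a field and let $N\subset M$ be a depth 2 Frobenius extension of $K$-algebras with centralizer $R=C_M(N)$ a separable $K$-algebra and with $\mathrm{Center}(N)=K$. Assume $\phi:M\to N$ is a Frobenius map whose restriction $\phi|_R:R\to K$ is an index 1 Frobenius map. Then there exists a unique (up to isomorphism compatible with the actions on $M$) weak Hopf algebra $A$ over $K$ together with a left module algebra action $\alpha:A\otimes M\to M$ with $N\subset M^A$ such that 1. (universal property) if $\alpha_W:W\otimes M\to M$ is a left module algebra action of a weak bialgebra $W$ over $K$ such that $M^W\supset N$, then there is a unique weak left morphism $f:W\to A$ of weak bialgebras such that $\alpha\circ(f\otimes\mathrm{id}_M)=\alpha_W$; and 2. $\phi|_R=\varepsilon|_R$, where $\varepsilon$ is the counit of $A$ and $R$ is identified with the left subalgebra $A^L$ of $A$ via $A^L\ni l\mapsto \alpha(l\otimes 1_M)\in R$.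
   Context: All algebras are unital associative and algebra maps are unital. $C_M(N)=\{m\in M: mn=nm\ \forall n\in N\}$. **Depth 2.** $N\subset M$ is of depth 2 if $M\otimes_NM$ is, as an $N$-$M$-bimodule, a direct summand of a finite direct sum of copies of ${}_NM_M$, and, as an $M$-$N$-bimodule, a direct summand of a finite direct sum of copies of ${}_MM_N$. **Frobenius maps.** A Frobenius map for $N\subset M$ is an $N$-$N$-bimodule map $\phi:M\to N$ possessing a quasibasis $\sum_im_i\otimes m^i\in M\otimes_NM$, i.e. $\sum_im_i\phi(m^im)=m=\sum_i\phi(mm_i)m^i$ for all $m\in M$; $N\subset M$ is a Frobenius extension if a Frobenius map exists. A Frobenius map $\phi$ restricts to a map $R\to\mathrm{Center}(N)=K$. A functional $\psi:R\to K$ is an index 1 Frobenius map if it is a Frobenius map for $K\subset R$ (nondegenerate functional) whose quasibasis $\sum_ie_i\otimes e^i\in R\otimes_KR$ satisfies $\sum_ie_ie^i=1_R$. **Weak bialgebra (WBA) over $K$.** A finite dimensional $K$-space $W$ with a $K$-algebra structure and a coassociative counital $K$-coalgebra structure $\langle W,\Delta,\varepsilon\rangle$, $\Delta(w)=w_{(1)}\otimes w_{(2)}$, such that for all $x,y,z\in W$: $\Delta(xy)=\Delta(x)\Delta(y)$; $\varepsilon(xy_{(1)})\varepsilon(y_{(2)}z)=\varepsilon(xyz)=\varepsilon(xy_{(2)})\varepsilon(y_{(1)}z)$; $(\Delta(1)\otimes 1)(1\otimes\Delta(1))=(\Delta\otimes\mathrm{id})\Delta(1)=(1\otimes\Delta(1))(\Delta(1)\otimes1)$.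 Put $\pi^L(w)=\varepsilon(1_{(1)}w)1_{(2)}$, $\pi^R(w)=1_{(1)}\varepsilon(w1_{(2)})$; the left subalgebra is $W^L=\pi^L(W)$. A **weak Hopf algebra** is a WBA with a $K$-linear map $S:W\to W$ (antipode, necessarily unique) such that $w_{(1)}S(w_{(2)})=\pi^L(w)$, $S(w_{(1)})w_{(2)}=\pi^R(w)$, $S(w_{(1)})w_{(2)}S(w_{(3)})=S(w)$. **Weak left morphisms.** The underlying left bialgebroid of a WBA $W$ is $\langle W,W^L,s^L,t^L,\gamma^L,\pi^L\rangle$ with $s^L:W^L\to W$ the inclusion, $t^L:(W^L)^{\rm op}\to W$, $t^L(l)=1_{(1)}\varepsilon(1_{(2)}l)$, $W$ a $W^L$-bimodule via $l\cdot w\cdot l'=s^L(l)t^L(l')w$, and $\gamma^L$ the composite of $\Delta$ with the canonical map $W\otimes_KW\to W\otimes_{W^L}W$. A weak left morphism $f:W\to W'$ of WBAs is a map of the underlying left bialgebroids: an algebra homomorphism $f$ for which there is an algebra homomorphism $\omega:W^L\to W'^L$ with $f s^L=s'^L\omega$, $f t^L=t'^L\omega$, $\pi'^Lf=\omega\pi^L$ and $\gamma'^Lf=\tau^\omega(f\otimes f)\gamma^L$, where $\tau^\omega:W'\otimes_{W^L}W'\to W'\otimes_{W'^L}W'$ is the canonical epimorphism ($W'$ being a $W^L$-bimodule along $\omega$). For weak Hopf algebras, weak left morphisms are those of the underlying WBAs (no condition on antipodes). **Module algebra actions of a WBA.** A left $W$-module structure $w\otimes m\mapsto w\triangleright m$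 on the algebra $M$ with $w\triangleright(mm')=(w_{(1)}\triangleright m)(w_{(2)}\triangleright m')$ and $w\triangleright1_M=\pi^L(w)\triangleright1_M$; the invariant subalgebra is $M^W=\{m: w\triangleright m=\pi^L(w)\triangleright m\ \forall w\in W\}$. *)

theory Defs
  imports Complex_Main "HOL-Library.Poly_Mapping"
begin

section \<open>Tensor products\<close>

text \<open>
  Elements of a tensor product are represented by formal sums, i.e. lists of pairs (or triples), the
  list \<open>[(a\<^sub>1,b\<^sub>1),\<dots>,(a\<^sub>n,b\<^sub>n)]\<close> standing for \<open>\<Sum>\<^sub>i a\<^sub>i \<otimes> b\<^sub>i\<close>.  Equality in the tensor product is the
  least congruence on the free commutative monoid containing the defining relations.  The relations
  mention elements of the carriers only, so lists with entries outside of the carriers are inert.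
\<close>

inductive formal_eq :: "('x list \<Rightarrow> 'x list \<Rightarrow> bool) \<Rightarrow> 'x list \<Rightarrow> 'x list \<Rightarrow> bool"
  for rel where
  base: "rel xs ys \<Longrightarrow> formal_eq rel xs ys"
| refl: "formal_eq rel xs xs"
| sym: "formal_eq rel xs ys \<Longrightarrow> formal_eq rel ys xs"
| trans: "formal_eq rel xs ys \<Longrightarrow> formal_eq rel ys zs \<Longrightarrow> formal_eq rel xs zs"
| append: "formal_eq rel xs xs' \<Longrightarrow> formal_eq rel ys ys' \<Longrightarrow> formal_eq rel (xs @ ys) (xs' @ ys')"
| comm: "formal_eq rel (xs @ ys) (ys @ xs)"

text \<open>Relations of \<open>A \<otimes>\<^sub>C B\<close>, where \<open>ra\<close> is the right action of \<open>C\<close> on \<open>A\<close> and \<open>la\<close> the left action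
  of \<open>C\<close> on \<open>B\<close>.\<close>

inductive tensor_rel ::
  "'a::ab_group_add set \<Rightarrow> 'b::ab_group_add set \<Rightarrow> 'c set \<Rightarrow> ('a \<Rightarrow> 'c \<Rightarrow> 'a) \<Rightarrow> ('c \<Rightarrow> 'b \<Rightarrow> 'b)
    \<Rightarrow> ('a \<times> 'b) list \<Rightarrow> ('a \<times> 'b) list \<Rightarrow> bool"
  for A B C ra la where
  add_left: "a \<in> A \<Longrightarrow> a' \<in> A \<Longrightarrow> b \<in> B \<Longrightarrow> tensor_rel A B C ra la [(a + a', b)] [(a, b), (a', b)]"
| add_right: "a \<in> A \<Longrightarrow> b \<in> B \<Longrightarrow> b' \<in> B \<Longrightarrow> tensor_rel A B C ra la [(a, b + b')] [(a, b), (a, b')]"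
| zero_left: "b \<in> B \<Longrightarrow> tensor_rel A B C ra la [(0, b)] []"
| zero_right: "a \<in> A \<Longrightarrow> tensor_rel A B C ra la [(a, 0)] []"
| balanced: "a \<in> A \<Longrightarrow> b \<in> B \<Longrightarrow> c \<in> C \<Longrightarrow> tensor_rel A B C ra la [(ra a c, b)] [(a, la c b)]"

definition tensor_eq ::
  "'a::ab_group_add set \<Rightarrow> 'b::ab_group_add set \<Rightarrow> 'c set \<Rightarrow> ('a \<Rightarrow> 'c \<Rightarrow> 'a) \<Rightarrow> ('c \<Rightarrow> 'b \<Rightarrow> 'b)
    \<Rightarrow> ('a \<times> 'b) list \<Rightarrow> ('a \<times> 'b) list \<Rightarrow> bool" where
  "tensor_eq A B C ra la = formal_eq (tensor_rel A B C ra la)"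

text \<open>\<open>V \<otimes>\<^sub>K V\<close> and \<open>V \<otimes>\<^sub>K V \<otimes>\<^sub>K V\<close> for a subspace \<open>V\<close> of a vector space with scalar multiplication \<open>s\<close>\<close>

definition tensor2_rel ::
  "('k::field \<Rightarrow> 'a::ab_group_add \<Rightarrow> 'a) \<Rightarrow> 'a set \<Rightarrow> ('a \<times> 'a) list \<Rightarrow> ('a \<times> 'a) list \<Rightarrow> bool" where
  "tensor2_rel s V = tensor_rel V V UNIV (\<lambda>v c. s c v) s"

definition tensor2_eq ::
  "('k::field \<Rightarrow> 'a::ab_group_add \<Rightarrow> 'a) \<Rightarrow> 'a set \<Rightarrow> ('a \<times> 'a) list \<Rightarrow> ('a \<times> 'a) list \<Rightarrow> bool" where
  "tensor2_eq s V = formal_eq (tensor2_rel s V)"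

inductive tensor3_rel ::
  "('k::field \<Rightarrow> 'a::ab_group_add \<Rightarrow> 'a) \<Rightarrow> 'a set
    \<Rightarrow> ('a \<times> 'a \<times> 'a) list \<Rightarrow> ('a \<times> 'a \<times> 'a) list \<Rightarrow> bool"
  for s V where
  slots_12: "tensor2_rel s V xs ys \<Longrightarrow> c \<in> V \<Longrightarrow>
    tensor3_rel s V (map (\<lambda>(a, b). (a, b, c)) xs) (map (\<lambda>(a, b). (a, b, c)) ys)"
| slots_23: "tensor2_rel s V xs ys \<Longrightarrow> a \<in> V \<Longrightarrow>
    tensor3_rel s V (map (\<lambda>(b, c). (a, b, c)) xs) (map (\<lambda>(b, c). (a, b, c)) ys)"

definition tensor3_eq ::
  "('k::field \<Rightarrow> 'a::ab_group_add \<Rightarrow> 'a) \<Rightarrow> 'a set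
    \<Rightarrow> ('a \<times> 'a \<times> 'a) list \<Rightarrow> ('a \<times> 'a \<times> 'a) list \<Rightarrow> bool" where
  "tensor3_eq s V = formal_eq (tensor3_rel s V)"


section \<open>Algebras and subalgebras\<close>

definition k_algebra :: "('k::field \<Rightarrow> 'm::ring_1 \<Rightarrow> 'm) \<Rightarrow> bool" where
  "k_algebra s \<longleftrightarrow> vector_space s \<and>
     (\<forall>a x y. s a x * y = s a (x * y) \<and> x * s a y = s a (x * y))"

definition subalgebra :: "('k::field \<Rightarrow> 'm::ring_1 \<Rightarrow> 'm) \<Rightarrow> 'm set \<Rightarrow> bool" where
  "subalgebra s N \<longleftrightarrow> module.subspace s N \<and> 1 \<in> N \<and> (\<forall>x\<in>N. \<forall>y\<in>N. x * y \<in> N)"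

definition scalars :: "('k::field \<Rightarrow> 'm::ring_1 \<Rightarrow> 'm) \<Rightarrow> 'm set" where
  "scalars s = range (\<lambda>a. s a 1)"

definition centralizer :: "'m::ring_1 set \<Rightarrow> 'm set \<Rightarrow> 'm set" where
  "centralizer M N = {m\<in>M. \<forall>n\<in>N. m * n = n * m}"

definition center :: "'m::ring_1 set \<Rightarrow> 'm set" where
  "center N = centralizer N N"

text \<open>The element \<open>e \<in> R \<otimes>\<^sub>K R\<close> below is the image of \<open>1\<close> under an \<open>R\<close>-\<open>R\<close>-bimodule section of the
  multiplication \<open>R \<otimes>\<^sub>K R \<rightarrow> R\<close>.\<close>

definition separable_algebra :: "('k::field \<Rightarrow> 'm::ring_1 \<Rightarrow> 'm) \<Rightarrow> 'm set \<Rightarrow> bool" where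
  "separable_algebra s R \<longleftrightarrow> (\<exists>e. set e \<subseteq> R \<times> R \<and> (\<Sum>(a, b)\<leftarrow>e. a * b) = 1 \<and>
     (\<forall>r\<in>R. tensor2_eq s R (map (\<lambda>(a, b). (r * a, b)) e) (map (\<lambda>(a, b). (a, b * r)) e)))"


section \<open>Frobenius maps\<close>

definition quasibasis :: "'m::ring_1 set \<Rightarrow> ('m \<Rightarrow> 'm) \<Rightarrow> ('m \<times> 'm) list \<Rightarrow> bool" where
  "quasibasis M \<phi> q \<longleftrightarrow> set q \<subseteq> M \<times> M \<and>
     (\<forall>m\<in>M. (\<Sum>(a, b)\<leftarrow>q. a * \<phi> (b * m)) = m \<and> (\<Sum>(a, b)\<leftarrow>q. \<phi> (m * a) * b) = m)"

definition frobenius_map :: "'m::ring_1 set \<Rightarrow> 'm set \<Rightarrow> ('m \<Rightarrow> 'm) \<Rightarrow> bool" where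
  "frobenius_map N M \<phi> \<longleftrightarrow>
     (\<forall>x\<in>M. \<phi> x \<in> N) \<and>
     (\<forall>x\<in>M. \<forall>y\<in>M. \<phi> (x + y) = \<phi> x + \<phi> y) \<and>
     (\<forall>n\<in>N. \<forall>x\<in>M. \<forall>n'\<in>N. \<phi> (n * x * n') = n * \<phi> x * n') \<and>
     (\<exists>q. quasibasis M \<phi> q)"

definition frobenius_extension :: "'m::ring_1 set \<Rightarrow> 'm set \<Rightarrow> bool" where
  "frobenius_extension N M \<longleftrightarrow> (\<exists>\<phi>. frobenius_map N M \<phi>)"

text \<open>The base field is embedded as \<open>scalars s\<close>, so functionals \<open>R \<rightarrow> K\<close> take values there.\<close>

definition index_one_frobenius_map ::
  "('k::field \<Rightarrow> 'm::ring_1 \<Rightarrow> 'm) \<Rightarrow> 'm set \<Rightarrow> ('m \<Rightarrow> 'm) \<Rightarrow> bool" where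
  "index_one_frobenius_map s R \<psi> \<longleftrightarrow> frobenius_map (scalars s) R \<psi> \<and>
     (\<exists>e. quasibasis R \<psi> e \<and> (\<Sum>(a, b)\<leftarrow>e. a * b) = 1)"


section \<open>Bimodules and depth 2\<close>

record ('m, 'x) bimodule =
  bcarrier :: "'x set"
  badd :: "'x \<Rightarrow> 'x \<Rightarrow> 'x"
  bzero :: 'x
  lact :: "'m \<Rightarrow> 'x \<Rightarrow> 'x"
  ract :: "'x \<Rightarrow> 'm \<Rightarrow> 'x"

text \<open>Homomorphisms of \<open>P\<close>-\<open>Q\<close>-bimodules; \<open>P\<close> and \<open>Q\<close> are subrings of an ambient ring, so an
  \<open>M\<close>-\<open>M\<close>-bimodule is viewed as a \<open>P\<close>-\<open>Q\<close>-bimodule without changing the record.\<close>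

definition bimodule_hom ::
  "'m set \<Rightarrow> 'm set \<Rightarrow> ('m, 'x) bimodule \<Rightarrow> ('m, 'y) bimodule \<Rightarrow> ('x \<Rightarrow> 'y) \<Rightarrow> bool" where
  "bimodule_hom P Q X Y f \<longleftrightarrow>
     (\<forall>x\<in>bcarrier X. f x \<in> bcarrier Y) \<and>
     (\<forall>x\<in>bcarrier X. \<forall>y\<in>bcarrier X. f (badd X x y) = badd Y (f x) (f y)) \<and>
     (\<forall>p\<in>P. \<forall>x\<in>bcarrier X. f (lact X p x) = lact Y p (f x)) \<and>
     (\<forall>q\<in>Q. \<forall>x\<in>bcarrier X. f (ract X x q) = ract Y (f x) q)"

definition direct_summand ::
  "'m set \<Rightarrow> 'm set \<Rightarrow> ('m, 'x) bimodule \<Rightarrow> ('m, 'y) bimodule \<Rightarrow> bool" where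
  "direct_summand P Q X Y \<longleftrightarrow> (\<exists>f g. bimodule_hom P Q X Y f \<and> bimodule_hom P Q Y X g \<and>
     (\<forall>x\<in>bcarrier X. g (f x) = x))"

definition direct_power :: "nat \<Rightarrow> ('m, 'x) bimodule \<Rightarrow> ('m, nat \<Rightarrow> 'x) bimodule" where
  "direct_power n X = \<lparr>
     bcarrier = {v. (\<forall>i<n. v i \<in> bcarrier X) \<and> (\<forall>i\<ge>n. v i = bzero X)},
     badd = (\<lambda>v w i. if i < n then badd X (v i) (w i) else bzero X),
     bzero = (\<lambda>i. bzero X),
     lact = (\<lambda>m v i. if i < n then lact X m (v i) else bzero X),
     ract = (\<lambda>v m i. if i < n then ract X (v i) m else bzero X)\<rparr>"

definition regular_bimodule :: "('m::ring_1, 'm) bimodule" where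
  "regular_bimodule = \<lparr>bcarrier = UNIV, badd = (+), bzero = 0, lact = (*), ract = (*)\<rparr>"

definition tensor_class :: "'m::ring_1 set \<Rightarrow> ('m \<times> 'm) list \<Rightarrow> ('m \<times> 'm) list set" where
  "tensor_class N xs = {ys. tensor_eq UNIV UNIV N (*) (*) xs ys}"

text \<open>\<open>M \<otimes>\<^sub>N M\<close>, with \<open>M\<close> the whole type\<close>

definition tensor_bimodule :: "'m::ring_1 set \<Rightarrow> ('m, ('m \<times> 'm) list set) bimodule" where
  "tensor_bimodule N = \<lparr>
     bcarrier = range (tensor_class N),
     badd = (\<lambda>X Y. \<Union>xs\<in>X. \<Union>ys\<in>Y. tensor_class N (xs @ ys)),
     bzero = tensor_class N [],
     lact = (\<lambda>m X. \<Union>xs\<in>X. tensor_class N (map (\<lambda>(a, b). (m * a, b)) xs)),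
     ract = (\<lambda>X m. \<Union>xs\<in>X. tensor_class N (map (\<lambda>(a, b). (a, b * m)) xs))\<rparr>"

definition depth_two :: "'m::ring_1 set \<Rightarrow> bool" where
  "depth_two N \<longleftrightarrow>
     (\<exists>n. direct_summand N UNIV (tensor_bimodule N) (direct_power n regular_bimodule)) \<and>
     (\<exists>n. direct_summand UNIV N (tensor_bimodule N) (direct_power n regular_bimodule))"


section \<open>Weak bialgebras and weak Hopf algebras\<close>

text \<open>
  The underlying space of \<open>W\<close> is a subspace \<open>car W\<close> of an ambient vector space (a type of class
  \<open>ab_group_add\<close> with scalar multiplication \<open>scl W\<close>).  The formal sum \<open>cop W w\<close> is a representative
  of \<open>\<Delta>(w) \<in> W \<otimes>\<^sub>K W\<close>; equalities between comultiplications are equalities in the tensor product.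
\<close>

record ('k, 'w) wba =
  car :: "'w set"
  scl :: "'k \<Rightarrow> 'w \<Rightarrow> 'w"
  mul :: "'w \<Rightarrow> 'w \<Rightarrow> 'w"
  unt :: 'w
  cop :: "'w \<Rightarrow> ('w \<times> 'w) list"
  eps :: "'w \<Rightarrow> 'k"

record ('k, 'w) wha = "('k, 'w) wba" +
  antip :: "'w \<Rightarrow> 'w"

definition linear_on ::
  "'a::ab_group_add set \<Rightarrow> ('k::field \<Rightarrow> 'a \<Rightarrow> 'a) \<Rightarrow> ('k \<Rightarrow> 'b::ab_group_add \<Rightarrow> 'b) \<Rightarrow> ('a \<Rightarrow> 'b) \<Rightarrow> bool" where
  "linear_on V s s' f \<longleftrightarrow>
     (\<forall>x\<in>V. \<forall>y\<in>V. f (x + y) = f x + f y) \<and> (\<forall>c. \<forall>x\<in>V. f (s c x) = s' c (f x))"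

definition fin_dim_algebra :: "('k::field, 'w::ab_group_add, 'z) wba_scheme \<Rightarrow> bool" where
  "fin_dim_algebra W \<longleftrightarrow>
     vector_space (scl W) \<and>
     (\<exists>B. finite B \<and> car W = module.span (scl W) B) \<and>
     unt W \<in> car W \<and>
     (\<forall>x\<in>car W. \<forall>y\<in>car W. mul W x y \<in> car W) \<and>
     (\<forall>x\<in>car W. mul W (unt W) x = x \<and> mul W x (unt W) = x) \<and>
     (\<forall>x\<in>car W. \<forall>y\<in>car W. \<forall>z\<in>car W. mul W (mul W x y) z = mul W x (mul W y z)) \<and>
     (\<forall>x\<in>car W. linear_on (car W) (scl W) (scl W) (mul W x)) \<and>
     (\<forall>y\<in>car W. linear_on (car W) (scl W) (scl W) (\<lambda>x. mul W x y))"

definition coalgebra :: "('k::field, 'w::ab_group_add, 'z) wba_scheme \<Rightarrow> bool" where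
  "coalgebra W \<longleftrightarrow>
     (\<forall>w\<in>car W. set (cop W w) \<subseteq> car W \<times> car W) \<and>
     (\<forall>x\<in>car W. \<forall>y\<in>car W. tensor2_eq (scl W) (car W) (cop W (x + y)) (cop W x @ cop W y)) \<and>
     (\<forall>c. \<forall>x\<in>car W. tensor2_eq (scl W) (car W)
        (cop W (scl W c x)) [(scl W c a, b). (a, b) \<leftarrow> cop W x]) \<and>
     linear_on (car W) (scl W) (*) (eps W) \<and>
     (\<forall>w\<in>car W. tensor3_eq (scl W) (car W)
        [(a, b, c). (x, c) \<leftarrow> cop W w, (a, b) \<leftarrow> cop W x]
        [(a, b, c). (a, y) \<leftarrow> cop W w, (b, c) \<leftarrow> cop W y]) \<and>
     (\<forall>w\<in>car W. (\<Sum>(a, b)\<leftarrow>cop W w. scl W (eps W a) b) = w \<and>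
                (\<Sum>(a, b)\<leftarrow>cop W w. scl W (eps W b) a) = w)"

definition weak_bialgebra :: "('k::field, 'w::ab_group_add, 'z) wba_scheme \<Rightarrow> bool" where
  "weak_bialgebra W \<longleftrightarrow> fin_dim_algebra W \<and> coalgebra W \<and>
     (\<forall>x\<in>car W. \<forall>y\<in>car W. tensor2_eq (scl W) (car W) (cop W (mul W x y))
        [(mul W a a', mul W b b'). (a, b) \<leftarrow> cop W x, (a', b') \<leftarrow> cop W y]) \<and>
     (\<forall>x\<in>car W. \<forall>y\<in>car W. \<forall>z\<in>car W.
        (\<Sum>(a, b)\<leftarrow>cop W y. eps W (mul W x a) * eps W (mul W b z)) = eps W (mul W (mul W x y) z) \<and>
        (\<Sum>(a, b)\<leftarrow>cop W y. eps W (mul W x b) * eps W (mul W a z)) = eps W (mul W (mul W x y) z)) \<and>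
     tensor3_eq (scl W) (car W)
       [(mul W a (unt W), mul W b a', mul W (unt W) b'). (a, b) \<leftarrow> cop W (unt W), (a', b') \<leftarrow> cop W (unt W)]
       [(a, b, c). (x, c) \<leftarrow> cop W (unt W), (a, b) \<leftarrow> cop W x] \<and>
     tensor3_eq (scl W) (car W)
       [(mul W (unt W) a, mul W a' b, mul W b' (unt W)). (a', b') \<leftarrow> cop W (unt W), (a, b) \<leftarrow> cop W (unt W)]
       [(a, b, c). (x, c) \<leftarrow> cop W (unt W), (a, b) \<leftarrow> cop W x]"

definition piL :: "('k::field, 'w::ab_group_add, 'z) wba_scheme \<Rightarrow> 'w \<Rightarrow> 'w" where
  "piL W w = (\<Sum>(a, b)\<leftarrow>cop W (unt W). scl W (eps W (mul W a w)) b)"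

definition piR :: "('k::field, 'w::ab_group_add, 'z) wba_scheme \<Rightarrow> 'w \<Rightarrow> 'w" where
  "piR W w = (\<Sum>(a, b)\<leftarrow>cop W (unt W). scl W (eps W (mul W w b)) a)"

definition left_subalgebra :: "('k::field, 'w::ab_group_add, 'z) wba_scheme \<Rightarrow> 'w set" where
  "left_subalgebra W = piL W ` car W"

definition weak_hopf_algebra :: "('k::field, 'w::ab_group_add, 'z) wha_scheme \<Rightarrow> bool" where
  "weak_hopf_algebra W \<longleftrightarrow> weak_bialgebra W \<and>
     (\<forall>w\<in>car W. antip W w \<in> car W) \<and>
     linear_on (car W) (scl W) (scl W) (antip W) \<and>
     (\<forall>w\<in>car W.
        (\<Sum>(a, b)\<leftarrow>cop W w. mul W a (antip W b)) = piL W w \<and>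
        (\<Sum>(a, b)\<leftarrow>cop W w. mul W (antip W a) b) = piR W w \<and>
        (\<Sum>(x, c)\<leftarrow>cop W w. \<Sum>(a, b)\<leftarrow>cop W x. mul W (mul W (antip W a) b) (antip W c)) = antip W w)"


section \<open>Morphisms\<close>

definition algebra_hom ::
  "('k::field, 'w::ab_group_add, 'z) wba_scheme \<Rightarrow> 'w set \<Rightarrow>
   ('k, 'v::ab_group_add, 'y) wba_scheme \<Rightarrow> 'v set \<Rightarrow> ('w \<Rightarrow> 'v) \<Rightarrow> bool" where
  "algebra_hom W D W' D' f \<longleftrightarrow>
     (\<forall>x\<in>D. f x \<in> D') \<and> linear_on D (scl W) (scl W') f \<and> f (unt W) = unt W' \<and>
     (\<forall>x\<in>D. \<forall>y\<in>D. f (mul W x y) = mul W' (f x) (f y))"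

text \<open>The target map of the underlying left bialgebroid; the source map is the inclusion.\<close>

definition tL :: "('k::field, 'w::ab_group_add, 'z) wba_scheme \<Rightarrow> 'w \<Rightarrow> 'w" where
  "tL W l = (\<Sum>(a, b)\<leftarrow>cop W (unt W). scl W (eps W (mul W b l)) a)"

text \<open>Equality in \<open>W \<otimes>\<^bsub>W\<^sup>L\<^esub> W\<close> for the bimodule structure \<open>l \<cdot> w \<cdot> l' = l t\<^sup>L(l') w\<close>\<close>

definition tensorL_eq ::
  "('k::field, 'w::ab_group_add, 'z) wba_scheme \<Rightarrow> ('w \<times> 'w) list \<Rightarrow> ('w \<times> 'w) list \<Rightarrow> bool" where
  "tensorL_eq W = tensor_eq (car W) (car W) (left_subalgebra W) (\<lambda>w l. mul W (tL W l) w) (mul W)"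

text \<open>
  Canonical maps between tensor products do not change representing formal sums: \<open>cop W w\<close> also
  represents \<open>\<gamma>\<^sup>L(w)\<close>, and \<open>[(f a, f b). (a, b) \<leftarrow> cop W w]\<close> represents \<open>\<tau>\<^sup>\<omega>((f \<otimes> f)(\<gamma>\<^sup>L(w)))\<close>.
\<close>

definition weak_left_morphism ::
  "('k::field, 'w::ab_group_add, 'z) wba_scheme \<Rightarrow> ('k, 'v::ab_group_add, 'y) wba_scheme \<Rightarrow> ('w \<Rightarrow> 'v) \<Rightarrow> bool" where
  "weak_left_morphism W W' f \<longleftrightarrow> algebra_hom W (car W) W' (car W') f \<and>
     (\<exists>\<omega>. algebra_hom W (left_subalgebra W) W' (left_subalgebra W') \<omega> \<and>
        (\<forall>l\<in>left_subalgebra W. f l = \<omega> l) \<and>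
        (\<forall>l\<in>left_subalgebra W. f (tL W l) = tL W' (\<omega> l)) \<and>
        (\<forall>w\<in>car W. piL W' (f w) = \<omega> (piL W w)) \<and>
        (\<forall>w\<in>car W. tensorL_eq W' (cop W' (f w)) [(f a, f b). (a, b) \<leftarrow> cop W w]))"

definition wha_iso ::
  "('k::field, 'w::ab_group_add, 'z) wha_scheme \<Rightarrow> ('k, 'v::ab_group_add, 'y) wha_scheme \<Rightarrow> ('w \<Rightarrow> 'v) \<Rightarrow> bool" where
  "wha_iso W W' f \<longleftrightarrow> bij_betw f (car W) (car W') \<and>
     algebra_hom W (car W) W' (car W') f \<and>
     (\<forall>w\<in>car W. tensor2_eq (scl W') (car W') (cop W' (f w)) [(f a, f b). (a, b) \<leftarrow> cop W w]) \<and>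
     (\<forall>w\<in>car W. eps W' (f w) = eps W w) \<and>
     (\<forall>w\<in>car W. f (antip W w) = antip W' (f w))"


section \<open>Module algebra actions\<close>

definition module_algebra_action ::
  "('k::field \<Rightarrow> 'm::ring_1 \<Rightarrow> 'm) \<Rightarrow> ('k, 'w::ab_group_add, 'z) wba_scheme \<Rightarrow> ('w \<Rightarrow> 'm \<Rightarrow> 'm) \<Rightarrow> bool" where
  "module_algebra_action s W act \<longleftrightarrow>
     (\<forall>m. linear_on (car W) (scl W) s (\<lambda>w. act w m)) \<and>
     (\<forall>w\<in>car W. linear_on UNIV s s (act w)) \<and>
     (\<forall>m. act (unt W) m = m) \<and>
     (\<forall>w\<in>car W. \<forall>w'\<in>car W. \<forall>m. act (mul W w w') m = act w (act w' m)) \<and>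
     (\<forall>w\<in>car W. \<forall>m m'. act w (m * m') = (\<Sum>(a, b)\<leftarrow>cop W w. act a m * act b m')) \<and>
     (\<forall>w\<in>car W. act w 1 = act (piL W w) 1)"

definition invariants ::
  "('k::field, 'w::ab_group_add, 'z) wba_scheme \<Rightarrow> ('w \<Rightarrow> 'm \<Rightarrow> 'm) \<Rightarrow> 'm set" where
  "invariants W act = {m. \<forall>w\<in>car W. act w m = act (piL W w) m}"

text \<open>Universality of \<open>(A, \<alpha>)\<close> among the weak bialgebras whose space lies in the type \<open>'w\<close>\<close>

definition universal_action ::
  "'w::ab_group_add itself \<Rightarrow> ('k::field \<Rightarrow> 'm::ring_1 \<Rightarrow> 'm) \<Rightarrow> 'm set \<Rightarrow>
   ('k, 'v::ab_group_add, 'z) wba_scheme \<Rightarrow> ('v \<Rightarrow> 'm \<Rightarrow> 'm) \<Rightarrow> bool" where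
  "universal_action (_ :: 'w itself) s N A \<alpha> \<longleftrightarrow>
     (\<forall>(W :: ('k, 'w) wba) \<alpha>W.
        weak_bialgebra W \<and> module_algebra_action s W \<alpha>W \<and> N \<subseteq> invariants W \<alpha>W \<longrightarrow>
        (\<exists>f. weak_left_morphism W A f \<and> (\<forall>w\<in>car W. \<forall>m. \<alpha> (f w) m = \<alpha>W w m) \<and>
          (\<forall>g. weak_left_morphism W A g \<and> (\<forall>w\<in>car W. \<forall>m. \<alpha> (g w) m = \<alpha>W w m) \<longrightarrow>
            (\<forall>w\<in>car W. g w = f w))))"

text \<open>The algebra isomorphism \<open>l \<mapsto> \<alpha>(l \<otimes> 1)\<close> from \<open>A\<^sup>L\<close> to \<open>R\<close>, transporting \<open>\<phi>|\<^sub>R\<close> to \<open>\<epsilon>\<close>\<close>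

definition counit_restricts_to ::
  "('k::field \<Rightarrow> 'm::ring_1 \<Rightarrow> 'm) \<Rightarrow> 'm set \<Rightarrow> ('m \<Rightarrow> 'm) \<Rightarrow>
   ('k, 'v::ab_group_add, 'z) wba_scheme \<Rightarrow> ('v \<Rightarrow> 'm \<Rightarrow> 'm) \<Rightarrow> bool" where
  "counit_restricts_to s R \<phi> A \<alpha> \<longleftrightarrow>
     bij_betw (\<lambda>l. \<alpha> l 1) (left_subalgebra A) R \<and>
     (\<forall>l\<in>left_subalgebra A. \<forall>l'\<in>left_subalgebra A. \<alpha> (mul A l l') 1 = \<alpha> l 1 * \<alpha> l' 1) \<and>
     (\<forall>l\<in>left_subalgebra A. \<phi> (\<alpha> l 1) = s (eps A l) 1)"

text \<open>
  The universal property of the solution ranges over the weak bialgebras contained in \<open>nat \<Rightarrow>\<^sub>0 'k\<close>.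
  Every finite dimensional space over \<open>'k\<close> is isomorphic to a subspace of this type, so all weak
  bialgebras occur up to isomorphism.
\<close>

definition is_solution ::
  "('k::field \<Rightarrow> 'm::ring_1 \<Rightarrow> 'm) \<Rightarrow> 'm set \<Rightarrow> ('m \<Rightarrow> 'm) \<Rightarrow>
   ('k, 'v::ab_group_add) wha \<Rightarrow> ('v \<Rightarrow> 'm \<Rightarrow> 'm) \<Rightarrow> bool" where
  "is_solution s N \<phi> A \<alpha> \<longleftrightarrow>
     weak_hopf_algebra A \<and> module_algebra_action s A \<alpha> \<and> N \<subseteq> invariants A \<alpha> \<and>
     universal_action TYPE(nat \<Rightarrow>\<^sub>0 'k) s N A \<alpha> \<and>
     counit_restricts_to s (centralizer UNIV N) \<phi> A \<alpha>"

end

theory Submission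
  imports Defs "HOL-Library.Multiset" "HOL-Library.Function_Algebras"
begin

text \<open>
  The weak Hopf algebra is the algebra \<open>E\<close> of all \<open>N\<close>-\<open>N\<close>-bimodule endomorphisms of \<open>M\<close>, acting on \<open>M\<close>
  by evaluation.  A weak bialgebra \<open>W\<close> that acts on \<open>M\<close> with \<open>N\<close> invariant acts by elements of \<open>E\<close>
  (lemma \<open>act_bimodule_end\<close>): elements \<open>l\<close> of the left subalgebra act by \<open>m \<mapsto> (l \<triangleright> 1) m\<close>,
  elements \<open>r\<close> of the right subalgebra by \<open>m \<mapsto> m (r \<triangleright> 1)\<close>, and comparing the two on
  \<open>N\<close> shows that \<open>w \<triangleright> 1\<close> lies in the centralizer \<open>R\<close>.  So \<open>w \<mapsto> (w \<triangleright> _)\<close> is the only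
  candidate for the universal morphism, and the content of the theorem is that \<open>E\<close> is a weak Hopf
  algebra for which this map respects the comultiplications.

  Depth two identifies \<open>E \<otimes>\<^sub>R E\<close> with the bimodule maps \<open>M \<otimes>\<^sub>N M \<rightarrow> M\<close> through
  \<open>a \<otimes> b \<mapsto> (x \<otimes> y \<mapsto> a(x) b(y))\<close>: formal sums with the same values are equal over \<open>R\<close>
  (\<open>balanced_tensorI\<close>), and the dual basis of \<open>M \<otimes>\<^sub>N M\<close> provides a formal sum for \<open>x \<otimes> y \<mapsto> a(x y)\<close>
  (\<open>theta_mult\<close>).  This is the comultiplication over \<open>R\<close>.
  The quasibasis \<open>\<Sum> e\<^sub>i \<otimes> e\<^sup>i\<close> of \<open>\<phi>\<close> on \<open>R\<close> lifts it to \<open>E \<otimes>\<^sub>K E\<close> by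
  \<open>a \<otimes> b \<mapsto> \<Sum> a(_) e\<^sub>i \<otimes> e\<^sup>i b(_)\<close>, and index one makes the lift multiplicative.  The outcome is one
  formula, \<open>cop_psum\<close>: a \<open>K\<close>-balanced expression \<open>B\<close> summed over \<open>\<Delta>(w)\<close> is
  \<open>\<Sum> B(z\<^sub>1(_) e\<^sub>i, e\<^sup>i z\<^sub>2(_))\<close> for every formal sum \<open>\<Sum> z\<^sub>1 \<otimes> z\<^sub>2\<close> with
  \<open>\<Sum> z\<^sub>1(x) z\<^sub>2(y) = w(x y)\<close>.  With the counit \<open>a \<mapsto> \<phi>(a(1))\<close> all axioms of a weak bialgebra
  follow by choosing suitable formal sums.

  The antipode is the adjoint with respect to \<open>\<phi>\<close>, that is \<open>\<phi>(a(x) y) = \<phi>(x S(a)(y))\<close>.  The identity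
  for \<open>S(a\<^sub>1) a\<^sub>2\<close> is immediate.  The one for \<open>a\<^sub>1 S(a\<^sub>2)\<close> rests on the map
  \<open>F(z) = \<Sum> e\<^sub>i \<phi>(e\<^sup>i z) = \<Sum> \<phi>(z e\<^sub>i) e\<^sup>i\<close> onto \<open>R N\<close>: it commutes with all of \<open>E\<close>
  (\<open>proj_commute\<close>), and \<open>\<Sum> m\<^sub>j F(m\<^sup>j z) = z\<close> by index one (\<open>mb_proj\<close>).

  For uniqueness, the universal properties of \<open>E\<close> and of another solution \<open>A'\<close> provide morphisms
  \<open>A' \<rightarrow> E\<close> and \<open>E \<rightarrow> A'\<close>.  They are mutually inverse, one composite because \<open>E\<close> acts faithfully, the
  other by the uniqueness clause for \<open>A'\<close>, applied to a copy of \<open>A'\<close> among finitely supported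
  sequences.  Weak left morphisms preserve the comultiplication over \<open>R\<close> only; the prescribed counit
  on \<open>R\<close> determines \<open>\<Delta>(1)\<close> (\<open>cop_one_transfer\<close>) and hence \<open>\<Delta>\<close>, the counit satisfies
  \<open>\<epsilon> = \<epsilon> \<circ> \<pi>\<^sup>L\<close>, and antipodes are unique.
\<close>

section \<open>Formal sums and tensor products\<close>

text \<open>
  Value of a two-variable map on a formal sum; keeping the map curried lets the algebraic laws below
  act as higher-order rewrite rules.
\<close>
definition psum :: "('a \<times> 'b) list \<Rightarrow> ('a \<Rightarrow> 'b \<Rightarrow> 'c::comm_monoid_add) \<Rightarrow> 'c" where
  "psum xs F = (\<Sum>(a, b)\<leftarrow>xs. F a b)"

lemma psum_Nil [simp]: "psum [] F = 0"
  and psum_Cons [simp]: "psum ((a, b) # xs) F = F a b + psum xs F"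
  and psum_append [simp]: "psum (xs @ ys) F = psum xs F + psum ys F"
  by (simp_all add: psum_def)

lemma psum_cong:
  assumes "\<And>a b. (a, b) \<in> set xs \<Longrightarrow> F a b = G a b"
  shows "psum xs F = psum xs G"
  using assms by (induction xs) auto

lemma psum_cong_map: "xs = ys \<Longrightarrow> (\<And>a b. (a, b) \<in> set ys \<Longrightarrow> F a b = G a b) \<Longrightarrow> psum xs F = psum ys G"
  using psum_cong by metis

lemma psum_0 [simp]: "psum xs (\<lambda>a b. 0) = 0"
  by (induction xs) auto

lemma psum_add: "psum xs (\<lambda>a b. F a b + G a b) = psum xs F + psum xs G"
  by (induction xs) (auto simp: algebra_simps)

lemma psum_map: "psum (map (\<lambda>(a, b). (f a b, g a b)) xs) F = psum xs (\<lambda>a b. F (f a b) (g a b))"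
  by (induction xs) auto

lemma psum_concat: "psum (concat (map (\<lambda>(a, b). h a b) xs)) F = psum xs (\<lambda>a b. psum (h a b) F)"
  by (induction xs) auto

lemma psum_swap: "psum xs (\<lambda>a b. psum ys (\<lambda>c d. F a b c d)) = psum ys (\<lambda>c d. psum xs (\<lambda>a b. F a b c d))"
  by (induction xs) (auto simp: psum_add)

lemma psum_mult_left: "psum xs (\<lambda>a b. (c::'c::semiring_0) * F a b) = c * psum xs F"
  and psum_mult_right: "psum xs (\<lambda>a b. F a b * (c::'c::semiring_0)) = psum xs F * c"
  by (induction xs) (auto simp: algebra_simps)

lemma psum_in:
  assumes "0 \<in> V" "\<And>x y. x \<in> V \<Longrightarrow> y \<in> V \<Longrightarrow> x + y \<in> V" "\<And>a b. (a, b) \<in> set xs \<Longrightarrow> F a b \<in> V"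
  shows "psum xs F \<in> V"
  using assms(3) by (induction xs) (auto simp: assms(1,2))

lemma psum_hom_on:
  fixes f :: "'c::ab_group_add \<Rightarrow> 'd::ab_group_add"
  assumes V: "0 \<in> V" "\<And>x y. x \<in> V \<Longrightarrow> y \<in> V \<Longrightarrow> x + y \<in> V"
    and f: "\<And>x y. x \<in> V \<Longrightarrow> y \<in> V \<Longrightarrow> f (x + y) = f x + f y"
    and F: "\<And>a b. (a, b) \<in> set xs \<Longrightarrow> F a b \<in> V"
  shows "f (psum xs F) = psum xs (\<lambda>a b. f (F a b))"
proof -
  have "f 0 = 0" using f[of 0 0] V by simp
  then show ?thesis using F
  proof (induction xs)
    case (Cons x xs)
    have "psum xs F \<in> V" using Cons.prems by (intro psum_in V) auto
    with Cons show ?case by (cases x) (auto simp: f)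
  qed simp
qed

lemma psum_hom:
  fixes f :: "'c::ab_group_add \<Rightarrow> 'd::ab_group_add"
  assumes "\<And>x y. f (x + y) = f x + f y"
  shows "f (psum xs F) = psum xs (\<lambda>a b. f (F a b))"
  using psum_hom_on[of UNIV f xs F] assms by simp

text \<open>
  A map on generators that respects the relations is defined on the quotient.
\<close>
lemma formal_eq_sum_list:
  fixes f :: "'x \<Rightarrow> 'y::comm_monoid_add"
  assumes "formal_eq rel xs ys" "\<And>xs ys. rel xs ys \<Longrightarrow> (\<Sum>x\<leftarrow>xs. f x) = (\<Sum>x\<leftarrow>ys. f x)"
  shows "(\<Sum>x\<leftarrow>xs. f x) = (\<Sum>x\<leftarrow>ys. f x)"
  using assms(1) by induction (auto simp: assms(2) add.commute)

lemma formal_eq_map: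
  assumes "formal_eq rel xs ys" "\<And>xs ys. rel xs ys \<Longrightarrow> formal_eq rel' (map h xs) (map h ys)"
  shows "formal_eq rel' (map h xs) (map h ys)"
  using assms(1)
proof induction
  case (sym xs ys) then show ?case using formal_eq.sym by blast
next
  case (trans xs ys zs) then show ?case using formal_eq.trans by blast
qed (auto intro: assms(2) formal_eq.refl formal_eq.append formal_eq.comm)

lemma formal_eq_mset: "mset xs = mset ys \<Longrightarrow> formal_eq rel xs ys"
proof (induction xs arbitrary: ys)
  case Nil then show ?case by (simp add: formal_eq.refl)
next
  case (Cons x xs)
  then have "x \<in> set ys" by (metis list.set_intros(1) set_mset_mset)
  then obtain us vs where ys: "ys = us @ x # vs" by (meson split_list)
  with Cons.prems have "mset xs = mset (us @ vs)" by simp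
  then have "formal_eq rel ([x] @ xs) ([x] @ (us @ vs))"
    by (intro formal_eq.append Cons.IH formal_eq.refl)
  moreover have "formal_eq rel (([x] @ us) @ vs) ((us @ [x]) @ vs)"
    by (intro formal_eq.append formal_eq.comm formal_eq.refl)
  ultimately show ?case unfolding ys by (metis append.assoc append_Cons append_Nil formal_eq.trans)
qed

lemma formal_eq_concat2:
  assumes "\<And>x. x \<in> set zs \<Longrightarrow> formal_eq rel (f x) (g x)"
  shows "formal_eq rel (concat (map f zs)) (concat (map g zs))"
  using assms by (induction zs) (auto intro: formal_eq.append formal_eq.refl)

text \<open>
  Normal form in a tensor product whose right factor has a finite dual basis \<open>(g, d)\<close>: writing
  \<open>b = \<Sum> g(b) d\<close> moves the coefficients to the left factor.  Thus a tensor is determined by the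
  left coefficients.  It is used with scalars in \<open>K\<close> and with scalars in the centralizer.
\<close>
lemma tensor_eq_expand:
  assumes A: "0 \<in> A" "\<And>x y. x \<in> A \<Longrightarrow> y \<in> A \<Longrightarrow> x + y \<in> A"
    and B: "0 \<in> B" "\<And>x y. x \<in> B \<Longrightarrow> y \<in> B \<Longrightarrow> x + y \<in> B"
    and ra: "\<And>a c. a \<in> A \<Longrightarrow> c \<in> C \<Longrightarrow> ra a c \<in> A"
    and la: "\<And>c b. c \<in> C \<Longrightarrow> b \<in> B \<Longrightarrow> la c b \<in> B"
    and d: "\<And>g d. (g, d) \<in> set D \<Longrightarrow> d \<in> B"
    and g: "\<And>g d b. (g, d) \<in> set D \<Longrightarrow> b \<in> B \<Longrightarrow> g b \<in> C"
    and D: "\<And>b. b \<in> B \<Longrightarrow> psum D (\<lambda>g d. la (g b) d) = b"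
    and xs: "set xs \<subseteq> A \<times> B"
  shows "tensor_eq A B C ra la xs (map (\<lambda>(g, d). (psum xs (\<lambda>a b. ra a (g b)), d)) D)"
  using xs
proof (induction xs)
  let ?R = "tensor_rel A B C ra la"
  case Nil
  have "set D' \<subseteq> set D \<Longrightarrow> formal_eq ?R [] (map (\<lambda>(g, d). (0, d)) D')" for D'
  proof (induction D')
    case (Cons x D')
    then have "snd x \<in> B" using d by (cases x) auto
    then have "formal_eq ?R [] [(0, snd x)]"
      by (intro formal_eq.sym[OF formal_eq.base] tensor_rel.zero_left)
    from formal_eq.append[OF this Cons.IH] Cons.prems show ?case by (cases x) simp
  qed (simp add: formal_eq.refl)
  then show ?case unfolding tensor_eq_def by simp
next
  let ?R = "tensor_rel A B C ra la"
  case (Cons x xs)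
  obtain a b where x: "x = (a, b)" by fastforce
  have ab: "a \<in> A" "b \<in> B" and xs: "set xs \<subseteq> A \<times> B" using Cons.prems x by auto
  \<comment> \<open>One generator is expanded along the dual basis, by additivity and balancing.\<close>
  have 1: "set D' \<subseteq> set D \<Longrightarrow>
      formal_eq ?R [(a, psum D' (\<lambda>g d. la (g b) d))] (map (\<lambda>(g, d). (ra a (g b), d)) D')" for D'
  proof (induction D')
    case Nil
    then show ?case using ab by (auto intro!: formal_eq.base tensor_rel.zero_right)
  next
    case (Cons gd D')
    obtain g1 d1 where gd: "gd = (g1, d1)" by fastforce
    have m: "(g1, d1) \<in> set D" and D': "set D' \<subseteq> set D" using Cons.prems gd by auto
    have s: "psum D' (\<lambda>g d. la (g b) d) \<in> B"
    proof (rule psum_in[OF B])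
      fix g' d' assume "(g', d') \<in> set D'"
      then have "(g', d') \<in> set D" using D' by auto
      then show "la (g' b) d' \<in> B" using la[OF g[OF _ ab(2)] d] by auto
    qed
    have l: "la (g1 b) d1 \<in> B" by (rule la[OF g[OF m ab(2)] d[OF m]])
    have "formal_eq ?R [(a, la (g1 b) d1 + psum D' (\<lambda>g d. la (g b) d))]
        ([(a, la (g1 b) d1)] @ [(a, psum D' (\<lambda>g d. la (g b) d))])"
      using tensor_rel.add_right[OF ab(1) l s, of C ra la] by (auto intro: formal_eq.base)
    moreover have "formal_eq ?R [(a, la (g1 b) d1)] [(ra a (g1 b), d1)]"
    proof (rule formal_eq.sym)
      have "?R [(ra a (g1 b), d1)] [(a, la (g1 b) d1)]"
        using ab(1) d[OF m] g[OF m ab(2)] tensor_rel.balanced[of a A d1 B "g1 b" C ra la] by blast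
      then show "formal_eq ?R [(ra a (g1 b), d1)] [(a, la (g1 b) d1)]" by (rule formal_eq.base)
    qed
    note formal_eq.append[OF this Cons.IH[OF D']]
    ultimately have "formal_eq ?R [(a, la (g1 b) d1 + psum D' (\<lambda>g d. la (g b) d))]
        ([(ra a (g1 b), d1)] @ map (\<lambda>(g, d). (ra a (g b), d)) D')"
      by (rule formal_eq.trans)
    then show ?case by (simp add: gd)
  qed
  \<comment> \<open>The coefficients of one generator are added to those of the remaining sum.\<close>
  have 2: "set D' \<subseteq> set D \<Longrightarrow>
      formal_eq ?R (map (\<lambda>(g, d). (ra a (g b), d)) D' @ map (\<lambda>(g, d). (psum xs (\<lambda>a b. ra a (g b)), d)) D')
        (map (\<lambda>(g, d). (psum (x # xs) (\<lambda>a b. ra a (g b)), d)) D')" for D'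
  proof (induction D')
    case Nil then show ?case by (simp add: formal_eq.refl)
  next
    case (Cons gd D')
    obtain g1 d1 where gd: "gd = (g1, d1)" by fastforce
    have m: "(g1, d1) \<in> set D" and D': "set D' \<subseteq> set D" using Cons.prems gd by auto
    have s: "psum xs (\<lambda>a b. ra a (g1 b)) \<in> A"
    proof (rule psum_in[OF A])
      fix a b assume "(a, b) \<in> set xs"
      then have "a \<in> A" "b \<in> B" using xs by auto
      then show "ra a (g1 b) \<in> A" using ra[OF _ g[OF m]] by auto
    qed
    have l: "ra a (g1 b) \<in> A" by (rule ra[OF ab(1) g[OF m ab(2)]])
    have "formal_eq ?R [(ra a (g1 b), d1), (psum xs (\<lambda>a b. ra a (g1 b)), d1)]
        [(psum (x # xs) (\<lambda>a b. ra a (g1 b)), d1)]"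
      using tensor_rel.add_left[OF l s d[OF m], of C ra la] by (auto simp: x intro: formal_eq.base formal_eq.sym)
    from formal_eq.append[OF this Cons.IH[OF D']]
    have "formal_eq ?R ([(ra a (g1 b), d1), (psum xs (\<lambda>a b. ra a (g1 b)), d1)] @
        map (\<lambda>(g, d). (ra a (g b), d)) D' @ map (\<lambda>(g, d). (psum xs (\<lambda>a b. ra a (g b)), d)) D')
       (map (\<lambda>(g, d). (psum (x # xs) (\<lambda>a b. ra a (g b)), d)) (gd # D'))" by (simp add: gd)
    then show ?case
      by (rule formal_eq.trans[rotated], intro formal_eq_mset) (simp add: gd)
  qed
  have "formal_eq ?R [x] (map (\<lambda>(g, d). (ra a (g b), d)) D)" using 1[of D] ab D x by simp
  from formal_eq.append[OF this] Cons.IH[OF xs]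
  have "formal_eq ?R ([x] @ xs)
      (map (\<lambda>(g, d). (ra a (g b), d)) D @ map (\<lambda>(g, d). (psum xs (\<lambda>a b. ra a (g b)), d)) D)"
    unfolding tensor_eq_def by blast
  from formal_eq.trans[OF this 2[OF subset_refl]] show ?case
    by (simp add: tensor_eq_def del: psum_Cons)
qed

lemma tensor_eq_psum:
  fixes F :: "'a::ab_group_add \<Rightarrow> 'b::ab_group_add \<Rightarrow> 'd::ab_group_add"
  assumes "tensor_eq A B C ra la xs ys" and "0 \<in> A" "0 \<in> B"
    and "\<And>a a' b. a \<in> A \<Longrightarrow> a' \<in> A \<Longrightarrow> b \<in> B \<Longrightarrow> F (a + a') b = F a b + F a' b"
    and "\<And>a b b'. a \<in> A \<Longrightarrow> b \<in> B \<Longrightarrow> b' \<in> B \<Longrightarrow> F a (b + b') = F a b + F a b'"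
    and "\<And>a b c. a \<in> A \<Longrightarrow> b \<in> B \<Longrightarrow> c \<in> C \<Longrightarrow> F (ra a c) b = F a (la c b)"
  shows "psum xs F = psum ys F"
  unfolding psum_def
proof (rule formal_eq_sum_list[OF assms(1)[unfolded tensor_eq_def]])
  fix xs ys assume "tensor_rel A B C ra la xs ys"
  then show "(\<Sum>(x, y)\<leftarrow>xs. F x y) = (\<Sum>(x, y)\<leftarrow>ys. F x y)"
  proof cases
    case (zero_left b)
    with assms(4)[of 0 0 b] assms(2) show ?thesis by simp
  next
    case (zero_right a)
    with assms(5)[of a 0 0] assms(3) show ?thesis by simp
  qed (auto simp: assms)
qed

section \<open>Finite dimensional subspaces\<close>

definition fd_space :: "('k::field \<Rightarrow> 'a::ab_group_add \<Rightarrow> 'a) \<Rightarrow> 'a set \<Rightarrow> bool" where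
  "fd_space s V \<longleftrightarrow> vector_space s \<and> (\<exists>B. finite B \<and> V = module.span s B)"

definition bilinear_on ::
  "'a::ab_group_add set \<Rightarrow> ('k::field \<Rightarrow> 'a \<Rightarrow> 'a) \<Rightarrow> ('k \<Rightarrow> 'b::ab_group_add \<Rightarrow> 'b) \<Rightarrow> ('a \<Rightarrow> 'a \<Rightarrow> 'b) \<Rightarrow> bool" where
  "bilinear_on V s t F \<longleftrightarrow>
     (\<forall>x\<in>V. linear_on V s t (F x)) \<and> (\<forall>y\<in>V. linear_on V s t (\<lambda>x. F x y))"

definition trilinear_on ::
  "'a::ab_group_add set \<Rightarrow> ('k::field \<Rightarrow> 'a \<Rightarrow> 'a) \<Rightarrow> ('k \<Rightarrow> 'b::ab_group_add \<Rightarrow> 'b) \<Rightarrow> ('a \<Rightarrow> 'a \<Rightarrow> 'a \<Rightarrow> 'b) \<Rightarrow> bool" where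
  "trilinear_on V s t F \<longleftrightarrow>
     (\<forall>x\<in>V. bilinear_on V s t (F x)) \<and> (\<forall>z\<in>V. bilinear_on V s t (\<lambda>x y. F x y z))"

lemma fd_spaceD:
  assumes "fd_space s V"
  shows "vector_space s" "0 \<in> V" "x \<in> V \<Longrightarrow> y \<in> V \<Longrightarrow> x + y \<in> V" "x \<in> V \<Longrightarrow> s c x \<in> V"
    "x \<in> V \<Longrightarrow> y \<in> V \<Longrightarrow> x - y \<in> V"
proof -
  interpret vector_space s using assms unfolding fd_space_def by blast
  obtain B where V: "V = span B" using assms unfolding fd_space_def by blast
  show "vector_space s" "0 \<in> V" "x \<in> V \<Longrightarrow> y \<in> V \<Longrightarrow> x + y \<in> V" "x \<in> V \<Longrightarrow> s c x \<in> V"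
    "x \<in> V \<Longrightarrow> y \<in> V \<Longrightarrow> x - y \<in> V"
    by (simp_all add: V vector_space_axioms span_zero span_add span_scale span_diff)
qed

lemma linear_onD:
  assumes "linear_on V s t f"
  shows "x \<in> V \<Longrightarrow> y \<in> V \<Longrightarrow> f (x + y) = f x + f y" "x \<in> V \<Longrightarrow> f (s c x) = t c (f x)"
  using assms by (auto simp: linear_on_def)

lemma linear_on_subset: "linear_on V s t f \<Longrightarrow> U \<subseteq> V \<Longrightarrow> linear_on U s t f"
  unfolding linear_on_def by (meson subsetD)

lemma linear_on_psum:
  assumes "linear_on V s t f" "fd_space s V" "\<And>a b. (a, b) \<in> set xs \<Longrightarrow> F a b \<in> V"
  shows "f (psum xs F) = psum xs (\<lambda>a b. f (F a b))"
  using assms by (intro psum_hom_on[of V]) (auto simp: linear_on_def fd_spaceD)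

lemma linear_on_0: "linear_on V s t f \<Longrightarrow> 0 \<in> V \<Longrightarrow> f 0 = 0"
  by (auto simp: linear_on_def dest!: bspec[of _ _ 0])

lemma fd_space_dual_basis:
  assumes "fd_space s V"
  obtains D where "\<And>g d. (g, d) \<in> set D \<Longrightarrow> d \<in> V"
    "\<And>g d. (g, d) \<in> set D \<Longrightarrow> linear_on V s (*) g"
    "\<And>v. v \<in> V \<Longrightarrow> psum D (\<lambda>g d. s (g v) d) = v"
proof -
  interpret vector_space s using assms unfolding fd_space_def by blast
  obtain B0 where B0: "finite B0" "V = span B0" using assms unfolding fd_space_def by blast
  obtain B where B: "B \<subseteq> B0" "independent B" "span B = V"
    using maximal_independent_subset[of B0] B0 by (metis span_mono span_span subset_antisym)
  have fB: "finite B" using B B0 finite_subset by blast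
  obtain bs where bs: "set bs = B" "distinct bs" using finite_distinct_list[OF fB] by auto
  let ?D = "map (\<lambda>d. (\<lambda>v. representation B v d, d)) bs"
  have "psum ?D (\<lambda>g d. s (g v) d) = v" if "v \<in> V" for v
  proof -
    have "psum ?D (\<lambda>g d. s (g v) d) = (\<Sum>d\<leftarrow>bs. s (representation B v d) d)"
      by (simp add: psum_def comp_def)
    also have "\<dots> = (\<Sum>d\<in>B. s (representation B v d) d)"
      using bs sum_list_distinct_conv_sum_set by metis
    also have "\<dots> = v" using sum_representation_eq[OF B(2), of v B] that B fB by auto
    finally show ?thesis .
  qed
  moreover have "linear_on V s (*) (\<lambda>v. representation B v d)" for d
    unfolding linear_on_def using B representation_add representation_scale by auto
  moreover have "d \<in> V" if "d \<in> B" for d using B span_base that by auto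
  ultimately show ?thesis using bs by (intro that[of ?D]) auto
qed

lemma tensor2_eq_conv: "tensor2_eq s V = tensor_eq V V UNIV (\<lambda>v c. s c v) s"
  by (simp add: tensor2_eq_def tensor2_rel_def tensor_eq_def fun_eq_iff)

text \<open>
  Over a field it suffices to test a tensor equation with functionals on the second factor only,
  because the coefficients with respect to a dual basis of that factor are of this form.
\<close>
lemma tensor2_eqI:
  assumes "fd_space s V" "set xs \<subseteq> V \<times> V" "set ys \<subseteq> V \<times> V"
    and *: "\<And>g. linear_on V s (*) g \<Longrightarrow> psum xs (\<lambda>a b. s (g b) a) = psum ys (\<lambda>a b. s (g b) a)"
  shows "tensor2_eq s V xs ys"
proof -
  from fd_space_dual_basis[OF assms(1)] obtain D where
    D: "\<And>g d. (g, d) \<in> set D \<Longrightarrow> d \<in> V" "\<And>g d. (g, d) \<in> set D \<Longrightarrow> linear_on V s (*) g"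
    "\<And>v. v \<in> V \<Longrightarrow> psum D (\<lambda>g d. s (g v) d) = v" by metis
  have "tensor2_eq s V zs (map (\<lambda>(g, d). (psum zs (\<lambda>a b. s (g b) a), d)) D)" if "set zs \<subseteq> V \<times> V" for zs
    unfolding tensor2_eq_conv
    by (rule tensor_eq_expand) (use D that assms(1) in \<open>auto simp: fd_spaceD\<close>)
  note this[OF assms(2)] this[OF assms(3)]
  moreover have "map (\<lambda>(g, d). (psum xs (\<lambda>a b. s (g b) a), d)) D = map (\<lambda>(g, d). (psum ys (\<lambda>a b. s (g b) a), d)) D"
    using * D by auto
  ultimately show ?thesis unfolding tensor2_eq_def
    using formal_eq.trans[OF _ formal_eq.sym] by simp
qed

lemma tensor2_eq_psum:
  assumes "tensor2_eq s V xs ys" "0 \<in> V" "bilinear_on V s t F"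
  shows "psum xs F = psum ys F"
  using assms(1)[unfolded tensor2_eq_conv] assms(2,2)
  by (rule tensor_eq_psum) (use assms(3) in \<open>auto simp: bilinear_on_def linear_on_def\<close>)

lemma tensor2_eq_map:
  assumes "tensor2_eq s V xs ys" "linear_on V s t f" "f ` V \<subseteq> U" "0 \<in> V"
  shows "tensor2_eq t U (map (\<lambda>(a, b). (f a, f b)) xs) (map (\<lambda>(a, b). (f a, f b)) ys)"
  unfolding tensor2_eq_def
proof (rule formal_eq_map[OF assms(1)[unfolded tensor2_eq_def]])
  fix xs ys assume rel: "tensor2_rel s V xs ys"
  have "tensor_rel U U UNIV (\<lambda>v c. t c v) t (map (\<lambda>(a, b). (f a, f b)) xs) (map (\<lambda>(a, b). (f a, f b)) ys)"
    using rel[unfolded tensor2_rel_def]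
  proof cases
    case (balanced a b c)
    then show ?thesis
      using assms(2,3) tensor_rel.balanced[of "f a" U "f b" U c UNIV "\<lambda>v c. t c v" t] by (auto simp: linear_on_def)
  qed (use assms in \<open>auto simp: linear_on_0 linear_on_def intro: tensor_rel.intros(1-4)\<close>)
  then show "formal_eq (tensor2_rel t U) (map (\<lambda>(a, b). (f a, f b)) xs) (map (\<lambda>(a, b). (f a, f b)) ys)"
    by (intro formal_eq.base) (simp add: tensor2_rel_def)
qed

definition tsum :: "('a \<times> 'b \<times> 'c) list \<Rightarrow> ('a \<Rightarrow> 'b \<Rightarrow> 'c \<Rightarrow> 'd::comm_monoid_add) \<Rightarrow> 'd" where
  "tsum xs F = (\<Sum>(a, b, c)\<leftarrow>xs. F a b c)"

lemma tsum_simps [simp]: "tsum [] F = 0" "tsum ((a, b, c) # xs) F = F a b c + tsum xs F"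
  "tsum (xs @ ys) F = tsum xs F + tsum ys F"
  by (simp_all add: tsum_def)

lemma tsum_map: "tsum (map (\<lambda>(a, b). (f a b, g a b, h a b)) xs) F = psum xs (\<lambda>a b. F (f a b) (g a b) (h a b))"
  by (induction xs) auto

lemma tsum_map_Pair: "tsum (map (Pair a) xs) T = psum xs (T a)"
  by (induction xs) auto

lemma tsum_concat: "tsum (concat (map (\<lambda>(a, b). h a b) xs)) F = psum xs (\<lambda>a b. tsum (h a b) F)"
  by (induction xs) auto

lemma tensor3_eq_tsum:
  assumes "tensor3_eq s V xs ys" "0 \<in> V" "trilinear_on V s t F"
  shows "tsum xs F = tsum ys F"
  unfolding tsum_def
proof (rule formal_eq_sum_list[OF assms(1)[unfolded tensor3_eq_def]])
  fix xs ys assume "tensor3_rel s V xs ys"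
  then have "tsum xs F = tsum ys F"
  proof cases
    case (slots_12 xs' ys' c)
    then have "psum xs' (\<lambda>a b. F a b c) = psum ys' (\<lambda>a b. F a b c)"
      using assms by (intro tensor2_eq_psum[of s V _ _ t])
        (auto simp: trilinear_on_def tensor2_eq_def intro: formal_eq.base)
    then show ?thesis using slots_12 by (simp add: tsum_map)
  next
    case (slots_23 xs' ys' a)
    then have "psum xs' (\<lambda>b c. F a b c) = psum ys' (\<lambda>b c. F a b c)"
      using assms by (intro tensor2_eq_psum[of s V _ _ t])
        (auto simp: trilinear_on_def tensor2_eq_def intro: formal_eq.base)
    then show ?thesis using slots_23 by (simp add: tsum_def psum_def comp_def case_prod_unfold)
  qed
  then show "(\<Sum>(a, b, c)\<leftarrow>xs. F a b c) = (\<Sum>(a, b, c)\<leftarrow>ys. F a b c)" by (simp add: tsum_def)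
qed

lemma tensor3_eq_slots:
  assumes "tensor2_eq s V xs ys" "v \<in> V"
  shows "tensor3_eq s V (map (\<lambda>(a, b). (a, b, v)) xs) (map (\<lambda>(a, b). (a, b, v)) ys)"
    and "tensor3_eq s V (map (\<lambda>(b, c). (v, b, c)) xs) (map (\<lambda>(b, c). (v, b, c)) ys)"
  unfolding tensor3_eq_def
  by (rule formal_eq_map[OF assms(1)[unfolded tensor2_eq_def]],
      rule formal_eq.base, erule tensor3_rel.intros[OF _ assms(2)])+

text \<open>
  As for two factors: expanding the last factor along a dual basis reduces the claim to the equality
  of the two-fold tensors \<open>\<Sum> g(c) a \<otimes> b\<close>, one for each coordinate \<open>g\<close>.
\<close>
lemma tensor3_eqI:
  fixes s :: "'k::field \<Rightarrow> 'a::ab_group_add \<Rightarrow> 'a"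
  assumes fd: "fd_space s V" and "set xs \<subseteq> V \<times> V \<times> V" "set ys \<subseteq> V \<times> V \<times> V"
    and *: "\<And>g h. linear_on V s (*) g \<Longrightarrow> linear_on V s (*) h \<Longrightarrow>
      tsum xs (\<lambda>a b c. s (g b * h c) a) = tsum ys (\<lambda>a b c. s (g b * h c) a)"
  shows "tensor3_eq s V xs ys"
proof -
  from fd_space_dual_basis[OF assms(1)] obtain D where
    D: "\<And>g d. (g, d) \<in> set D \<Longrightarrow> d \<in> V" "\<And>g d. (g, d) \<in> set D \<Longrightarrow> linear_on V s (*) g"
    "\<And>v. v \<in> V \<Longrightarrow> psum D (\<lambda>g d. s (g v) d) = v" by metis
  define P where "P zs g = map (\<lambda>(a, b, c). (a, s (g c) b)) zs" for zs :: "('a \<times> 'a \<times> 'a) list" and g :: "'a \<Rightarrow> 'k"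
  define Q where "Q zs = concat (map (\<lambda>(g, d). map (\<lambda>(a, b). (a, b, d)) (P zs g)) D)" for zs
  have exp: "tensor3_eq s V zs (Q zs)" if "set zs \<subseteq> V \<times> V \<times> V" for zs
    using that
  proof (induction zs)
    case Nil
    have "Q [] = []" by (auto simp: Q_def P_def concat_eq_Nil_conv)
    then show ?case by (simp add: tensor3_eq_def formal_eq.refl)
  next
    case (Cons z zs)
    obtain a b c where z: "z = (a, b, c)" by (cases z) auto
    have abc: "a \<in> V" "b \<in> V" "c \<in> V" using Cons.prems z by auto
    have "tensor2_eq s V [(b, c)] (map (\<lambda>(g, d). (psum [(b, c)] (\<lambda>a b. s (g b) a), d)) D)"
      unfolding tensor2_eq_conv by (rule tensor_eq_expand) (use D abc fd in \<open>auto simp: fd_spaceD\<close>)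
    from tensor3_eq_slots(2)[OF this abc(1)]
    have "tensor3_eq s V [z] (map (\<lambda>(g, d). (a, s (g c) b, d)) D)"
      by (simp add: z comp_def case_prod_unfold)
    from formal_eq.append[OF this[unfolded tensor3_eq_def] Cons.IH[unfolded tensor3_eq_def]] Cons.prems
    have "formal_eq (tensor3_rel s V) (z # zs) (map (\<lambda>(g, d). (a, s (g c) b, d)) D @ Q zs)" by simp
    moreover have "mset (map (\<lambda>(g, d). (a, s (g c) b, d)) D' @
        concat (map (\<lambda>(g, d). map (\<lambda>(a, b). (a, b, d)) (P zs g)) D')) =
      mset (concat (map (\<lambda>(g, d). map (\<lambda>(a, b). (a, b, d)) (P (z # zs) g)) D'))" for D'
      by (induction D') (auto simp: P_def z)
    then have "formal_eq (tensor3_rel s V) (map (\<lambda>(g, d). (a, s (g c) b, d)) D @ Q zs) (Q (z # zs))"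
      unfolding Q_def by (rule formal_eq_mset)
    ultimately show ?case unfolding tensor3_eq_def by (rule formal_eq.trans)
  qed
  have "tensor3_eq s V (Q xs) (Q ys)"
    unfolding tensor3_eq_def Q_def
  proof (rule formal_eq_concat2)
    fix gd assume gd: "gd \<in> set D"
    obtain g d where [simp]: "gd = (g, d)" by fastforce
    have PV: "set (P zs g) \<subseteq> V \<times> V" if "set zs \<subseteq> V \<times> V \<times> V" for zs
      using that by (auto simp: P_def fd_spaceD[OF fd])
    have Psum: "psum (P zs g) (\<lambda>a b. s (h b) a) = tsum zs (\<lambda>a b c. s (h b * g c) a)"
      if h: "linear_on V s (*) h" and "set zs \<subseteq> V \<times> V \<times> V" for h zs
      using that(2)
    proof (induction zs)
      case (Cons z zs)
      then show ?case by (cases z) (simp add: P_def linear_onD(2)[OF h] mult.commute)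
    qed (simp add: P_def)
    have "tensor2_eq s V (P xs g) (P ys g)"
    proof (rule tensor2_eqI[OF fd PV[OF assms(2)] PV[OF assms(3)]])
      fix h assume h: "linear_on V s (*) h"
      show "psum (P xs g) (\<lambda>a b. s (h b) a) = psum (P ys g) (\<lambda>a b. s (h b) a)"
        unfolding Psum[OF h assms(2)] Psum[OF h assms(3)] using gd by (intro *[OF h] D) simp
    qed
    moreover have "d \<in> V" using gd by (intro D(1)[of g]) simp
    ultimately have "tensor3_eq s V (map (\<lambda>(a, b). (a, b, d)) (P xs g)) (map (\<lambda>(a, b). (a, b, d)) (P ys g))"
      by (rule tensor3_eq_slots)
    then show "formal_eq (tensor3_rel s V) (case gd of (g, d) \<Rightarrow> map (\<lambda>(a, b). (a, b, d)) (P xs g))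
         (case gd of (g, d) \<Rightarrow> map (\<lambda>(a, b). (a, b, d)) (P ys g))"
      by (simp add: tensor3_eq_def)
  qed
  note formal_eq.trans[OF this[unfolded tensor3_eq_def]
    formal_eq.sym[OF exp[OF assms(3), unfolded tensor3_eq_def]]]
  with exp[OF assms(2)] show ?thesis unfolding tensor3_eq_def by (rule formal_eq.trans)
qed

section \<open>Bimodule endomorphisms of a depth two Frobenius extension\<close>

definition bimodule_end :: "'m::ring_1 set \<Rightarrow> ('m \<Rightarrow> 'm) set" where
  "bimodule_end N = {f. (\<forall>x y. f (x + y) = f x + f y) \<and> (\<forall>n\<in>N. \<forall>x. f (n * x) = n * f x \<and> f (x * n) = f x * n)}"

text \<open>
  Biadditive maps on \<open>M \<times> M\<close> that factor through \<open>M \<otimes>\<^sub>N M\<close>.  Identities in \<open>M \<otimes>\<^sub>N M\<close> enter the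
  argument only through the values of such maps.
\<close>
definition balanced_map :: "'m::ring_1 set \<Rightarrow> ('m \<Rightarrow> 'm \<Rightarrow> 'm) \<Rightarrow> bool" where
  "balanced_map N H \<longleftrightarrow> (\<forall>x x' y. H (x + x') y = H x y + H x' y) \<and>
     (\<forall>x y y'. H x (y + y') = H x y + H x y') \<and> (\<forall>x y. \<forall>n\<in>N. H (x * n) y = H x (n * y))"

text \<open>
  The formal sum \<open>t\<close> represents an element of \<open>(M \<otimes>\<^sub>N M)\<^sup>N\<close>.
\<close>
definition central_tensor :: "'m::ring_1 set \<Rightarrow> ('m \<times> 'm) list \<Rightarrow> bool" where
  "central_tensor N t \<longleftrightarrow> (\<forall>H n. balanced_map N H \<longrightarrow> n \<in> N \<longrightarrow>
     psum t (\<lambda>p q. H (n * p) q) = psum t (\<lambda>p q. H p (q * n)))"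

text \<open>
  \<open>y \<otimes> 1 = \<Sum> t \<cdot> \<beta>(y)\<close> in \<open>M \<otimes>\<^sub>N M\<close>, which is what it means that the \<open>N\<close>-\<open>M\<close>-bimodule
  \<open>M \<otimes>\<^sub>N M\<close> is a direct summand of a power of \<open>M\<close>.
\<close>
definition left_depth_two_quasibasis :: "'m::ring_1 set \<Rightarrow> (('m \<times> 'm) list \<times> ('m \<Rightarrow> 'm)) list \<Rightarrow> bool" where
  "left_depth_two_quasibasis N tb \<longleftrightarrow> (\<forall>t \<beta>. (t, \<beta>) \<in> set tb \<longrightarrow> central_tensor N t \<and> \<beta> \<in> bimodule_end N) \<and>
     (\<forall>H y. balanced_map N H \<longrightarrow> psum tb (\<lambda>t \<beta>. psum t (\<lambda>p q. H p (q * \<beta> y))) = H y 1)"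

text \<open>
  \<open>1 \<otimes> y = \<Sum> \<gamma>(y) \<cdot> u\<close>, the same for the \<open>M\<close>-\<open>N\<close>-bimodule.
\<close>
definition right_depth_two_quasibasis :: "'m::ring_1 set \<Rightarrow> (('m \<times> 'm) list \<times> ('m \<Rightarrow> 'm)) list \<Rightarrow> bool" where
  "right_depth_two_quasibasis N ub \<longleftrightarrow> (\<forall>u \<gamma>. (u, \<gamma>) \<in> set ub \<longrightarrow> central_tensor N u \<and> \<gamma> \<in> bimodule_end N) \<and>
     (\<forall>H y. balanced_map N H \<longrightarrow> psum ub (\<lambda>u \<gamma>. psum u (\<lambda>p q. H (\<gamma> y * p) q)) = H 1 y)"

text \<open>
  The data extracted from the hypotheses: \<open>mb\<close> is a quasibasis \<open>\<Sum> m\<^sub>j \<otimes> m\<^sup>j\<close> of \<open>\<phi>\<close>, and \<open>eb\<close> is a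
  quasibasis \<open>\<Sum> e\<^sub>i \<otimes> e\<^sup>i\<close> of the restriction of \<open>\<phi>\<close> to the centralizer.
\<close>
locale depth_two_frobenius =
  fixes s :: "'k::field \<Rightarrow> 'm::ring_1 \<Rightarrow> 'm" and N :: "'m set" and \<phi> :: "'m \<Rightarrow> 'm"
    and mb eb :: "('m \<times> 'm) list" and tb ub :: "(('m \<times> 'm) list \<times> ('m \<Rightarrow> 'm)) list"
  assumes alg: "k_algebra s" and sub: "subalgebra s N"
    and phi_N: "\<phi> x \<in> N"
    and phi_add: "\<phi> (x + y) = \<phi> x + \<phi> y"
    and phi_left: "n \<in> N \<Longrightarrow> \<phi> (n * x) = n * \<phi> x"
    and phi_right: "n \<in> N \<Longrightarrow> \<phi> (x * n) = \<phi> x * n"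
    and phi_R: "r \<in> centralizer UNIV N \<Longrightarrow> \<phi> r \<in> scalars s"
    and mb_left: "psum mb (\<lambda>m m'. m * \<phi> (m' * x)) = x"
    and mb_right: "psum mb (\<lambda>m m'. \<phi> (x * m) * m') = x"
    and eb_R: "(e, e') \<in> set eb \<Longrightarrow> e \<in> centralizer UNIV N \<and> e' \<in> centralizer UNIV N"
    and eb_left: "r \<in> centralizer UNIV N \<Longrightarrow> psum eb (\<lambda>e e'. e * \<phi> (e' * r)) = r"
    and eb_right: "r \<in> centralizer UNIV N \<Longrightarrow> psum eb (\<lambda>e e'. \<phi> (r * e) * e') = r"
    and eb_index: "psum eb (\<lambda>e e'. e * e') = 1"
    and tb: "left_depth_two_quasibasis N tb"
    and ub: "right_depth_two_quasibasis N ub"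
begin

abbreviation R :: "'m set" where "R \<equiv> centralizer UNIV N"
abbreviation E :: "('m \<Rightarrow> 'm) set" where "E \<equiv> bimodule_end N"

lemma tb_end: "(t, \<beta>) \<in> set tb \<Longrightarrow> \<beta> \<in> E" and tb_central: "(t, \<beta>) \<in> set tb \<Longrightarrow> central_tensor N t"
  and tb_basis: "balanced_map N H \<Longrightarrow> psum tb (\<lambda>t \<beta>. psum t (\<lambda>p q. H p (q * \<beta> y))) = H y 1"
  using tb by (auto simp: left_depth_two_quasibasis_def)

lemma ub_central: "(u, \<gamma>) \<in> set ub \<Longrightarrow> central_tensor N u"
  and ub_basis: "balanced_map N H \<Longrightarrow> psum ub (\<lambda>u \<gamma>. psum u (\<lambda>p q. H (\<gamma> y * p) q)) = H 1 y"
  using ub by (auto simp: right_depth_two_quasibasis_def)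

sublocale vs: vector_space s using alg by (simp add: k_algebra_def)

lemma s_mult_left: "s a x * y = s a (x * y)" and s_mult_right: "x * s a y = s a (x * y)"
  using alg by (auto simp: k_algebra_def)

lemma s_one_mult: "s a 1 * x = s a x" "x * s a 1 = s a x"
  by (simp_all add: s_mult_left s_mult_right)

lemma s_N: "s a 1 \<in> N"
  using sub vs.subspace_scale by (auto simp: subalgebra_def)

lemma R_commute: "r \<in> R \<Longrightarrow> n \<in> N \<Longrightarrow> r * n = n * r"
  by (simp add: centralizer_def)

lemma R_0: "0 \<in> R" and R_1: "1 \<in> R" and R_add: "r \<in> R \<Longrightarrow> r' \<in> R \<Longrightarrow> r + r' \<in> R"
  and R_scale: "r \<in> R \<Longrightarrow> s c r \<in> R"
  by (auto simp: centralizer_def algebra_simps s_mult_left s_mult_right)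

lemma R_mult: "r \<in> R \<Longrightarrow> r' \<in> R \<Longrightarrow> r * r' \<in> R"
  by (auto simp: centralizer_def) (metis mult.assoc)

lemma EI:
  assumes "\<And>x y. f (x + y) = f x + f y" "\<And>n x. n \<in> N \<Longrightarrow> f (n * x) = n * f x" "\<And>n x. n \<in> N \<Longrightarrow> f (x * n) = f x * n"
  shows "f \<in> E"
  using assms by (simp add: bimodule_end_def)

lemma ED:
  assumes "f \<in> E"
  shows "f (x + y) = f x + f y" "n \<in> N \<Longrightarrow> f (n * x) = n * f x" "n \<in> N \<Longrightarrow> f (x * n) = f x * n"
  using assms by (simp_all add: bimodule_end_def)

lemma E_scale: assumes "f \<in> E" shows "f (s c x) = s c (f x)"
  using ED(2)[OF assms s_N[of c], of x] by (simp add: s_one_mult)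

lemma E_psum: "f \<in> E \<Longrightarrow> f (psum xs F) = psum xs (\<lambda>a b. f (F a b))"
  by (rule psum_hom) (rule ED)

lemma E_R: assumes "f \<in> E" "r \<in> R" shows "f r \<in> R"
  unfolding centralizer_def using ED(2,3)[OF assms(1), symmetric] R_commute[OF assms(2)] by auto

lemma E_id: "(\<lambda>x. x) \<in> E" "id \<in> E"
  by (auto intro: EI)

lemma E_comp: "f \<in> E \<Longrightarrow> g \<in> E \<Longrightarrow> (\<lambda>x. f (g x)) \<in> E"
  by (auto intro!: EI simp: ED)

lemma E_left: "f \<in> E \<Longrightarrow> r \<in> R \<Longrightarrow> (\<lambda>x. r * f x) \<in> E"
  by (rule EI) (simp_all add: ED algebra_simps R_commute flip: mult.assoc)

lemma E_right: "f \<in> E \<Longrightarrow> r \<in> R \<Longrightarrow> (\<lambda>x. f x * r) \<in> E"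
  by (rule EI) (simp_all add: ED algebra_simps R_commute)

lemma E_add: "f \<in> E \<Longrightarrow> g \<in> E \<Longrightarrow> (\<lambda>x. f x + g x) \<in> E"
  by (auto intro!: EI simp: ED algebra_simps)

lemma E_zero: "(\<lambda>x. 0) \<in> E"
  by (auto intro!: EI)

lemma E_smult: "f \<in> E \<Longrightarrow> (\<lambda>x. s c (f x)) \<in> E"
  using E_left[of f "s c 1"] R_1 R_scale by (simp add: s_one_mult)

lemma E_psumI: "(\<And>a b. (a, b) \<in> set xs \<Longrightarrow> F a b \<in> E) \<Longrightarrow> (\<lambda>x. psum xs (\<lambda>a b. F a b x)) \<in> E"
  by (induction xs) (auto intro!: E_zero E_add)

lemma balanced_mapI:
  assumes "\<And>x x' y. H (x + x') y = H x y + H x' y" "\<And>x y y'. H x (y + y') = H x y + H x y'"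
    "\<And>x y n. n \<in> N \<Longrightarrow> H (x * n) y = H x (n * y)"
  shows "balanced_map N H"
  using assms by (simp add: balanced_map_def)

lemma balanced_mult: "f \<in> E \<Longrightarrow> balanced_map N (\<lambda>p q. f (x * p) * q)"
  by (rule balanced_mapI) (simp_all add: ED algebra_simps flip: mult.assoc)

text \<open>
  The coordinate of an element of \<open>K = K 1\<close>.  Other elements of \<open>M\<close> get an arbitrary value.
\<close>
definition kap :: "'m \<Rightarrow> 'k" where "kap x = (SOME c. x = s c 1)"

lemma kap_R: "r \<in> R \<Longrightarrow> s (kap (\<phi> r)) x = \<phi> r * x" "r \<in> R \<Longrightarrow> s (kap (\<phi> r)) x = x * \<phi> r"
proof -
  assume "r \<in> R"
  then have "\<exists>c. \<phi> r = s c 1" using phi_R by (auto simp: scalars_def)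
  then have "\<phi> r = s (kap (\<phi> r)) 1" unfolding kap_def by (rule someI_ex)
  then show "s (kap (\<phi> r)) x = \<phi> r * x" "s (kap (\<phi> r)) x = x * \<phi> r"
    by (metis s_one_mult)+
qed

lemma s_inj: "s a 1 = s b 1 \<Longrightarrow> a = b"
  by (simp add: vs.scale_cancel_right)

lemma kap_s: "kap (s c 1) = c"
proof -
  have "\<exists>d. s c 1 = s d 1" by blast
  then have "s c 1 = s (kap (s c 1)) 1" unfolding kap_def by (rule someI_ex)
  then show ?thesis using s_inj by metis
qed

lemma kap_one: "r \<in> R \<Longrightarrow> s (kap (\<phi> r)) 1 = \<phi> r"
  using kap_R(1)[of r 1] by simp

lemma kap_add: "r \<in> R \<Longrightarrow> r' \<in> R \<Longrightarrow> kap (\<phi> (r + r')) = kap (\<phi> r) + kap (\<phi> r')"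
  by (rule s_inj, simp only: vs.scale_left_distrib kap_one R_add, rule phi_add)

lemma phi_scale: "\<phi> (s c x) = s c (\<phi> x)"
  using phi_left[OF s_N[of c], of x] by (simp add: s_one_mult)

lemma kap_scale: "r \<in> R \<Longrightarrow> kap (\<phi> (s c r)) = c * kap (\<phi> r)"
  by (rule s_inj, simp only: kap_one R_scale flip: vs.scale_scale, rule phi_scale)

lemma phi_right': "n \<in> N \<Longrightarrow> \<phi> (x * (y * n)) = \<phi> (x * y) * n"
  using phi_right[of n "x * y"] by (simp add: mult.assoc)

lemma phi_left': "n \<in> N \<Longrightarrow> \<phi> (n * x * y) = n * \<phi> (x * y)"
  using phi_left[of n "x * y"] by (simp add: mult.assoc)

lemma phi_psum: "\<phi> (psum xs F) = psum xs (\<lambda>a b. \<phi> (F a b))"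
  by (rule psum_hom) (rule phi_add)

lemma phi_E: "\<phi> \<in> E"
  by (rule EI) (simp_all add: phi_add phi_left phi_right)

lemma phi_nondegenerate:
  assumes "\<And>x. \<phi> (x * y) = \<phi> (x * y')"
  shows "y = y'"
proof -
  have "y = psum mb (\<lambda>m m'. m * \<phi> (m' * y'))" by (simp only: mb_left flip: assms)
  then show ?thesis by (simp only: mb_left)
qed

text \<open>
  \<open>\<Sum> r e\<^sub>i \<otimes> e\<^sup>i = \<Sum> e\<^sub>i \<otimes> e\<^sup>i r\<close> in \<open>R \<otimes>\<^sub>K R\<close>: expand \<open>r e\<^sub>i\<close> along the quasibasis, move the
  scalars \<open>\<phi>(e\<^sup>j r e\<^sub>i)\<close> to the other factor and collect \<open>e\<^sup>j r\<close> there.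
\<close>
lemma eb_casimir:
  fixes B :: "'m \<Rightarrow> 'm \<Rightarrow> 'z::ab_group_add"
  assumes r: "r \<in> R"
    and l: "\<And>x y z. x \<in> R \<Longrightarrow> y \<in> R \<Longrightarrow> z \<in> R \<Longrightarrow> B (x + y) z = B x z + B y z"
    and rr: "\<And>x y z. x \<in> R \<Longrightarrow> y \<in> R \<Longrightarrow> z \<in> R \<Longrightarrow> B z (x + y) = B z x + B z y"
    and k: "\<And>x y c. x \<in> R \<Longrightarrow> y \<in> R \<Longrightarrow> B (s c x) y = B x (s c y)"
  shows "psum eb (\<lambda>e e'. B (r * e) e') = psum eb (\<lambda>e e'. B e (e' * r))"
proof -
  have "psum eb (\<lambda>e e'. B (r * e) e') = psum eb (\<lambda>e e'. psum eb (\<lambda>d d'. B d (s (kap (\<phi> (d' * (r * e)))) e')))"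
  proof (rule psum_cong)
    fix e e' assume e: "(e, e') \<in> set eb"
    have re: "r * e \<in> R" using e eb_R r R_mult by blast
    have "psum eb (\<lambda>d d'. s (kap (\<phi> (d' * (r * e)))) d) = psum eb (\<lambda>d d'. d * \<phi> (d' * (r * e)))"
      using eb_R re by (intro psum_cong kap_R(2) R_mult[OF _ re]) auto
    then have "B (r * e) e' = B (psum eb (\<lambda>d d'. s (kap (\<phi> (d' * (r * e)))) d)) e'"
      using eb_left[OF re] by simp
    also have "\<dots> = psum eb (\<lambda>d d'. B (s (kap (\<phi> (d' * (r * e)))) d) e')"
      using e eb_R by (intro psum_hom_on[of R "\<lambda>x. B x e'"]) (auto intro: R_0 R_add R_scale l)
    also have "\<dots> = psum eb (\<lambda>d d'. B d (s (kap (\<phi> (d' * (r * e)))) e'))"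
      using e eb_R by (intro psum_cong k) auto
    finally show "B (r * e) e' = psum eb (\<lambda>d d'. B d (s (kap (\<phi> (d' * (r * e)))) e'))" .
  qed
  also have "\<dots> = psum eb (\<lambda>d d'. psum eb (\<lambda>e e'. B d (s (kap (\<phi> (d' * (r * e)))) e')))"
    by (rule psum_swap)
  also have "\<dots> = psum eb (\<lambda>d d'. B d (d' * r))"
  proof (rule psum_cong)
    fix d d' assume d: "(d, d') \<in> set eb"
    have dr: "d' * r \<in> R" using d eb_R r R_mult by blast
    have "psum eb (\<lambda>e e'. B d (s (kap (\<phi> (d' * (r * e)))) e')) = B d (psum eb (\<lambda>e e'. s (kap (\<phi> (d' * (r * e)))) e'))"
      using d eb_R by (intro psum_hom_on[of R "B d", symmetric]) (auto intro: R_0 R_add R_scale rr)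
    also have "psum eb (\<lambda>e e'. s (kap (\<phi> (d' * (r * e)))) e') = psum eb (\<lambda>e e'. \<phi> (d' * r * e) * e')"
    proof (rule psum_cong)
      fix e e' assume "(e, e') \<in> set eb"
      then have "d' * r * e \<in> R" using eb_R R_mult dr by blast
      then show "s (kap (\<phi> (d' * (r * e)))) e' = \<phi> (d' * r * e) * e'"
        using kap_R(1)[of "d' * r * e" e'] by (simp add: mult.assoc)
    qed
    also have "\<dots> = d' * r" by (rule eb_right[OF dr])
    finally show "psum eb (\<lambda>e e'. B d (s (kap (\<phi> (d' * (r * e)))) e')) = B d (d' * r)" .
  qed
  finally show ?thesis .
qed

text \<open>
  The adjoint with respect to \<open>\<phi>\<close>.  The formula is forced: it expands \<open>S(a)(y)\<close> along the
  quasibasis of \<open>\<phi>\<close> and uses \<open>\<phi>(m\<^sup>j S(a)(y)) = \<phi>(a(m\<^sup>j) y)\<close>.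
\<close>
definition adj :: "('m \<Rightarrow> 'm) \<Rightarrow> 'm \<Rightarrow> 'm" where
  "adj a y = psum mb (\<lambda>m m'. m * \<phi> (a m' * y))"

lemma phi_adj:
  assumes a: "a \<in> E"
  shows "\<phi> (a x * y) = \<phi> (x * adj a y)"
proof -
  have "\<phi> (x * adj a y) = psum mb (\<lambda>m m'. \<phi> (x * m * \<phi> (a m' * y)))"
    by (simp add: adj_def phi_psum mult.assoc flip: psum_mult_left)
  also have "\<dots> = psum mb (\<lambda>m m'. \<phi> (a (\<phi> (x * m) * m') * y))"
    by (intro psum_cong) (simp add: phi_N phi_right phi_left' ED[OF a])
  also have "\<dots> = \<phi> (a (psum mb (\<lambda>m m'. \<phi> (x * m) * m')) * y)"
    by (simp add: E_psum[OF a] phi_psum flip: psum_mult_right)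
  also have "\<dots> = \<phi> (a x * y)" by (simp add: mb_right)
  finally show ?thesis by simp
qed

lemma adj_E: assumes a: "a \<in> E" shows "adj a \<in> E"
proof (rule EI)
  show "adj a (x + y) = adj a x + adj a y" for x y
    by (rule phi_nondegenerate) (simp add: distrib_left phi_add flip: phi_adj[OF a])
  show "adj a (n * y) = n * adj a y" if "n \<in> N" for n y
  proof (rule phi_nondegenerate)
    fix x
    have "\<phi> (x * adj a (n * y)) = \<phi> (a x * (n * y))" by (rule phi_adj[OF a, symmetric])
    also have "\<dots> = \<phi> (a (x * n) * y)" by (simp only: ED(3)[OF a that] mult.assoc)
    also have "\<dots> = \<phi> (x * (n * adj a y))" by (simp only: phi_adj[OF a] mult.assoc)
    finally show "\<phi> (x * adj a (n * y)) = \<phi> (x * (n * adj a y))" .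
  qed
  show "adj a (y * n) = adj a y * n" if "n \<in> N" for n y
  proof (rule phi_nondegenerate)
    fix x
    have "\<phi> (x * adj a (y * n)) = \<phi> (a x * (y * n))" by (rule phi_adj[OF a, symmetric])
    also have "\<dots> = \<phi> (x * adj a y) * n" by (simp only: phi_right'[OF that] phi_adj[OF a])
    also have "\<dots> = \<phi> (x * (adj a y * n))" by (rule phi_right'[OF that, symmetric])
    finally show "\<phi> (x * adj a (y * n)) = \<phi> (x * (adj a y * n))" .
  qed
qed

text \<open>
  So every bimodule map \<open>\<phi> \<circ> a\<close> from \<open>M\<close> to \<open>N\<close> is \<open>\<phi>\<close> preceded by a right multiplication from \<open>R\<close>.
\<close>
lemma phi_adj_one: "a \<in> E \<Longrightarrow> \<phi> (a x) = \<phi> (x * adj a 1)"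
  using phi_adj[of a x 1] by simp

lemma adj_one_R: "a \<in> E \<Longrightarrow> adj a 1 \<in> R"
  by (simp add: adj_E E_R R_1)

definition proj :: "'m \<Rightarrow> 'm" where
  "proj z = psum eb (\<lambda>e e'. e * \<phi> (e' * z))"

text \<open>
  The map \<open>z \<mapsto> \<phi>(e\<^sup>i \<beta>(z))\<close> is \<open>z \<mapsto> \<phi>(z r\<^sub>i)\<close> for some \<open>r\<^sub>i \<in> R\<close>.  Expanding \<open>r\<^sub>i\<close> along the
  quasibasis of \<open>R\<close>, the scalars \<open>\<phi>(e\<^sup>j r\<^sub>i) = \<phi>(e\<^sup>i \<beta>(e\<^sup>j))\<close> sum up to \<open>\<beta>(e\<^sup>j)\<close>.
\<close>
lemma proj_apply:
  assumes b: "\<beta> \<in> E"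
  shows "proj (\<beta> z) = psum eb (\<lambda>e e'. \<phi> (z * e) * \<beta> e')"
proof -
  define r where "r e' = adj (\<lambda>x. e' * \<beta> x) 1" for e'
  have Lb: "(\<lambda>x. e' * \<beta> x) \<in> E" if "(e, e') \<in> set eb" for e e'
    using that eb_R b by (intro E_left) auto
  have r: "r e' \<in> R" "\<phi> (e' * \<beta> x) = \<phi> (x * r e')" if "(e, e') \<in> set eb" for e e' x
    unfolding r_def using phi_adj_one[OF Lb[OF that], of x] adj_one_R[OF Lb[OF that]] by auto
  have "proj (\<beta> z) = psum eb (\<lambda>e e'. e * \<phi> (z * r e'))"
    unfolding proj_def by (intro psum_cong) (simp add: r)
  also have "\<dots> = psum eb (\<lambda>e e'. psum eb (\<lambda>d d'. \<phi> (z * d) * (e * \<phi> (d' * r e'))))"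
  proof (rule psum_cong)
    fix e e' assume e: "(e, e') \<in> set eb"
    have "\<phi> (z * r e') = \<phi> (z * psum eb (\<lambda>d d'. d * \<phi> (d' * r e')))"
      using r[OF e] eb_left by simp
    also have "\<dots> = psum eb (\<lambda>d d'. \<phi> (z * d) * \<phi> (d' * r e'))"
      by (simp add: phi_psum phi_right phi_N flip: psum_mult_left mult.assoc)
    finally have "e * \<phi> (z * r e') = psum eb (\<lambda>d d'. e * \<phi> (z * d) * \<phi> (d' * r e'))"
      by (simp add: mult.assoc flip: psum_mult_left)
    also have "\<dots> = psum eb (\<lambda>d d'. \<phi> (z * d) * (e * \<phi> (d' * r e')))"
      using R_commute[of e] e eb_R by (intro psum_cong) (auto simp: phi_N mult.assoc)
    finally show "e * \<phi> (z * r e') = psum eb (\<lambda>d d'. \<phi> (z * d) * (e * \<phi> (d' * r e')))" .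
  qed
  also have "\<dots> = psum eb (\<lambda>d d'. \<phi> (z * d) * psum eb (\<lambda>e e'. e * \<phi> (d' * r e')))"
    by (subst psum_swap) (simp add: psum_mult_left)
  also have "\<dots> = psum eb (\<lambda>d d'. \<phi> (z * d) * \<beta> d')"
  proof (rule psum_cong)
    fix d d' assume d: "(d, d') \<in> set eb"
    have "psum eb (\<lambda>e e'. e * \<phi> (d' * r e')) = psum eb (\<lambda>e e'. e * \<phi> (e' * \<beta> d'))"
      by (intro psum_cong) (simp add: r)
    also have "\<dots> = \<beta> d'" using d eb_R E_R[OF b] by (intro eb_left) auto
    finally show "\<phi> (z * d) * psum eb (\<lambda>e e'. e * \<phi> (d' * r e')) = \<phi> (z * d) * \<beta> d'" by simp
  qed
  finally show ?thesis .
qed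

lemma proj_alt: "proj z = psum eb (\<lambda>e e'. \<phi> (z * e) * e')"
  by (rule proj_apply[OF E_id(1)])

text \<open>
  By the preceding formula, since \<open>\<beta>\<close> is \<open>N\<close>-linear and the values of \<open>\<phi>\<close> lie in \<open>N\<close>.
  This is the invariance that makes \<open>\<phi>\<close> behave as an integral for the weak Hopf algebra \<open>E\<close>.
\<close>
lemma proj_commute: assumes "\<beta> \<in> E" shows "proj (\<beta> z) = \<beta> (proj z)"
  unfolding proj_apply[OF assms] proj_alt[of z] E_psum[OF assms]
  by (simp add: ED(2)[OF assms] phi_N)

lemma proj_E: "proj \<in> E"
proof -
  have "(\<lambda>z. psum eb (\<lambda>e e'. e * \<phi> (e' * z))) \<in> E"
  proof (rule E_psumI)
    fix e e' assume "(e, e') \<in> set eb"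
    then have e: "e \<in> R" "e' \<in> R" using eb_R by auto
    show "(\<lambda>z. e * \<phi> (e' * z)) \<in> E"
      by (rule E_left[OF E_comp[OF phi_E E_left[OF E_id(1) e(2)]] e(1)])
  qed
  then show ?thesis unfolding proj_def[abs_def] .
qed

text \<open>
  With \<open>F(y) = \<Sum> \<phi>(y e\<^sub>i) e\<^sup>i\<close> the sum over \<open>j\<close> collapses to \<open>\<Sum> z e\<^sub>i e\<^sup>i\<close>, which is \<open>z\<close> for index one.
\<close>
lemma mb_proj: "psum mb (\<lambda>m m'. m * proj (m' * z)) = z"
proof -
  have "psum mb (\<lambda>m m'. m * proj (m' * z)) = psum mb (\<lambda>m m'. psum eb (\<lambda>e e'. m * \<phi> (m' * (z * e)) * e'))"
    unfolding proj_alt by (simp add: mult.assoc flip: psum_mult_left)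
  also have "\<dots> = psum eb (\<lambda>e e'. psum mb (\<lambda>m m'. m * \<phi> (m' * (z * e))) * e')"
    by (subst psum_swap) (simp add: psum_mult_right)
  also have "\<dots> = z" using eb_index by (simp add: mb_left mult.assoc psum_mult_left)
  finally show ?thesis .
qed

text \<open>
  The left legs of the comultiplication over \<open>R\<close>: applying \<open>p \<otimes> q \<mapsto> a(x p) q\<close> to
  \<open>y \<otimes> 1 = \<Sum> t \<cdot> \<beta>(y)\<close> gives \<open>a(x y) = \<Sum> theta a t x \<cdot> \<beta>(y)\<close>.
\<close>
definition theta :: "('m \<Rightarrow> 'm) \<Rightarrow> ('m \<times> 'm) list \<Rightarrow> 'm \<Rightarrow> 'm" where
  "theta a t x = psum t (\<lambda>p q. a (x * p) * q)"

lemma theta_E_central: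
  assumes a: "a \<in> E" and t: "central_tensor N t"
  shows "theta a t \<in> E"
proof (rule EI)
  show "theta a t (x + y) = theta a t x + theta a t y" for x y
    by (simp add: theta_def distrib_right ED[OF a] psum_add)
  show "theta a t (n * x) = n * theta a t x" if "n \<in> N" for n x
    using that by (simp add: theta_def ED[OF a] mult.assoc flip: psum_mult_left)
  show "theta a t (x * n) = theta a t x * n" if "n \<in> N" for n x
    using t[unfolded central_tensor_def, rule_format, OF balanced_mult[OF a, of x] that]
    by (simp add: theta_def mult.assoc flip: psum_mult_right)
qed

lemma theta_E: "a \<in> E \<Longrightarrow> (t, \<beta>) \<in> set tb \<Longrightarrow> theta a t \<in> E"
  by (rule theta_E_central[OF _ tb_central])

lemma theta_mult: assumes "a \<in> E" shows "psum tb (\<lambda>t \<beta>. theta a t x * \<beta> y) = a (x * y)"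
  using tb_basis[OF balanced_mult[OF assms, of x], of y]
  by (simp add: theta_def mult.assoc flip: psum_mult_right)

text \<open>
  The \<open>\<beta>\<close> generate \<open>E\<close> as a left \<open>R\<close>-module, with coordinates \<open>a \<mapsto> theta a t 1\<close>.
\<close>
lemma theta_expand: "a \<in> E \<Longrightarrow> psum tb (\<lambda>t \<beta>. theta a t 1 * \<beta> y) = a y"
  using theta_mult[of a 1 y] by simp

text \<open>
  Under \<open>M \<otimes>\<^sub>N M \<cong> (M \<otimes>\<^sub>N M)\<^sup>N \<otimes>\<^sub>R M\<close>, \<open>c \<cdot> m \<mapsto> c \<otimes> m\<close>, the map \<open>id \<otimes> F\<close> is computed in two
  ways on \<open>y \<otimes> z\<close>.  It sends \<open>w \<otimes> 1\<close> to \<open>F(w) \<otimes> 1\<close> because \<open>F\<close> commutes with the \<open>\<beta>\<close>, and it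
  commutes with inserting a central tensor \<open>u\<close> in the middle.  Now \<open>y \<otimes> z = \<Sum> y \<gamma>(z) \<cdot> u\<close> arises
  from the elements \<open>w \<otimes> 1\<close>, \<open>w = y \<gamma>(z)\<close>, by such insertions.
\<close>
lemma theta_diagonal:
  assumes a: "a \<in> E"
  shows "psum tb (\<lambda>t \<beta>. psum t (\<lambda>p q. a (x * p) * q * proj (\<beta> y * z))) =
    psum ub (\<lambda>u \<gamma>. psum u (\<lambda>p q. a (x * proj (y * \<gamma> z) * p) * q))"
proof -
  define P where "P y z = psum tb (\<lambda>t \<beta>. psum t (\<lambda>p q. a (x * p) * q * proj (\<beta> y * z)))" for y z
  have P: "balanced_map N (\<lambda>p q. P (y * p) q)"
  proof (rule balanced_mapI)
    show "P (y * (p + p')) q = P (y * p) q + P (y * p') q" for p p' q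
      unfolding P_def psum_add[symmetric]
      by (intro psum_cong) (simp add: distrib_left distrib_right ED[OF tb_end] ED[OF proj_E])
    show "P (y * p) (q + q') = P (y * p) q + P (y * p) q'" for p q q'
      unfolding P_def psum_add[symmetric]
      by (intro psum_cong) (simp add: distrib_left distrib_right ED[OF proj_E])
    show "P (y * (p * n)) q = P (y * p) (n * q)" if "n \<in> N" for p q n
      unfolding P_def by (intro psum_cong) (simp add: that ED[OF tb_end] flip: mult.assoc)
  qed
  \<comment> \<open>The right quasibasis replaces \<open>1 \<otimes> z\<close>.\<close>
  have "P y z = psum ub (\<lambda>u \<gamma>. psum u (\<lambda>p q. P (y * (\<gamma> z * p)) q))"
    using ub_basis[OF P, of z] by simp
  also have "\<dots> = psum ub (\<lambda>u \<gamma>. psum u (\<lambda>p q. a (x * proj (y * \<gamma> z) * p) * q))"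
  proof (rule psum_cong)
    fix u \<gamma> assume u: "(u, \<gamma>) \<in> set ub"
    let ?w = "y * \<gamma> z"
    have "psum u (\<lambda>p' q'. P (y * (\<gamma> z * p')) q') =
        psum tb (\<lambda>t \<beta>. psum t (\<lambda>p q. a (x * p) * q * proj (theta \<beta> u ?w)))"
      unfolding P_def
      by (subst psum_swap, intro psum_cong, subst psum_swap)
        (simp add: theta_def E_psum[OF proj_E] psum_mult_left mult.assoc)
    \<comment> \<open>\<open>theta \<beta> u\<close> is the endomorphism \<open>\<beta>\<close> composed with the insertion of \<open>u\<close>, so it commutes with \<open>F\<close>.\<close>
    also have "\<dots> = psum tb (\<lambda>t \<beta>. psum t (\<lambda>p q. a (x * p) * q * theta \<beta> u (proj ?w)))"
      by (intro psum_cong) (simp add: proj_commute[OF theta_E_central[OF tb_end ub_central[OF u]]])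
    also have "\<dots> = psum u (\<lambda>p' q'. psum tb (\<lambda>t \<beta>. psum t (\<lambda>p q. a (x * p) * (q * \<beta> (proj ?w * p'))) * q'))"
    proof (subst psum_swap[of u], rule psum_cong)
      fix t \<beta>
      have "psum t (\<lambda>p q. a (x * p) * q * theta \<beta> u (proj ?w)) =
          psum t (\<lambda>p q. psum u (\<lambda>p' q'. a (x * p) * q * (\<beta> (proj ?w * p') * q')))"
        unfolding theta_def psum_mult_left ..
      also have "\<dots> = psum u (\<lambda>p' q'. psum t (\<lambda>p q. a (x * p) * q * (\<beta> (proj ?w * p') * q')))"
        by (rule psum_swap)
      also have "\<dots> = psum u (\<lambda>p' q'. psum t (\<lambda>p q. a (x * p) * (q * \<beta> (proj ?w * p'))) * q')"
        by (intro psum_cong) (simp add: mult.assoc flip: psum_mult_right)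
      finally show "psum t (\<lambda>p q. a (x * p) * q * theta \<beta> u (proj ?w)) = \<dots>" .
    qed
    also have "\<dots> = psum u (\<lambda>p' q'. a (x * (proj ?w * p')) * q')"
      using tb_basis[OF balanced_mult[OF a, of x]] by (simp add: psum_mult_right)
    finally show "psum u (\<lambda>p' q'. P (y * (\<gamma> z * p')) q') = psum u (\<lambda>p q. a (x * proj ?w * p) * q)"
      by (simp add: mult.assoc)
  qed
  finally show ?thesis unfolding P_def .
qed

text \<open>
  This is \<open>a\<^sub>1 S(a\<^sub>2) = \<pi>\<^sup>L(a)\<close> evaluated at \<open>z\<close>.  In the form given by \<open>theta_diagonal\<close> the sum over \<open>j\<close>
  becomes \<open>\<Sum> m\<^sub>j F(m\<^sup>j w) = w\<close>, and the right quasibasis reassembles \<open>a(1) z\<close>.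
\<close>
lemma antipode_identity:
  assumes a: "a \<in> E"
  shows "psum mb (\<lambda>m m'. psum tb (\<lambda>t \<beta>. theta a t m * proj (\<beta> m' * z))) = a 1 * z"
proof -
  have "psum mb (\<lambda>m m'. psum tb (\<lambda>t \<beta>. theta a t m * proj (\<beta> m' * z))) =
      psum mb (\<lambda>m m'. psum ub (\<lambda>u \<gamma>. psum u (\<lambda>p q. a (m * proj (m' * \<gamma> z) * p) * q)))"
    using theta_diagonal[OF a] by (intro psum_cong) (simp add: theta_def flip: psum_mult_right)
  also have "\<dots> = psum ub (\<lambda>u \<gamma>. psum u (\<lambda>p q. a (psum mb (\<lambda>m m'. m * proj (m' * \<gamma> z)) * p) * q))"
    by (subst psum_swap, intro psum_cong, subst psum_swap, intro psum_cong)
      (simp add: E_psum[OF a] flip: psum_mult_right)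
  also have "\<dots> = a 1 * z"
    using ub_basis[OF balanced_mult[OF a, of 1], of z] by (simp add: mb_proj)
  finally show ?thesis .
qed

end

section \<open>The weak bialgebra of bimodule endomorphisms\<close>

text \<open>
  The algebra \<open>E\<close> is carried by a subspace \<open>C\<close> of an arbitrary vector space, which \<open>al\<close> maps
  bijectively onto \<open>E\<close>: weak bialgebras live in a type that is fixed beforehand, whereas the elements
  of \<open>E\<close> are functions on \<open>M\<close>.
\<close>
locale endomorphism_model = depth_two_frobenius s N \<phi> mb eb tb ub
  for s :: "'k::field \<Rightarrow> 'm::ring_1 \<Rightarrow> 'm" and N \<phi> mb eb tb ub +
  fixes C :: "'c::ab_group_add set" and sc :: "'k \<Rightarrow> 'c \<Rightarrow> 'c" and al :: "'c \<Rightarrow> 'm \<Rightarrow> 'm"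
  assumes fd_C: "fd_space sc C"
    and al_add: "x \<in> C \<Longrightarrow> y \<in> C \<Longrightarrow> al (x + y) m = al x m + al y m"
    and al_scale: "x \<in> C \<Longrightarrow> al (sc c x) m = s c (al x m)"
    and al_bij: "bij_betw al C (bimodule_end N)"
begin

lemma C_closed [simp]: "0 \<in> C" "x \<in> C \<Longrightarrow> y \<in> C \<Longrightarrow> x + y \<in> C" "x \<in> C \<Longrightarrow> sc c x \<in> C"
  using fd_spaceD[OF fd_C] by auto

lemma C_psum: "(\<And>a b. (a, b) \<in> set xs \<Longrightarrow> F a b \<in> C) \<Longrightarrow> psum xs F \<in> C"
  by (rule psum_in) auto

definition la :: "('m \<Rightarrow> 'm) \<Rightarrow> 'c" where "la = inv_into C al"

lemma al_E [simp]: "x \<in> C \<Longrightarrow> al x \<in> E"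
  using al_bij by (auto simp: bij_betw_def)

lemma la_C [simp]: "f \<in> E \<Longrightarrow> la f \<in> C"
  using al_bij unfolding la_def by (metis bij_betw_def inv_into_into)

lemma al_la [simp]: "f \<in> E \<Longrightarrow> al (la f) = f"
  using al_bij unfolding la_def by (metis bij_betw_def f_inv_into_f)

lemma al_eqI: "x \<in> C \<Longrightarrow> y \<in> C \<Longrightarrow> (\<And>m. al x m = al y m) \<Longrightarrow> x = y"
  using al_bij by (metis bij_betw_def ext inj_onD)

lemma al_psum: "(\<And>a b. (a, b) \<in> set xs \<Longrightarrow> F a b \<in> C) \<Longrightarrow> al (psum xs F) m = psum xs (\<lambda>a b. al (F a b) m)"
  by (rule psum_hom_on[of C "\<lambda>x. al x m"]) (auto simp: al_add)

lemma al_R [simp]: "x \<in> C \<Longrightarrow> r \<in> R \<Longrightarrow> al x r \<in> R" and al_1 [simp]: "x \<in> C \<Longrightarrow> al x 1 \<in> R"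
  using E_R R_1 al_E by auto

text \<open>
  \<open>lf r\<close> and \<open>rt r\<close> are the left and the right multiplication by \<open>r \<in> R\<close>, that is the actions of \<open>R\<close>
  on \<open>E\<close> through the source map and through the target map.
\<close>
definition one :: 'c where "one = la (\<lambda>x. x)"
definition mu :: "'c \<Rightarrow> 'c \<Rightarrow> 'c" where "mu x y = la (\<lambda>z. al x (al y z))"
definition lf :: "'m \<Rightarrow> 'c \<Rightarrow> 'c" where "lf r x = la (\<lambda>z. r * al x z)"
definition rt :: "'m \<Rightarrow> 'c \<Rightarrow> 'c" where "rt r x = la (\<lambda>z. al x z * r)"
definition ad :: "'c \<Rightarrow> 'c" where "ad x = la (adj (al x))"
definition th :: "'c \<Rightarrow> ('m \<times> 'm) list \<Rightarrow> 'c" where "th x t = la (theta (al x) t)"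

lemma ops_C [simp]: "one \<in> C" "x \<in> C \<Longrightarrow> y \<in> C \<Longrightarrow> mu x y \<in> C" "r \<in> R \<Longrightarrow> x \<in> C \<Longrightarrow> lf r x \<in> C"
  "r \<in> R \<Longrightarrow> x \<in> C \<Longrightarrow> rt r x \<in> C" "x \<in> C \<Longrightarrow> ad x \<in> C" "x \<in> C \<Longrightarrow> (t, \<beta>) \<in> set tb \<Longrightarrow> th x t \<in> C"
  by (simp_all add: one_def mu_def lf_def rt_def ad_def th_def E_id E_comp E_left E_right adj_E theta_E[of _ t \<beta>])

lemma al_ops [simp]: "al one z = z" "x \<in> C \<Longrightarrow> y \<in> C \<Longrightarrow> al (mu x y) z = al x (al y z)"
  "r \<in> R \<Longrightarrow> x \<in> C \<Longrightarrow> al (lf r x) z = r * al x z"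
  "r \<in> R \<Longrightarrow> x \<in> C \<Longrightarrow> al (rt r x) z = al x z * r" "x \<in> C \<Longrightarrow> al (ad x) z = adj (al x) z"
  "x \<in> C \<Longrightarrow> (t, \<beta>) \<in> set tb \<Longrightarrow> al (th x t) z = theta (al x) t z"
  by (simp_all add: one_def mu_def lf_def rt_def ad_def th_def E_id E_comp E_left E_right adj_E theta_E[of _ t \<beta>])

lemma al_linear: "x \<in> C \<Longrightarrow> al x (y + z) = al x y + al x z" "x \<in> C \<Longrightarrow> al x (s c z) = s c (al x z)"
  using ED(1)[OF al_E] E_scale[OF al_E] by auto

lemma adj_add: "x \<in> C \<Longrightarrow> y \<in> C \<Longrightarrow> adj (al (x + y)) z = adj (al x) z + adj (al y) z"
  by (simp add: adj_def al_add distrib_right distrib_left phi_add psum_add)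

lemma s_psum: "s c (psum xs F) = psum xs (\<lambda>a b. s c (F a b))"
  by (rule psum_hom) (simp add: vs.scale_right_distrib)

lemma adj_scale: "x \<in> C \<Longrightarrow> adj (al (sc c x)) z = s c (adj (al x) z)"
  by (simp add: adj_def al_scale s_mult_left s_mult_right phi_scale s_psum)

lemma ops_add:
  "x \<in> C \<Longrightarrow> x' \<in> C \<Longrightarrow> y \<in> C \<Longrightarrow> mu (x + x') y = mu x y + mu x' y"
  "x \<in> C \<Longrightarrow> y \<in> C \<Longrightarrow> y' \<in> C \<Longrightarrow> mu x (y + y') = mu x y + mu x y'"
  "r \<in> R \<Longrightarrow> x \<in> C \<Longrightarrow> y \<in> C \<Longrightarrow> lf r (x + y) = lf r x + lf r y"
  "r \<in> R \<Longrightarrow> x \<in> C \<Longrightarrow> y \<in> C \<Longrightarrow> rt r (x + y) = rt r x + rt r y"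
  "r \<in> R \<Longrightarrow> r' \<in> R \<Longrightarrow> x \<in> C \<Longrightarrow> lf (r + r') x = lf r x + lf r' x"
  "r \<in> R \<Longrightarrow> r' \<in> R \<Longrightarrow> x \<in> C \<Longrightarrow> rt (r + r') x = rt r x + rt r' x"
  "x \<in> C \<Longrightarrow> y \<in> C \<Longrightarrow> ad (x + y) = ad x + ad y"
  by (rule al_eqI; simp add: al_add al_linear algebra_simps R_add adj_add)+

lemma ops_scale:
  "x \<in> C \<Longrightarrow> y \<in> C \<Longrightarrow> mu (sc c x) y = sc c (mu x y)"
  "x \<in> C \<Longrightarrow> y \<in> C \<Longrightarrow> mu x (sc c y) = sc c (mu x y)"
  "r \<in> R \<Longrightarrow> x \<in> C \<Longrightarrow> lf r (sc c x) = sc c (lf r x)"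
  "r \<in> R \<Longrightarrow> x \<in> C \<Longrightarrow> rt r (sc c x) = sc c (rt r x)"
  "r \<in> R \<Longrightarrow> x \<in> C \<Longrightarrow> lf (s c r) x = sc c (lf r x)"
  "r \<in> R \<Longrightarrow> x \<in> C \<Longrightarrow> rt (s c r) x = sc c (rt r x)"
  "x \<in> C \<Longrightarrow> ad (sc c x) = sc c (ad x)"
  by (rule al_eqI; simp add: al_scale al_linear R_scale s_mult_left s_mult_right adj_scale)+

lemma rt_lf: "r \<in> R \<Longrightarrow> r' \<in> R \<Longrightarrow> x \<in> C \<Longrightarrow> rt r (lf r' x) = lf r' (rt r x)"
  "r \<in> R \<Longrightarrow> r' \<in> R \<Longrightarrow> x \<in> C \<Longrightarrow> rt r (rt r' x) = rt (r' * r) x"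
  "r \<in> R \<Longrightarrow> r' \<in> R \<Longrightarrow> x \<in> C \<Longrightarrow> lf r (lf r' x) = lf (r * r') x"
  "r \<in> R \<Longrightarrow> x \<in> C \<Longrightarrow> y \<in> C \<Longrightarrow> mu (rt r x) y = rt r (mu x y)"
  "r \<in> R \<Longrightarrow> x \<in> C \<Longrightarrow> y \<in> C \<Longrightarrow> mu (lf r x) y = lf r (mu x y)"
  by (rule al_eqI; simp add: R_mult mult.assoc)+

text \<open>
  The comultiplication is the formal sum \<open>\<Sum> theta w t \<otimes> \<beta>\<close> over \<open>R\<close>, lifted to \<open>K\<close> with the
  quasibasis of \<open>R\<close>.
\<close>
definition A :: "('k, 'c) wha" where
  "A = \<lparr>car = C, scl = sc, mul = mu, unt = one,
    cop = (\<lambda>w. [(rt e (th w t), lf e' (la \<beta>)). (t, \<beta>) \<leftarrow> tb, (e, e') \<leftarrow> eb]),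
    eps = (\<lambda>w. kap (\<phi> (al w 1))), antip = ad\<rparr>"

lemma A_simps [simp]: "car A = C" "scl A = sc" "mul A = mu" "unt A = one" "eps A = (\<lambda>w. kap (\<phi> (al w 1)))" "antip A = ad"
  by (simp_all add: A_def)

abbreviation ep :: "'c \<Rightarrow> 'k" where "ep w \<equiv> kap (\<phi> (al w 1))"

lemma ep_linear: "x \<in> C \<Longrightarrow> y \<in> C \<Longrightarrow> ep (x + y) = ep x + ep y" "x \<in> C \<Longrightarrow> ep (sc c x) = c * ep x"
  by (simp_all add: al_add al_scale kap_add kap_scale)

text \<open>
  The value of \<open>B\<close> on the lift of \<open>x \<otimes>\<^sub>R y\<close> to \<open>E \<otimes>\<^sub>K E\<close>.
\<close>
definition bracket :: "('c \<Rightarrow> 'c \<Rightarrow> 'z::ab_group_add) \<Rightarrow> 'c \<Rightarrow> 'c \<Rightarrow> 'z" where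
  "bracket B x y = psum eb (\<lambda>e e'. B (rt e x) (lf e' y))"

text \<open>
  Weaker than bilinear: no scalar multiplication on the target is involved, so that iterated
  comultiplications in one argument give maps of the same kind.
\<close>
definition kbal :: "('c \<Rightarrow> 'c \<Rightarrow> 'z::ab_group_add) \<Rightarrow> bool" where
  "kbal B \<longleftrightarrow> (\<forall>x\<in>C. \<forall>x'\<in>C. \<forall>y\<in>C. B (x + x') y = B x y + B x' y) \<and>
     (\<forall>x\<in>C. \<forall>y\<in>C. \<forall>y'\<in>C. B x (y + y') = B x y + B x y') \<and>
     (\<forall>x\<in>C. \<forall>y\<in>C. \<forall>c. B (sc c x) y = B x (sc c y))"

lemma kbalI:
  assumes "\<And>x x' y. x \<in> C \<Longrightarrow> x' \<in> C \<Longrightarrow> y \<in> C \<Longrightarrow> B (x + x') y = B x y + B x' y"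
    "\<And>x y y'. x \<in> C \<Longrightarrow> y \<in> C \<Longrightarrow> y' \<in> C \<Longrightarrow> B x (y + y') = B x y + B x y'"
    "\<And>x y c. x \<in> C \<Longrightarrow> y \<in> C \<Longrightarrow> B (sc c x) y = B x (sc c y)"
  shows "kbal B"
  using assms by (simp add: kbal_def)

lemma kbalD:
  assumes "kbal B" "x \<in> C" "y \<in> C"
  shows "x' \<in> C \<Longrightarrow> B (x + x') y = B x y + B x' y" "y' \<in> C \<Longrightarrow> B x (y + y') = B x y + B x y'"
    "B (sc c x) y = B x (sc c y)"
  using assms unfolding kbal_def by blast+

lemma eb_in [simp]: "(e, e') \<in> set eb \<Longrightarrow> e \<in> R" "(e, e') \<in> set eb \<Longrightarrow> e' \<in> R"
  using eb_R by auto

lemma tb_in [simp]: "(t, \<beta>) \<in> set tb \<Longrightarrow> \<beta> \<in> E"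
  by (rule tb_end)

lemma bracket_add: assumes "kbal B" "x \<in> C" "x' \<in> C" "y \<in> C" "y' \<in> C"
  shows "bracket B (x + x') y = bracket B x y + bracket B x' y"
    "bracket B x (y + y') = bracket B x y + bracket B x y'"
  unfolding bracket_def psum_add[symmetric] using assms(2-)
  by (auto intro!: psum_cong simp: ops_add kbalD[OF assms(1)])

lemma bracket_balanced:
  assumes B: "kbal B" and "x \<in> C" "y \<in> C" "r \<in> R"
  shows "bracket B (rt r x) y = bracket B x (lf r y)"
proof -
  have "bracket B (rt r x) y = psum eb (\<lambda>e e'. B (rt (r * e) x) (lf e' y))"
    unfolding bracket_def using assms by (intro psum_cong) (simp add: rt_lf)
  also have "\<dots> = psum eb (\<lambda>e e'. B (rt e x) (lf (e' * r) y))"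
    by (rule eb_casimir[OF assms(4)]) (use assms in \<open>simp_all add: ops_add ops_scale kbalD[OF B]\<close>)
  also have "\<dots> = bracket B x (lf r y)"
    unfolding bracket_def using assms by (intro psum_cong) (simp add: rt_lf)
  finally show ?thesis .
qed

text \<open>
  Injectivity of \<open>E \<otimes>\<^sub>R E \<rightarrow> Hom(M \<otimes>\<^sub>N M, M)\<close>.  By \<open>theta_expand\<close> the second factor has a dual basis
  over \<open>R\<close>; the resulting left coefficients are \<open>m \<mapsto> \<Sum> a(m) b(p) q\<close>, summed over a central
  tensor, and depend on the values \<open>\<Sum> a(x) b(y)\<close> only.
\<close>
lemma balanced_tensorI:
  assumes xs: "set xs \<subseteq> C \<times> C" and ys: "set ys \<subseteq> C \<times> C"
    and G: "\<And>x y. psum xs (\<lambda>a b. al a x * al b y) = psum ys (\<lambda>a b. al a x * al b y)"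
  shows "tensor_eq C C R (\<lambda>x r. rt r x) lf xs ys"
proof -
  define D where "D = map (\<lambda>(t, \<beta>). (\<lambda>b. theta (al b) t 1, la \<beta>)) tb"
  have g: "g b \<in> R" if gd: "(g, d) \<in> set D" and b: "b \<in> C" for g d b
    using gd E_R[OF theta_E[OF al_E[OF b]] R_1] by (auto simp: D_def)
  have exp: "tensor_eq C C R (\<lambda>x r. rt r x) lf zs (map (\<lambda>(g, d). (psum zs (\<lambda>a b. rt (g b) a), d)) D)"
    if "set zs \<subseteq> C \<times> C" for zs
  proof (rule tensor_eq_expand)
    show "d \<in> C" if "(g, d) \<in> set D" for g d using that by (auto simp: D_def)
    show "g b \<in> R" if "(g, d) \<in> set D" "b \<in> C" for g d b using g that by auto
    show "psum D (\<lambda>g d. lf (g b) d) = b" if b: "b \<in> C" for b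
    proof (rule al_eqI)
      have *: "psum D (\<lambda>g d. lf (g b) d) = psum tb (\<lambda>t \<beta>. lf (theta (al b) t 1) (la \<beta>))"
        by (simp add: D_def psum_map)
      have l: "lf (theta (al b) t 1) (la \<beta>) \<in> C" "al (lf (theta (al b) t 1) (la \<beta>)) m = theta (al b) t 1 * \<beta> m"
        if "(t, \<beta>) \<in> set tb" for t \<beta> m
        using that E_R[OF theta_E[OF al_E[OF b] that] R_1] by auto
      show "psum D (\<lambda>g d. lf (g b) d) \<in> C" unfolding * by (rule C_psum) (rule l)
      show "al (psum D (\<lambda>g d. lf (g b) d)) m = al b m" for m
        unfolding * by (simp add: al_psum l psum_cong[OF l(2)] theta_expand[OF al_E[OF b]])
    qed (rule b)
  qed (use that in auto)
  have eq: "psum xs (\<lambda>a b. rt (g b) a) = psum ys (\<lambda>a b. rt (g b) a)" if gd: "(g, d) \<in> set D" for g d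
  proof -
    from gd obtain t where g_t: "g = (\<lambda>b. theta (al b) t 1)" by (auto simp: D_def)
    have mem: "psum zs (\<lambda>a b. rt (g b) a) \<in> C" if "set zs \<subseteq> C \<times> C" for zs
      using that g[OF gd] by (intro C_psum) auto
    have val: "al (psum zs (\<lambda>a b. rt (g b) a)) m = psum t (\<lambda>p q. psum zs (\<lambda>a b. al a m * al b p) * q)"
      if zs: "set zs \<subseteq> C \<times> C" for zs m
    proof -
      have zsC: "a \<in> C \<and> b \<in> C" if "(a, b) \<in> set zs" for a b using that zs by auto
      have "al (psum zs (\<lambda>a b. rt (g b) a)) m = psum zs (\<lambda>a b. al (rt (g b) a) m)"
      proof (rule al_psum)
        fix a b assume "(a, b) \<in> set zs"
        then show "rt (g b) a \<in> C" using zsC g[OF gd] by simp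
      qed
      also have "\<dots> = psum zs (\<lambda>a b. psum t (\<lambda>p q. al a m * al b p * q))"
      proof (rule psum_cong)
        fix a b assume "(a, b) \<in> set zs"
        then have "a \<in> C" "b \<in> C" using zsC by auto
        then have "al (rt (g b) a) m = al a m * theta (al b) t 1" using g[OF gd] by (simp add: g_t)
        then show "al (rt (g b) a) m = psum t (\<lambda>p q. al a m * al b p * q)"
          by (simp add: theta_def mult.assoc flip: psum_mult_left)
      qed
      also have "\<dots> = psum t (\<lambda>p q. psum zs (\<lambda>a b. al a m * al b p * q))" by (rule psum_swap)
      finally show ?thesis by (simp add: psum_mult_right)
    qed
    show "psum xs (\<lambda>a b. rt (g b) a) = psum ys (\<lambda>a b. rt (g b) a)"
      by (rule al_eqI) (simp_all add: mem xs ys val G)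
  qed
  then have "map (\<lambda>(g, d). (psum xs (\<lambda>a b. rt (g b) a), d)) D = map (\<lambda>(g, d). (psum ys (\<lambda>a b. rt (g b) a), d)) D"
    by auto
  with exp[OF xs] exp[OF ys] show ?thesis
    unfolding tensor_eq_def using formal_eq.trans[OF _ formal_eq.sym] by simp
qed

lemma cop_psum_def: "psum (cop A w) B = psum tb (\<lambda>t \<beta>. bracket B (th w t) (la \<beta>))"
  by (simp add: A_def psum_concat psum_map bracket_def)

lemma bracket_psum_eq:
  assumes "kbal B" "set xs \<subseteq> C \<times> C" "set ys \<subseteq> C \<times> C"
    and "\<And>x y. psum xs (\<lambda>a b. al a x * al b y) = psum ys (\<lambda>a b. al a x * al b y)"
  shows "psum xs (bracket B) = psum ys (bracket B)"
  by (rule tensor_eq_psum[OF balanced_tensorI[OF assms(2-4)]])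
    (use assms(1) in \<open>simp_all add: bracket_add bracket_balanced\<close>)

text \<open>
  The comultiplication is the lift of one tensor over \<open>R\<close> that represents \<open>w\<close>; by \<open>bracket_balanced\<close>
  the lift depends on the tensor only, so any other representative \<open>zs\<close> may be used.
\<close>
lemma cop_psum:
  assumes "kbal B" "w \<in> C" "set zs \<subseteq> C \<times> C"
    and "\<And>x y. psum zs (\<lambda>a b. al a x * al b y) = al w (x * y)"
  shows "psum (cop A w) B = psum zs (bracket B)"
proof -
  let ?T = "map (\<lambda>(t, \<beta>). (th w t, la \<beta>)) tb"
  have "psum (cop A w) B = psum ?T (bracket B)"
    by (simp add: cop_psum_def psum_map)
  also have "\<dots> = psum zs (bracket B)"
  proof (rule bracket_psum_eq[OF assms(1) _ assms(3)])
    show "set ?T \<subseteq> C \<times> C" using assms(2) by auto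
    have "psum ?T (\<lambda>a b. al a x * al b y) = psum tb (\<lambda>t \<beta>. theta (al w) t x * \<beta> y)" for x y
      unfolding psum_map using assms(2) by (intro psum_cong) simp
    then show "psum ?T (\<lambda>a b. al a x * al b y) = psum zs (\<lambda>a b. al a x * al b y)" for x y
      using theta_mult[OF al_E[OF assms(2)]] assms(4) by simp
  qed
  finally show ?thesis .
qed

lemma cop_C: "w \<in> C \<Longrightarrow> set (cop A w) \<subseteq> C \<times> C"
  by (auto simp: A_def)

lemma cop_CD: "w \<in> C \<Longrightarrow> (a, b) \<in> set (cop A w) \<Longrightarrow> a \<in> C" "w \<in> C \<Longrightarrow> (a, b) \<in> set (cop A w) \<Longrightarrow> b \<in> C"
  using cop_C by blast+

lemma cop_A_cong:
  assumes "w \<in> C" "\<And>a b. a \<in> C \<Longrightarrow> b \<in> C \<Longrightarrow> F a b = G a b"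
  shows "psum (cop A w) F = psum (cop A w) G"
  using cop_CD[OF assms(1)] assms(2) by (intro psum_cong) blast

text \<open>
  The lift from \<open>R\<close> to \<open>K\<close> inserts \<open>\<Sum> e\<^sub>i e\<^sup>i\<close>, which is \<open>1\<close>.
\<close>
lemma cop_apply:
  assumes "w \<in> C"
  shows "psum (cop A w) (\<lambda>a b. al a x * al b y) = al w (x * y)"
proof -
  have "psum (cop A w) (\<lambda>a b. al a x * al b y) = psum tb (\<lambda>t \<beta>. theta (al w) t x * \<beta> y)"
    unfolding cop_psum_def
  proof (rule psum_cong)
    fix t \<beta> assume t: "(t, \<beta>) \<in> set tb"
    have "bracket (\<lambda>a b. al a x * al b y) (th w t) (la \<beta>) = psum eb (\<lambda>e e'. theta (al w) t x * (e * e' * \<beta> y))"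
      unfolding bracket_def using assms t by (intro psum_cong) (simp add: mult.assoc al_ops(6)[OF _ t])
    also have "\<dots> = theta (al w) t x * \<beta> y"
      by (simp only: psum_mult_left psum_mult_right eb_index mult_1_left)
    finally show "bracket (\<lambda>a b. al a x * al b y) (th w t) (la \<beta>) = theta (al w) t x * \<beta> y" .
  qed
  then show ?thesis using theta_mult[OF al_E[OF assms]] by simp
qed

lemma cop_bracket:
  assumes "kbal B" "w \<in> C"
  shows "psum (cop A w) B = psum (cop A w) (bracket B)"
  by (rule cop_psum[OF assms cop_C[OF assms(2)] cop_apply[OF assms(2)]])

lemma cop_one: "kbal B \<Longrightarrow> psum (cop A one) B = bracket B one one"
  using cop_psum[of B one "[(one, one)]"] by simp

text \<open>
  If \<open>f\<close> and \<open>g\<close> are linear over the inner multiplications by \<open>R\<close> then \<open>\<Sum> f(x\<^sub>1) \<otimes> g(x\<^sub>2)\<close> is again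
  the lift of a tensor over \<open>R\<close>, and is therefore \<open>\<Delta>(w)\<close> as soon as it represents \<open>w\<close>.
\<close>
lemma cop_image:
  assumes B: "kbal B" and w: "w \<in> C" and x: "x \<in> C"
    and f: "\<And>a. a \<in> C \<Longrightarrow> f a \<in> C" "\<And>a a'. a \<in> C \<Longrightarrow> a' \<in> C \<Longrightarrow> f (a + a') = f a + f a'"
      "\<And>a c. a \<in> C \<Longrightarrow> f (sc c a) = sc c (f a)" "\<And>a e. a \<in> C \<Longrightarrow> e \<in> R \<Longrightarrow> f (rt e a) = rt e (f a)"
    and g: "\<And>a. a \<in> C \<Longrightarrow> g a \<in> C" "\<And>a a'. a \<in> C \<Longrightarrow> a' \<in> C \<Longrightarrow> g (a + a') = g a + g a'"
      "\<And>a c. a \<in> C \<Longrightarrow> g (sc c a) = sc c (g a)" "\<And>a e. a \<in> C \<Longrightarrow> e \<in> R \<Longrightarrow> g (lf e a) = lf e (g a)"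
    and val: "\<And>y z. psum (cop A x) (\<lambda>a b. al (f a) y * al (g b) z) = al w (y * z)"
  shows "psum (cop A w) B = psum (cop A x) (\<lambda>a b. B (f a) (g b))"
proof -
  let ?zs = "map (\<lambda>(a, b). (f a, g b)) (cop A x)"
  have "psum (cop A w) B = psum ?zs (bracket B)"
    by (rule cop_psum[OF B w]) (use cop_C[OF x] in \<open>auto simp: psum_map f(1) g(1) val\<close>)
  also have "\<dots> = psum (cop A x) (bracket (\<lambda>a b. B (f a) (g b)))"
    unfolding psum_map bracket_def by (rule cop_A_cong[OF x], rule psum_cong) (simp add: f g)
  also have "\<dots> = psum (cop A x) (\<lambda>a b. B (f a) (g b))"
    by (intro cop_bracket[symmetric] kbalI x) (simp_all add: f g kbalD[OF B])
  finally show ?thesis .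
qed

lemma cop_rt:
  assumes "kbal B" and x: "x \<in> C" and r: "r \<in> R"
  shows "psum (cop A (rt r x)) B = psum (cop A x) (\<lambda>a b. B a (rt r b))"
proof (rule cop_image[OF assms(1)])
  have "psum (cop A x) (\<lambda>a b. al a y * al (rt r b) z) = psum (cop A x) (\<lambda>a b. al a y * al b z * r)" for y z
    by (rule cop_A_cong[OF x]) (simp add: r mult.assoc)
  then show "psum (cop A x) (\<lambda>a b. al a y * al (rt r b) z) = al (rt r x) (y * z)" for y z
    using x r by (simp add: psum_mult_right cop_apply)
qed (use x r in \<open>simp_all add: ops_add ops_scale rt_lf\<close>)

lemma cop_lf:
  assumes "kbal B" and x: "x \<in> C" and r: "r \<in> R"
  shows "psum (cop A (lf r x)) B = psum (cop A x) (\<lambda>a b. B (lf r a) b)"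
proof (rule cop_image[OF assms(1)])
  have "psum (cop A x) (\<lambda>a b. al (lf r a) y * al b z) = psum (cop A x) (\<lambda>a b. r * (al a y * al b z))" for y z
    by (rule cop_A_cong[OF x]) (simp add: r mult.assoc)
  then show "psum (cop A x) (\<lambda>a b. al (lf r a) y * al b z) = al (lf r x) (y * z)" for y z
    using x r by (simp add: psum_mult_left cop_apply)
qed (use x r in \<open>simp_all add: ops_add ops_scale rt_lf\<close>)

lemma cop_add:
  assumes B: "kbal B" and "x \<in> C" "y \<in> C"
  shows "psum (cop A (x + y)) B = psum (cop A x) B + psum (cop A y) B"
proof -
  have "psum (cop A (x + y)) B = psum (cop A x @ cop A y) (bracket B)"
  proof (rule cop_psum[OF B])
    show "set (cop A x @ cop A y) \<subseteq> C \<times> C" using cop_C[OF assms(2)] cop_C[OF assms(3)] by auto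
  qed (use assms in \<open>simp_all add: cop_apply al_add\<close>)
  then show ?thesis using assms by (simp add: cop_bracket[OF B])
qed

lemma cop_scale:
  assumes "kbal B" and x: "x \<in> C"
  shows "psum (cop A (sc c x)) B = psum (cop A x) (\<lambda>a b. B (sc c a) b)"
proof (rule cop_image[OF assms(1)])
  interpret v: vector_space sc by (rule fd_spaceD[OF fd_C])
  have "psum (cop A x) (\<lambda>a b. al (sc c a) y * al b z) = psum (cop A x) (\<lambda>a b. s c (al a y * al b z))" for y z
    by (rule cop_A_cong[OF x]) (simp add: al_scale s_mult_left)
  then show "psum (cop A x) (\<lambda>a b. al (sc c a) y * al b z) = al (sc c x) (y * z)" for y z
    using x by (simp add: cop_apply al_scale flip: s_psum)
  show "sc c (sc d a) = sc d (sc c a)" "sc c (a + a') = sc c a + sc c a'" for d a a'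
    by (simp_all add: mult.commute v.scale_right_distrib)
qed (use x in \<open>simp_all add: ops_scale\<close>)

text \<open>
  Both sides represent \<open>x \<circ> y\<close>; the lift is absorbed by the first comultiplication.
\<close>
lemma cop_mu:
  assumes B: "kbal B" and "x \<in> C" "y \<in> C"
  shows "psum (cop A (mu x y)) B = psum (cop A x) (\<lambda>a b. psum (cop A y) (\<lambda>a' b'. B (mu a a') (mu b b')))"
proof -
  let ?zs = "concat (map (\<lambda>(a, b). map (\<lambda>(a', b'). (mu a a', mu b b')) (cop A y)) (cop A x))"
  have "psum (cop A (mu x y)) B = psum ?zs (bracket B)"
  proof (rule cop_psum[OF B])
    show "set ?zs \<subseteq> C \<times> C" using cop_C[OF assms(2)] cop_C[OF assms(3)] by (auto intro!: ops_C(2))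
    fix z z'
    have "psum ?zs (\<lambda>a b. al a z * al b z') = psum (cop A x) (\<lambda>a b. psum (cop A y) (\<lambda>a' b'. al a (al a' z) * al b (al b' z')))"
      unfolding psum_concat psum_map by (rule cop_A_cong, rule assms(2), rule cop_A_cong) (simp_all add: assms)
    also have "\<dots> = psum (cop A y) (\<lambda>a' b'. al x (al a' z * al b' z'))"
    proof (subst psum_swap, rule cop_A_cong[OF assms(3)])
      fix a' b'
      show "psum (cop A x) (\<lambda>a b. al a (al a' z) * al b (al b' z')) = al x (al a' z * al b' z')"
        by (rule cop_apply[OF assms(2)])
    qed
    also have "\<dots> = al x (psum (cop A y) (\<lambda>a' b'. al a' z * al b' z'))"
      using assms by (simp add: E_psum)
    finally show "psum ?zs (\<lambda>a b. al a z * al b z') = al (mu x y) (z * z')"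
      using assms by (simp add: cop_apply)
  qed (use assms in simp)
  also have "\<dots> = psum (cop A x) (\<lambda>a b. psum (cop A y) (\<lambda>a' b'. bracket B (mu a a') (mu b b')))"
    by (simp add: psum_concat psum_map)
  also have "\<dots> = psum (cop A y) (\<lambda>a' b'. psum (cop A x) (bracket (\<lambda>a b. B (mu a a') (mu b b'))))"
    unfolding bracket_def
    by (subst psum_swap, rule cop_A_cong, rule assms(3), rule cop_A_cong, rule assms(2), rule psum_cong)
      (simp add: rt_lf)
  also have "\<dots> = psum (cop A y) (\<lambda>a' b'. psum (cop A x) (\<lambda>a b. B (mu a a') (mu b b')))"
  proof (rule psum_cong)
    fix a' b' assume "(a', b') \<in> set (cop A y)"
    then have "a' \<in> C" "b' \<in> C" using cop_C[OF assms(2)] cop_C[OF assms(3)] assms by auto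
    then show "psum (cop A x) (bracket (\<lambda>a b. B (mu a a') (mu b b'))) = psum (cop A x) (\<lambda>a b. B (mu a a') (mu b b'))"
      using assms by (intro cop_bracket[symmetric] kbalI) (simp_all add: ops_add ops_scale kbalD[OF B])
  qed
  also have "\<dots> = psum (cop A x) (\<lambda>a b. psum (cop A y) (\<lambda>a' b'. B (mu a a') (mu b b')))"
    by (rule psum_swap)
  finally show ?thesis .
qed

definition kbal3 :: "('c \<Rightarrow> 'c \<Rightarrow> 'c \<Rightarrow> 'z::ab_group_add) \<Rightarrow> bool" where
  "kbal3 T \<longleftrightarrow> (\<forall>a\<in>C. kbal (T a)) \<and> (\<forall>c\<in>C. kbal (\<lambda>a b. T a b c))"

text \<open>
  Both sides are sums of \<open>T(_ e\<^sub>i, e\<^sup>i _ d\<^sub>j, d\<^sup>j _)\<close>: the left one over the lift of \<open>\<Delta>(theta w t')\<close> and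
  \<open>\<beta>'\<close>, the right one over \<open>theta w t\<close>, \<open>theta \<beta> t'\<close> and \<open>\<beta>'\<close>.  They agree because
  \<open>\<Sum> theta w t \<otimes> theta \<beta> t'\<close> represents \<open>theta w t'\<close>.
\<close>
lemma coassoc_A:
  assumes T: "kbal3 T" and w: "w \<in> C"
  shows "psum (cop A w) (\<lambda>x c. psum (cop A x) (\<lambda>a b. T a b c)) =
    psum (cop A w) (\<lambda>a y. psum (cop A y) (\<lambda>b c. T a b c))"
proof -
  have T1: "a \<in> C \<Longrightarrow> kbal (T a)" and T2: "c \<in> C \<Longrightarrow> kbal (\<lambda>a b. T a b c)" for a c
    using T by (auto simp: kbal3_def)
  have "psum (cop A w) (\<lambda>x c. psum (cop A x) (\<lambda>a b. T a b c)) =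
      psum tb (\<lambda>t' \<beta>'. psum eb (\<lambda>d d'. psum (cop A (th w t')) (\<lambda>a b. T a (rt d b) (lf d' (la \<beta>')))))"
    unfolding cop_psum_def[of w] bracket_def using w
    by (intro psum_cong) (simp add: cop_rt[OF T2])
  also have "\<dots> = psum tb (\<lambda>t' \<beta>'. psum eb (\<lambda>d d'. psum tb (\<lambda>t \<beta>.
      bracket (\<lambda>u v. T u v (lf d' (la \<beta>'))) (th w t) (rt d (th (la \<beta>) t')))))"
  proof (intro psum_cong)
    fix t' \<beta>' d d' assume t': "(t', \<beta>') \<in> set tb" and d: "(d, d') \<in> set eb"
    let ?zs = "map (\<lambda>(t, \<beta>). (th w t, th (la \<beta>) t')) tb"
    have c: "lf d' (la \<beta>') \<in> C" using t' d by simp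
    have "psum (cop A (th w t')) (\<lambda>a b. T a (rt d b) (lf d' (la \<beta>'))) =
        psum ?zs (bracket (\<lambda>a b. T a (rt d b) (lf d' (la \<beta>'))))"
    proof (rule cop_psum)
      show "kbal (\<lambda>a b. T a (rt d b) (lf d' (la \<beta>')))"
        using d c by (intro kbalI) (simp_all add: ops_add ops_scale kbalD[OF T2])
      show "th w t' \<in> C" using w t' by simp
      show "set ?zs \<subseteq> C \<times> C" using w t' by auto
      fix x y
      have "psum ?zs (\<lambda>a b. al a x * al b y) = psum tb (\<lambda>t \<beta>. theta (al w) t x * theta \<beta> t' y)"
        unfolding psum_map using w t' by (intro psum_cong) simp
      also have "\<dots> = psum t' (\<lambda>p q. psum tb (\<lambda>t \<beta>. theta (al w) t x * \<beta> (y * p)) * q)"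
        unfolding theta_def[of _ t'] psum_mult_left[symmetric] psum_mult_right[symmetric]
        by (subst psum_swap) (simp add: mult.assoc)
      also have "\<dots> = psum t' (\<lambda>p q. al w (x * (y * p)) * q)" using w by (simp add: theta_mult)
      also have "\<dots> = al (th w t') (x * y)"
        unfolding al_ops(6)[OF w t'] by (simp add: theta_def mult.assoc)
      finally show "psum ?zs (\<lambda>a b. al a x * al b y) = al (th w t') (x * y)" .
    qed
    also have "\<dots> = psum tb (\<lambda>t \<beta>. bracket (\<lambda>u v. T u v (lf d' (la \<beta>'))) (th w t) (rt d (th (la \<beta>) t')))"
      unfolding psum_map bracket_def using w d t' by (intro psum_cong) (simp add: rt_lf)
    finally show "psum (cop A (th w t')) (\<lambda>a b. T a (rt d b) (lf d' (la \<beta>'))) = \<dots>" .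
  qed
  also have "\<dots> = psum tb (\<lambda>t \<beta>. psum tb (\<lambda>t' \<beta>'. psum eb (\<lambda>d d'.
      bracket (\<lambda>u v. T u v (lf d' (la \<beta>'))) (th w t) (rt d (th (la \<beta>) t')))))"
    by (subst psum_swap[of eb], subst psum_swap[of tb tb]) simp
  also have "\<dots> = psum tb (\<lambda>t \<beta>. psum (cop A (la \<beta>)) (\<lambda>b c. bracket (\<lambda>u v. T u v c) (th w t) b))"
    by (simp add: cop_psum_def bracket_def[of "\<lambda>b c. bracket (\<lambda>u v. T u v c) x b" for x])
  also have "\<dots> = psum tb (\<lambda>t \<beta>. psum eb (\<lambda>e e'. psum (cop A (la \<beta>)) (\<lambda>b c. T (rt e (th w t)) (lf e' b) c)))"
    unfolding bracket_def by (subst psum_swap) simp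
  also have "\<dots> = psum (cop A w) (\<lambda>a y. psum (cop A y) (\<lambda>b c. T a b c))"
    unfolding cop_psum_def[of w] bracket_def using w
    by (intro psum_cong) (simp add: cop_lf[OF T1])
  finally show ?thesis .
qed

lemma cop_tensorI:
  assumes "w \<in> C" "set ys \<subseteq> C \<times> C"
    and *: "\<And>B :: 'c \<Rightarrow> 'c \<Rightarrow> 'c. kbal B \<Longrightarrow> psum (cop A w) B = psum ys B"
  shows "tensor2_eq sc C (cop A w) ys"
proof (rule tensor2_eqI[OF fd_C cop_C[OF assms(1)] assms(2)])
  interpret v: vector_space sc by (rule fd_spaceD[OF fd_C])
  fix g assume g: "linear_on C sc (*) g"
  show "psum (cop A w) (\<lambda>a b. sc (g b) a) = psum ys (\<lambda>a b. sc (g b) a)"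
    by (intro * kbalI) (simp_all add: linear_onD[OF g] v.scale_right_distrib v.scale_left_distrib mult.commute)
qed

lemma tensor3I:
  assumes "set xs \<subseteq> C \<times> C \<times> C" "set ys \<subseteq> C \<times> C \<times> C"
    and *: "\<And>T :: 'c \<Rightarrow> 'c \<Rightarrow> 'c \<Rightarrow> 'c. kbal3 T \<Longrightarrow> tsum xs T = tsum ys T"
  shows "tensor3_eq sc C xs ys"
proof (rule tensor3_eqI[OF fd_C assms(1,2)])
  interpret v: vector_space sc by (rule fd_spaceD[OF fd_C])
  fix g h assume g: "linear_on C sc (*) g" and h: "linear_on C sc (*) h"
  have "kbal3 (\<lambda>a b c. sc (g b * h c) a)"
    unfolding kbal3_def by (intro conjI ballI kbalI)
      (simp_all add: linear_onD[OF g] linear_onD[OF h] v.scale_right_distrib v.scale_left_distrib algebra_simps)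
  then show "tsum xs (\<lambda>a b c. sc (g b * h c) a) = tsum ys (\<lambda>a b c. sc (g b * h c) a)" by (rule *)
qed

lemma phi_R_R: "r \<in> R \<Longrightarrow> \<phi> r \<in> R"
  using R_scale[OF R_1, of "kap (\<phi> r)"] kap_one[of r] by simp

lemma tsum_cop_left: "tsum [(a, b, c). (x, c) \<leftarrow> cop A w, (a, b) \<leftarrow> cop A x] T =
    psum (cop A w) (\<lambda>x c. psum (cop A x) (\<lambda>a b. T a b c))"
  by (simp add: tsum_concat tsum_map)

lemma tsum_cop_right: "tsum [(a, b, c). (a, y) \<leftarrow> cop A w, (b, c) \<leftarrow> cop A y] T =
    psum (cop A w) (\<lambda>a y. psum (cop A y) (\<lambda>b c. T a b c))"
  by (simp add: tsum_concat tsum_map tsum_map_Pair)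

lemma cop_iter_C:
  assumes "w \<in> C"
  shows "set [(a, b, c). (x, c) \<leftarrow> cop A w, (a, b) \<leftarrow> cop A x] \<subseteq> C \<times> C \<times> C"
    "set [(a, b, c). (a, y) \<leftarrow> cop A w, (b, c) \<leftarrow> cop A y] \<subseteq> C \<times> C \<times> C"
proof -
  have "x \<in> C \<and> c \<in> C" if "(x, c) \<in> set (cop A v)" "v \<in> C" for x c v using that cop_C by blast
  then show "set [(a, b, c). (x, c) \<leftarrow> cop A w, (a, b) \<leftarrow> cop A x] \<subseteq> C \<times> C \<times> C"
    "set [(a, b, c). (a, y) \<leftarrow> cop A w, (b, c) \<leftarrow> cop A y] \<subseteq> C \<times> C \<times> C"
    using assms by fastforce+
qed

lemma kap_psum: "(\<And>a b. (a, b) \<in> set xs \<Longrightarrow> F a b \<in> R) \<Longrightarrow> kap (\<phi> (psum xs F)) = psum xs (\<lambda>a b. kap (\<phi> (F a b)))"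
  by (rule psum_hom_on[of R]) (auto simp: R_0 R_add kap_add)

lemma kap_mult: assumes "r \<in> R" "r' \<in> R" shows "kap (\<phi> r) * kap (\<phi> r') = kap (\<phi> (r * \<phi> r'))"
  using kap_scale[OF assms(1), of "kap (\<phi> r')"] kap_R(2)[OF assms(2), of r] by (simp add: mult.commute)

lemma eb_left': "r \<in> R \<Longrightarrow> psum eb (\<lambda>e e'. s (kap (\<phi> (e' * r))) e) = r"
  using eb_left[of r] by (simp add: kap_R(2) R_mult cong: psum_cong_map)

lemma eb_right': "r \<in> R \<Longrightarrow> psum eb (\<lambda>e e'. s (kap (\<phi> (r * e))) e') = r"
  using eb_right[of r] by (simp add: kap_R(1) R_mult cong: psum_cong_map)

lemma lf_psum: assumes "x \<in> C" "\<And>a b. (a, b) \<in> set xs \<Longrightarrow> F a b \<in> R"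
  shows "lf (psum xs F) x = psum xs (\<lambda>a b. lf (F a b) x)" "rt (psum xs F) x = psum xs (\<lambda>a b. rt (F a b) x)"
  by (rule psum_hom_on[of R "\<lambda>r. lf r x"] psum_hom_on[of R "\<lambda>r. rt r x"]; use assms in \<open>auto simp: R_0 R_add ops_add\<close>)+

text \<open>
  The defining property of the quasibasis of \<open>R\<close> turns the counit into evaluation at \<open>1\<close>.
\<close>
lemma kap_bracket_left:
  assumes "x \<in> C" "y \<in> C"
  shows "bracket (\<lambda>a b. sc (ep a) b) x y = lf (al x 1) y"
proof -
  have "bracket (\<lambda>a b. sc (ep a) b) x y = psum eb (\<lambda>e e'. lf (s (kap (\<phi> (al x 1 * e))) e') y)"
    unfolding bracket_def using assms by (intro psum_cong) (simp add: ops_scale)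
  also have "\<dots> = lf (psum eb (\<lambda>e e'. s (kap (\<phi> (al x 1 * e))) e')) y"
    using assms by (intro lf_psum(1)[symmetric]) (auto intro!: R_scale)
  finally show ?thesis using assms by (simp add: eb_right')
qed

lemma kap_bracket_right:
  assumes "x \<in> C" "y \<in> C"
  shows "bracket (\<lambda>a b. sc (ep b) a) x y = rt (al y 1) x"
proof -
  have "bracket (\<lambda>a b. sc (ep b) a) x y = psum eb (\<lambda>e e'. rt (s (kap (\<phi> (e' * al y 1))) e) x)"
    unfolding bracket_def using assms by (intro psum_cong) (simp add: ops_scale)
  also have "\<dots> = rt (psum eb (\<lambda>e e'. s (kap (\<phi> (e' * al y 1))) e)) x"
    using assms by (intro lf_psum(2)[symmetric]) (auto intro!: R_scale)
  finally show ?thesis using assms by (simp add: eb_left')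
qed

lemma counit_A:
  assumes "w \<in> C"
  shows "psum (cop A w) (\<lambda>a b. sc (ep a) b) = w" "psum (cop A w) (\<lambda>a b. sc (ep b) a) = w"
proof -
  interpret v: vector_space sc by (rule fd_spaceD[OF fd_C])
  have k: "kbal (\<lambda>a b. sc (ep a) b)" "kbal (\<lambda>a b. sc (ep b) a)"
    by (rule kbalI; simp add: ep_linear v.scale_right_distrib v.scale_left_distrib algebra_simps)+
  have C: "lf (al a 1) b \<in> C" "rt (al b 1) a \<in> C" if "(a, b) \<in> set (cop A w)" for a b
    using that cop_C[OF assms] by auto
  have "psum (cop A w) (\<lambda>a b. sc (ep a) b) = psum (cop A w) (\<lambda>a b. lf (al a 1) b)"
    unfolding cop_bracket[OF k(1) assms] by (rule cop_A_cong[OF assms]) (rule kap_bracket_left)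
  also have "\<dots> = w"
  proof (rule al_eqI)
    fix m
    have "al (psum (cop A w) (\<lambda>a b. lf (al a 1) b)) m = psum (cop A w) (\<lambda>a b. al (lf (al a 1) b) m)"
      by (rule al_psum) (rule C)
    also have "\<dots> = psum (cop A w) (\<lambda>a b. al a 1 * al b m)" by (rule cop_A_cong[OF assms]) simp
    finally show "al (psum (cop A w) (\<lambda>a b. lf (al a 1) b)) m = al w m" using assms by (simp add: cop_apply)
  qed (use assms in \<open>auto intro!: C_psum C\<close>)
  finally show "psum (cop A w) (\<lambda>a b. sc (ep a) b) = w" .
  have "psum (cop A w) (\<lambda>a b. sc (ep b) a) = psum (cop A w) (\<lambda>a b. rt (al b 1) a)"
    unfolding cop_bracket[OF k(2) assms] by (rule cop_A_cong[OF assms]) (rule kap_bracket_right)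
  also have "\<dots> = w"
  proof (rule al_eqI)
    fix m
    have "al (psum (cop A w) (\<lambda>a b. rt (al b 1) a)) m = psum (cop A w) (\<lambda>a b. al (rt (al b 1) a) m)"
      by (rule al_psum) (rule C)
    also have "\<dots> = psum (cop A w) (\<lambda>a b. al a m * al b 1)" by (rule cop_A_cong[OF assms]) simp
    finally show "al (psum (cop A w) (\<lambda>a b. rt (al b 1) a)) m = al w m" using assms by (simp add: cop_apply)
  qed (use assms in \<open>auto intro!: C_psum C\<close>)
  finally show "psum (cop A w) (\<lambda>a b. sc (ep b) a) = w" .
qed

lemma fin_dim_algebra_A: "fin_dim_algebra A"
  unfolding fin_dim_algebra_def A_simps
proof (intro conjI ballI)
  show "vector_space sc" "\<exists>B. finite B \<and> C = module.span sc B" using fd_C by (auto simp: fd_space_def)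
  show "mu (mu x y) z = mu x (mu y z)" if "x \<in> C" "y \<in> C" "z \<in> C" for x y z
    using that by (intro al_eqI) simp_all
  show "mu one x = x" "mu x one = x" if "x \<in> C" for x
    using that by (auto intro!: al_eqI)
qed (auto simp: linear_on_def ops_add ops_scale)

lemma coalgebra_A: "coalgebra A"
  unfolding coalgebra_def A_simps psum_def[symmetric]
proof (intro conjI ballI allI)
  fix w assume w: "w \<in> C"
  show "set (cop A w) \<subseteq> C \<times> C" by (rule cop_C[OF w])
  show "psum (cop A w) (\<lambda>a. sc (ep a)) = w" by (rule counit_A(1)[OF w])
  show "psum (cop A w) (\<lambda>a b. sc (ep b) a) = w" by (rule counit_A(2)[OF w])
  show "tensor3_eq sc C [(a, b, c). (x, c) \<leftarrow> cop A w, (a, b) \<leftarrow> cop A x]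
      [(a, b, c). (a, y) \<leftarrow> cop A w, (b, c) \<leftarrow> cop A y]"
    by (rule tensor3I) (simp_all only: tsum_cop_left tsum_cop_right cop_iter_C[OF w] coassoc_A[OF _ w])
next
  fix x y assume "x \<in> C" "y \<in> C"
  then show "tensor2_eq sc C (cop A (x + y)) (cop A x @ cop A y)"
    using cop_C by (intro cop_tensorI) (auto simp: cop_add)
next
  fix c x assume x: "x \<in> C"
  show "tensor2_eq sc C (cop A (sc c x)) [(sc c a, b). (a, b) \<leftarrow> cop A x]"
    using x cop_C[OF x] by (intro cop_tensorI) (auto simp: cop_scale psum_map)
qed (simp add: linear_on_def ep_linear)

text \<open>
  As in the counit law, the quasibasis turns the product of the two values of \<open>\<epsilon>\<close> into
  \<open>\<phi>(x(y\<^sub>1(r) y\<^sub>2(r')))\<close>, with \<open>r, r'\<close> equal to \<open>1\<close> and \<open>z(1)\<close> in one or the other order.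
\<close>
lemma counit_mult:
  assumes "x \<in> C" "y \<in> C" "z \<in> C"
  shows "psum (cop A y) (\<lambda>a b. ep (mu x a) * ep (mu b z)) = ep (mu (mu x y) z)"
    "psum (cop A y) (\<lambda>a b. ep (mu x b) * ep (mu a z)) = ep (mu (mu x y) z)"
proof -
  have sum: "psum (cop A y) (\<lambda>a b. kap (\<phi> (al x (al a r * al b r')))) = kap (\<phi> (al x (al y (r * r'))))"
    if "r \<in> R" "r' \<in> R" for r r'
  proof -
    have "psum (cop A y) (\<lambda>a b. kap (\<phi> (al x (al a r * al b r')))) = kap (\<phi> (psum (cop A y) (\<lambda>a b. al x (al a r * al b r'))))"
      using that assms cop_C[OF assms(2)] by (intro kap_psum[symmetric]) (auto intro!: al_R R_mult)
    also have "\<dots> = kap (\<phi> (al x (psum (cop A y) (\<lambda>a b. al a r * al b r'))))"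
      using assms by (simp add: E_psum)
    finally show ?thesis using assms by (simp add: cop_apply)
  qed
  have k: "kbal (\<lambda>a b. ep (mu x a) * ep (mu b z))" "kbal (\<lambda>a b. ep (mu x b) * ep (mu a z))"
    using assms by (intro kbalI; simp add: ops_add ops_scale ep_linear algebra_simps)+
  have mult: "kap (\<phi> (al x u)) * kap (\<phi> v) = kap (\<phi> (al x (u * \<phi> v)))" if "u \<in> R" "v \<in> R" for u v
    using that assms kap_R(2)[OF that(2)] kap_mult[of "al x u" v] by (simp add: al_linear flip: kap_R(2))
  have "psum (cop A y) (\<lambda>a b. ep (mu x a) * ep (mu b z)) = psum (cop A y) (\<lambda>a b. kap (\<phi> (al x (al a 1 * al b (al z 1)))))"
    unfolding cop_bracket[OF k(1) assms(2)]
  proof (rule cop_A_cong[OF assms(2)])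
    fix a b assume ab: "a \<in> C" "b \<in> C"
    have "bracket (\<lambda>a b. ep (mu x a) * ep (mu b z)) a b =
        psum eb (\<lambda>e e'. kap (\<phi> (al x (al a 1 * (e * \<phi> (e' * al b (al z 1)))))))"
      unfolding bracket_def using ab assms by (intro psum_cong) (simp add: mult R_mult mult.assoc)
    also have "\<dots> = kap (\<phi> (al x (al a 1 * psum eb (\<lambda>e e'. e * \<phi> (e' * al b (al z 1))))))"
      unfolding psum_mult_left[symmetric] E_psum[OF al_E[OF assms(1)]]
      using ab assms by (intro kap_psum[symmetric]) (auto intro!: al_R R_mult R_1 phi_R_R)
    finally show "bracket (\<lambda>a b. ep (mu x a) * ep (mu b z)) a b = kap (\<phi> (al x (al a 1 * al b (al z 1))))"
      using ab assms by (simp add: eb_left)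
  qed
  with sum[of 1 "al z 1"] assms R_1
  show "psum (cop A y) (\<lambda>a b. ep (mu x a) * ep (mu b z)) = ep (mu (mu x y) z)" by simp
  have "psum (cop A y) (\<lambda>a b. ep (mu x b) * ep (mu a z)) = psum (cop A y) (\<lambda>a b. kap (\<phi> (al x (al a (al z 1) * al b 1))))"
    unfolding cop_bracket[OF k(2) assms(2)]
  proof (rule cop_A_cong[OF assms(2)])
    fix a b assume ab: "a \<in> C" "b \<in> C"
    have "bracket (\<lambda>a b. ep (mu x b) * ep (mu a z)) a b =
        psum eb (\<lambda>e e'. kap (\<phi> (al x ((\<phi> (al a (al z 1) * e) * e') * al b 1))))"
      unfolding bracket_def
    proof (rule psum_cong)
      fix e e' assume e: "(e, e') \<in> set eb"
      \<comment> \<open>Values of \<open>\<phi>\<close> lie in \<open>N\<close> and so commute with \<open>R\<close>.\<close>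
      have c: "e' * al b 1 * \<phi> (al a (al z 1) * e) = \<phi> (al a (al z 1) * e) * e' * al b 1"
        using R_commute[of "e' * al b 1", OF _ phi_N] e ab by (simp add: R_mult mult.assoc)
      show "ep (mu x (lf e' b)) * ep (mu (rt e a) z) = kap (\<phi> (al x (\<phi> (al a (al z 1) * e) * e' * al b 1)))"
        using ab assms e by (simp add: mult R_mult flip: c)
    qed
    also have "\<dots> = kap (\<phi> (al x (psum eb (\<lambda>e e'. \<phi> (al a (al z 1) * e) * e') * al b 1)))"
      unfolding psum_mult_right[symmetric] E_psum[OF al_E[OF assms(1)]]
      using ab assms by (intro kap_psum[symmetric]) (auto intro!: al_R R_mult R_1 phi_R_R)
    finally show "bracket (\<lambda>a b. ep (mu x b) * ep (mu a z)) a b = kap (\<phi> (al x (al a (al z 1) * al b 1)))"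
      using ab assms by (simp add: eb_right)
  qed
  with sum[of "al z 1" 1] assms R_1
  show "psum (cop A y) (\<lambda>a b. ep (mu x b) * ep (mu a z)) = ep (mu (mu x y) z)" by simp
qed

lemma kbal_cop_left:
  assumes "kbal3 T" shows "kbal (\<lambda>x c. psum (cop A x) (\<lambda>a b. T a b c))"
proof (rule kbalI)
  have T1: "a \<in> C \<Longrightarrow> kbal (T a)" and T2: "c \<in> C \<Longrightarrow> kbal (\<lambda>a b. T a b c)" for a c
    using assms by (auto simp: kbal3_def)
  show "psum (cop A (x + x')) (\<lambda>a b. T a b y) = psum (cop A x) (\<lambda>a b. T a b y) + psum (cop A x') (\<lambda>a b. T a b y)"
    if "x \<in> C" "x' \<in> C" "y \<in> C" for x x' y
    using that by (intro cop_add T2)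
  show "psum (cop A x) (\<lambda>a b. T a b (y + y')) = psum (cop A x) (\<lambda>a b. T a b y) + psum (cop A x) (\<lambda>a b. T a b y')"
    if "x \<in> C" "y \<in> C" "y' \<in> C" for x y y'
    using that by (subst psum_add[symmetric], intro cop_A_cong) (simp_all add: kbalD[OF T1])
  show "psum (cop A (sc c x)) (\<lambda>a b. T a b y) = psum (cop A x) (\<lambda>a b. T a b (sc c y))"
    if "x \<in> C" "y \<in> C" for x y c
    unfolding cop_scale[OF T2[OF that(2)] that(1)]
    using that by (intro cop_A_cong) (simp_all add: kbalD[OF T1] kbalD(3)[OF T2])
qed

text \<open>
  Here \<open>\<Delta>(1) = \<Sum> (_ e\<^sub>i) \<otimes> (e\<^sup>i _)\<close>, and the left and right multiplications commute.
\<close>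
lemma cop_A_one_iterated:
  assumes T: "kbal3 T"
  shows "psum (cop A one) (\<lambda>x c. psum (cop A x) (\<lambda>a b. T a b c)) =
    psum eb (\<lambda>d d'. psum eb (\<lambda>e e'. T (rt e one) (rt d (lf e' one)) (lf d' one)))"
proof -
  have T2: "c \<in> C \<Longrightarrow> kbal (\<lambda>a b. T a b c)" for c using T by (auto simp: kbal3_def)
  have "psum (cop A (rt d one)) (\<lambda>a b. T a b (lf d' one)) =
      psum eb (\<lambda>e e'. T (rt e one) (rt d (lf e' one)) (lf d' one))" if d: "(d, d') \<in> set eb" for d d'
  proof -
    have T2': "kbal (\<lambda>a b. T a b (lf d' one))" using d by (intro T2) simp
    have "psum (cop A (rt d one)) (\<lambda>a b. T a b (lf d' one)) = psum (cop A one) (\<lambda>a b. T a (rt d b) (lf d' one))"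
      using d by (intro cop_rt[OF T2']) simp_all
    also have "\<dots> = bracket (\<lambda>a b. T a (rt d b) (lf d' one)) one one"
      using d by (intro cop_one kbalI) (simp_all add: ops_add ops_scale kbalD[OF T2'])
    finally show ?thesis by (simp add: bracket_def)
  qed
  then show ?thesis unfolding cop_one[OF kbal_cop_left[OF T]] bracket_def by (intro psum_cong) simp
qed

lemma cop_one_nested:
  assumes F1: "\<And>a' b'. a' \<in> C \<Longrightarrow> b' \<in> C \<Longrightarrow> kbal (\<lambda>a b. F a b a' b')"
    and F2: "\<And>a b. a \<in> C \<Longrightarrow> b \<in> C \<Longrightarrow> kbal (F a b)"
  shows "psum (cop A one) (\<lambda>a b. psum (cop A one) (\<lambda>a' b'. F a b a' b')) =
    psum eb (\<lambda>d d'. psum eb (\<lambda>e e'. F (rt e one) (lf e' one) (rt d one) (lf d' one)))"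
proof -
  have "psum (cop A one) (\<lambda>a b. psum (cop A one) (F a b)) =
      psum (cop A one) (\<lambda>a b. psum eb (\<lambda>d d'. F a b (rt d one) (lf d' one)))"
    by (rule cop_A_cong) (simp_all add: cop_one[OF F2] bracket_def)
  also have "\<dots> = psum eb (\<lambda>d d'. psum (cop A one) (\<lambda>a b. F a b (rt d one) (lf d' one)))"
    by (rule psum_swap)
  also have "\<dots> = psum eb (\<lambda>d d'. psum eb (\<lambda>e e'. F (rt e one) (lf e' one) (rt d one) (lf d' one)))"
    by (rule psum_cong) (simp add: cop_one[OF F1] bracket_def)
  finally show ?thesis .
qed

lemma cop_one_double:
  assumes T: "kbal3 T"
  shows "psum (cop A one) (\<lambda>a b. psum (cop A one) (\<lambda>a' b'. T a (mu b a') b')) =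
      psum eb (\<lambda>d d'. psum eb (\<lambda>e e'. T (rt e one) (rt d (lf e' one)) (lf d' one)))"
    and "psum (cop A one) (\<lambda>a' b'. psum (cop A one) (\<lambda>a b. T a (mu a' b) b')) =
      psum eb (\<lambda>d d'. psum eb (\<lambda>e e'. T (rt e one) (rt d (lf e' one)) (lf d' one)))"
proof -
  have T1: "a \<in> C \<Longrightarrow> kbal (T a)" and T2: "c \<in> C \<Longrightarrow> kbal (\<lambda>a b. T a b c)" for a c
    using T by (auto simp: kbal3_def)
  have m: "mu (lf r' one) (rt r one) = rt r (lf r' one)" "mu (rt r one) (lf r' one) = rt r (lf r' one)"
    if "r \<in> R" "r' \<in> R" for r r'
    using that by (auto intro!: al_eqI simp: mult.assoc)
  have "psum (cop A one) (\<lambda>a b. psum (cop A one) (\<lambda>a' b'. T a (mu b a') b')) =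
      psum eb (\<lambda>d d'. psum eb (\<lambda>e e'. T (rt e one) (mu (lf e' one) (rt d one)) (lf d' one)))"
    by (rule cop_one_nested; rule kbalI) (simp_all add: ops_add ops_scale kbalD[OF T1] kbalD[OF T2])
  then show "psum (cop A one) (\<lambda>a b. psum (cop A one) (\<lambda>a' b'. T a (mu b a') b')) =
      psum eb (\<lambda>d d'. psum eb (\<lambda>e e'. T (rt e one) (rt d (lf e' one)) (lf d' one)))"
    by (simp add: m cong: psum_cong_map)
  have "psum (cop A one) (\<lambda>a' b'. psum (cop A one) (\<lambda>a b. T a (mu a' b) b')) =
      psum eb (\<lambda>e e'. psum eb (\<lambda>d d'. T (rt e one) (mu (rt d one) (lf e' one)) (lf d' one)))"
    by (rule cop_one_nested; rule kbalI) (simp_all add: ops_add ops_scale kbalD[OF T1] kbalD[OF T2])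
  then show "psum (cop A one) (\<lambda>a' b'. psum (cop A one) (\<lambda>a b. T a (mu a' b) b')) =
      psum eb (\<lambda>d d'. psum eb (\<lambda>e e'. T (rt e one) (rt d (lf e' one)) (lf d' one)))"
    by (subst psum_swap) (simp add: m cong: psum_cong_map)
qed

lemma weak_bialgebra_A: "weak_bialgebra A"
  unfolding weak_bialgebra_def A_simps psum_def[symmetric]
proof (intro conjI ballI)
  show "fin_dim_algebra A" by (rule fin_dim_algebra_A)
  show "coalgebra A" by (rule coalgebra_A)
  show "tensor2_eq sc C (cop A (mu x y)) [(mu a a', mu b b'). (a, b) \<leftarrow> cop A x, (a', b') \<leftarrow> cop A y]"
    if "x \<in> C" "y \<in> C" for x y
    using that cop_C[OF that(1)] cop_C[OF that(2)]
    by (intro cop_tensorI) (auto intro!: ops_C(2) simp: cop_mu psum_concat psum_map)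
  fix x y z assume "x \<in> C" "y \<in> C" "z \<in> C"
  then show "psum (cop A y) (\<lambda>a b. ep (mu x a) * ep (mu b z)) = ep (mu (mu x y) z)"
    "psum (cop A y) (\<lambda>a b. ep (mu x b) * ep (mu a z)) = ep (mu (mu x y) z)"
    by (rule counit_mult)+
next
  have C1: "a \<in> C \<and> b \<in> C" if "(a, b) \<in> set (cop A one)" for a b using that cop_C[of one] by auto
  have m: "mu one x = x" "mu x one = x" if "x \<in> C" for x using that by (auto intro!: al_eqI)
  show "tensor3_eq sc C
       [(mu a one, mu b a', mu one b'). (a, b) \<leftarrow> cop A one, (a', b') \<leftarrow> cop A one]
       [(a, b, c). (x, c) \<leftarrow> cop A one, (a, b) \<leftarrow> cop A x]"
  proof (rule tensor3I)
    show "set [(mu a one, mu b a', mu one b'). (a, b) \<leftarrow> cop A one, (a', b') \<leftarrow> cop A one] \<subseteq> C \<times> C \<times> C"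
      using C1 by (auto intro!: ops_C(2))
    fix T :: "'c \<Rightarrow> 'c \<Rightarrow> 'c \<Rightarrow> 'c" assume T: "kbal3 T"
    have "tsum [(mu a one, mu b a', mu one b'). (a, b) \<leftarrow> cop A one, (a', b') \<leftarrow> cop A one] T =
        psum (cop A one) (\<lambda>a b. psum (cop A one) (\<lambda>a' b'. T a (mu b a') b'))"
      unfolding tsum_concat tsum_map by (rule cop_A_cong, simp, rule cop_A_cong, simp) (simp add: m)
    then show "tsum [(mu a one, mu b a', mu one b'). (a, b) \<leftarrow> cop A one, (a', b') \<leftarrow> cop A one] T =
        tsum [(a, b, c). (x, c) \<leftarrow> cop A one, (a, b) \<leftarrow> cop A x] T"
      unfolding tsum_cop_left cop_one_double[OF T] cop_A_one_iterated[OF T] .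
  qed (rule cop_iter_C, simp)
  show "tensor3_eq sc C
       [(mu one a, mu a' b, mu b' one). (a', b') \<leftarrow> cop A one, (a, b) \<leftarrow> cop A one]
       [(a, b, c). (x, c) \<leftarrow> cop A one, (a, b) \<leftarrow> cop A x]"
  proof (rule tensor3I)
    show "set [(mu one a, mu a' b, mu b' one). (a', b') \<leftarrow> cop A one, (a, b) \<leftarrow> cop A one] \<subseteq> C \<times> C \<times> C"
      using C1 by (auto intro!: ops_C(2))
    fix T :: "'c \<Rightarrow> 'c \<Rightarrow> 'c \<Rightarrow> 'c" assume T: "kbal3 T"
    have "tsum [(mu one a, mu a' b, mu b' one). (a', b') \<leftarrow> cop A one, (a, b) \<leftarrow> cop A one] T =
        psum (cop A one) (\<lambda>a' b'. psum (cop A one) (\<lambda>a b. T a (mu a' b) b'))"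
      unfolding tsum_concat tsum_map by (rule cop_A_cong, simp, rule cop_A_cong, simp) (simp add: m)
    then show "tsum [(mu one a, mu a' b, mu b' one). (a', b') \<leftarrow> cop A one, (a, b) \<leftarrow> cop A one] T =
        tsum [(a, b, c). (x, c) \<leftarrow> cop A one, (a, b) \<leftarrow> cop A x] T"
      unfolding tsum_cop_left cop_one_double[OF T] cop_A_one_iterated[OF T] .
  qed (rule cop_iter_C, simp)
qed

end

section \<open>Weak bialgebras and their actions\<close>

lemma psum_list_comp: "(\<Sum>(a, b)\<leftarrow>xs. F a b) = psum xs F"
  by (simp add: psum_def)

locale weak_bialgebra_space =
  fixes W :: "('k::field, 'w::ab_group_add, 'z) wba_scheme"
  assumes wba: "weak_bialgebra W"
begin

lemma fd: "fd_space (scl W) (car W)"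
  using wba by (auto simp: weak_bialgebra_def fin_dim_algebra_def fd_space_def)

lemma closed [simp]: "0 \<in> car W" "x \<in> car W \<Longrightarrow> y \<in> car W \<Longrightarrow> x + y \<in> car W"
  "x \<in> car W \<Longrightarrow> scl W c x \<in> car W" "unt W \<in> car W" "x \<in> car W \<Longrightarrow> y \<in> car W \<Longrightarrow> mul W x y \<in> car W"
  using fd_spaceD[OF fd] wba by (auto simp: weak_bialgebra_def fin_dim_algebra_def)

lemma psum_car: "(\<And>a b. (a, b) \<in> set xs \<Longrightarrow> F a b \<in> car W) \<Longrightarrow> psum xs F \<in> car W"
  by (rule psum_in) auto

lemma unt_mul [simp]: "x \<in> car W \<Longrightarrow> mul W (unt W) x = x" "x \<in> car W \<Longrightarrow> mul W x (unt W) = x"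
  using wba by (auto simp: weak_bialgebra_def fin_dim_algebra_def)

lemma mul_assoc: "x \<in> car W \<Longrightarrow> y \<in> car W \<Longrightarrow> z \<in> car W \<Longrightarrow> mul W (mul W x y) z = mul W x (mul W y z)"
  using wba unfolding weak_bialgebra_def fin_dim_algebra_def by blast

lemma mul_linear: "x \<in> car W \<Longrightarrow> linear_on (car W) (scl W) (scl W) (mul W x)"
  "x \<in> car W \<Longrightarrow> linear_on (car W) (scl W) (scl W) (\<lambda>y. mul W y x)"
  using wba unfolding weak_bialgebra_def fin_dim_algebra_def by blast+

lemma mul_add: "x \<in> car W \<Longrightarrow> y \<in> car W \<Longrightarrow> z \<in> car W \<Longrightarrow> mul W x (y + z) = mul W x y + mul W x z"
  "x \<in> car W \<Longrightarrow> y \<in> car W \<Longrightarrow> z \<in> car W \<Longrightarrow> mul W (y + z) x = mul W y x + mul W z x"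
  "x \<in> car W \<Longrightarrow> y \<in> car W \<Longrightarrow> mul W x (scl W c y) = scl W c (mul W x y)"
  "x \<in> car W \<Longrightarrow> y \<in> car W \<Longrightarrow> mul W (scl W c y) x = scl W c (mul W y x)"
  using mul_linear[of x] by (auto simp: linear_on_def)

lemma coalgebra: "coalgebra W"
  using wba by (simp add: weak_bialgebra_def)

lemma eps_linear_on: "linear_on (car W) (scl W) (*) (eps W)"
  using coalgebra by (simp add: coalgebra_def)

lemma eps_linear: "x \<in> car W \<Longrightarrow> y \<in> car W \<Longrightarrow> eps W (x + y) = eps W x + eps W y"
  "x \<in> car W \<Longrightarrow> eps W (scl W c x) = c * eps W x"
  using eps_linear_on by (auto simp: linear_on_def)

lemma cop_car: "w \<in> car W \<Longrightarrow> set (cop W w) \<subseteq> car W \<times> car W"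
  using coalgebra by (simp add: coalgebra_def)

lemma cop_cong:
  assumes "w \<in> car W" "\<And>a b. a \<in> car W \<Longrightarrow> b \<in> car W \<Longrightarrow> F a b = G a b"
  shows "psum (cop W w) F = psum (cop W w) G"
  using cop_car[OF assms(1)] assms(2) by (intro psum_cong) blast

lemma cop_psum_car: "w \<in> car W \<Longrightarrow> (\<And>a b. a \<in> car W \<Longrightarrow> b \<in> car W \<Longrightarrow> F a b \<in> car W) \<Longrightarrow> psum (cop W w) F \<in> car W"
  using cop_car by (intro psum_car) blast

lemma linear_cop_psum:
  assumes "linear_on (car W) (scl W) t f" "w \<in> car W" "\<And>a b. a \<in> car W \<Longrightarrow> b \<in> car W \<Longrightarrow> F a b \<in> car W"
  shows "f (psum (cop W w) F) = psum (cop W w) (\<lambda>a b. f (F a b))"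
  using cop_car[OF assms(2)] assms(3) by (intro linear_on_psum[OF assms(1) fd]) blast

lemma counit: "w \<in> car W \<Longrightarrow> psum (cop W w) (\<lambda>a b. scl W (eps W a) b) = w"
  "w \<in> car W \<Longrightarrow> psum (cop W w) (\<lambda>a b. scl W (eps W b) a) = w"
  using coalgebra by (simp_all add: coalgebra_def psum_list_comp)

lemma coassoc:
  assumes "trilinear_on (car W) (scl W) t T" "w \<in> car W"
  shows "psum (cop W w) (\<lambda>x c. psum (cop W x) (\<lambda>a b. T a b c)) =
    psum (cop W w) (\<lambda>a y. psum (cop W y) (\<lambda>b c. T a b c))"
proof -
  have "tensor3_eq (scl W) (car W)
        [(a, b, c). (x, c) \<leftarrow> cop W w, (a, b) \<leftarrow> cop W x]
        [(a, b, c). (a, y) \<leftarrow> cop W w, (b, c) \<leftarrow> cop W y]"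
    using coalgebra assms(2) by (simp add: coalgebra_def)
  from tensor3_eq_tsum[OF this _ assms(1)] show ?thesis
    by (simp add: tsum_concat tsum_map tsum_map_Pair)
qed

lemma cop_one_iterated:
  assumes T: "trilinear_on (car W) (scl W) t T"
  shows "psum (cop W (unt W)) (\<lambda>x c. psum (cop W x) (\<lambda>a b. T a b c)) =
      psum (cop W (unt W)) (\<lambda>a b. psum (cop W (unt W)) (\<lambda>a' b'. T a (mul W b a') b'))"
    and "psum (cop W (unt W)) (\<lambda>x c. psum (cop W x) (\<lambda>a b. T a b c)) =
      psum (cop W (unt W)) (\<lambda>a' b'. psum (cop W (unt W)) (\<lambda>a b. T a (mul W a' b) b'))"
proof -
  have 1: "tensor3_eq (scl W) (car W)
       [(mul W a (unt W), mul W b a', mul W (unt W) b'). (a, b) \<leftarrow> cop W (unt W), (a', b') \<leftarrow> cop W (unt W)]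
       [(a, b, c). (x, c) \<leftarrow> cop W (unt W), (a, b) \<leftarrow> cop W x]"
    and 2: "tensor3_eq (scl W) (car W)
       [(mul W (unt W) a, mul W a' b, mul W b' (unt W)). (a', b') \<leftarrow> cop W (unt W), (a, b) \<leftarrow> cop W (unt W)]
       [(a, b, c). (x, c) \<leftarrow> cop W (unt W), (a, b) \<leftarrow> cop W x]"
    using wba by (simp_all add: weak_bialgebra_def)
  have "psum (cop W (unt W)) (\<lambda>a b. psum (cop W (unt W)) (\<lambda>a' b'. T a (mul W b a') b')) =
    psum (cop W (unt W)) (\<lambda>a b. psum (cop W (unt W)) (\<lambda>a' b'. T (mul W a (unt W)) (mul W b a') (mul W (unt W) b')))"
    by (rule cop_cong, simp, rule cop_cong, simp) simp
  with tensor3_eq_tsum[OF 1 _ T] show "psum (cop W (unt W)) (\<lambda>x c. psum (cop W x) (\<lambda>a b. T a b c)) =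
      psum (cop W (unt W)) (\<lambda>a b. psum (cop W (unt W)) (\<lambda>a' b'. T a (mul W b a') b'))"
    by (simp add: tsum_concat tsum_map)
  have "psum (cop W (unt W)) (\<lambda>a' b'. psum (cop W (unt W)) (\<lambda>a b. T a (mul W a' b) b')) =
    psum (cop W (unt W)) (\<lambda>a' b'. psum (cop W (unt W)) (\<lambda>a b. T (mul W (unt W) a) (mul W a' b) (mul W b' (unt W))))"
    by (rule cop_cong, simp, rule cop_cong, simp) simp
  with tensor3_eq_tsum[OF 2 _ T] show "psum (cop W (unt W)) (\<lambda>x c. psum (cop W x) (\<lambda>a b. T a b c)) =
      psum (cop W (unt W)) (\<lambda>a' b'. psum (cop W (unt W)) (\<lambda>a b. T a (mul W a' b) b'))"
    by (simp add: tsum_concat tsum_map)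
qed

lemma cop_mul:
  assumes "bilinear_on (car W) (scl W) t B" "x \<in> car W" "y \<in> car W"
  shows "psum (cop W (mul W x y)) B = psum (cop W x) (\<lambda>a b. psum (cop W y) (\<lambda>a' b'. B (mul W a a') (mul W b b')))"
proof -
  have "tensor2_eq (scl W) (car W) (cop W (mul W x y))
        [(mul W a a', mul W b b'). (a, b) \<leftarrow> cop W x, (a', b') \<leftarrow> cop W y]"
    using wba assms by (simp add: weak_bialgebra_def)
  from tensor2_eq_psum[OF this _ assms(1)] show ?thesis by (simp add: psum_concat psum_map)
qed

lemma eps_mul:
  assumes "x \<in> car W" "y \<in> car W" "z \<in> car W"
  shows "psum (cop W y) (\<lambda>a b. eps W (mul W x a) * eps W (mul W b z)) = eps W (mul W (mul W x y) z)"
  using wba assms by (simp add: weak_bialgebra_def psum_list_comp)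

lemma piL_psum: "piL W w = psum (cop W (unt W)) (\<lambda>a b. scl W (eps W (mul W a w)) b)"
  and piR_psum: "piR W w = psum (cop W (unt W)) (\<lambda>a b. scl W (eps W (mul W w b)) a)"
  and tL_psum: "tL W w = psum (cop W (unt W)) (\<lambda>a b. scl W (eps W (mul W b w)) a)"
  by (simp_all add: piL_def piR_def tL_def psum_list_comp)

lemma pi_car [simp]: "w \<in> car W \<Longrightarrow> piL W w \<in> car W" "w \<in> car W \<Longrightarrow> piR W w \<in> car W" "w \<in> car W \<Longrightarrow> tL W w \<in> car W"
  by (simp_all add: piL_psum piR_psum tL_psum cop_psum_car)

lemma left_subalgebra_car: "l \<in> left_subalgebra W \<Longrightarrow> l \<in> car W"
  by (auto simp: left_subalgebra_def)

lemma eps_mul_psum: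
  assumes "x \<in> car W" "w \<in> car W" "\<And>a b. a \<in> car W \<Longrightarrow> b \<in> car W \<Longrightarrow> F a b \<in> car W"
  shows "eps W (mul W x (psum (cop W w) F)) = psum (cop W w) (\<lambda>a b. eps W (mul W x (F a b)))"
    "eps W (mul W (psum (cop W w) F) x) = psum (cop W w) (\<lambda>a b. eps W (mul W (F a b) x))"
  using assms
  by (intro linear_cop_psum[where t = "(*)" and f = "\<lambda>y. eps W (mul W x y)"]
      linear_cop_psum[where t = "(*)" and f = "\<lambda>y. eps W (mul W y x)"];
    simp add: linear_on_def mul_add eps_linear)+

text \<open>
  The weak multiplicativity of the counit gives \<open>\<epsilon>(a t\<^sup>L(w)) = \<epsilon>(a w)\<close>.
\<close>
lemma piL_tL: assumes "w \<in> car W" shows "piL W (tL W w) = piL W w"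
proof -
  have "eps W (mul W a (tL W w)) = eps W (mul W a w)" if a: "a \<in> car W" for a
  proof -
    have "eps W (mul W a (tL W w)) = psum (cop W (unt W)) (\<lambda>c d. eps W (mul W a (scl W (eps W (mul W d w)) c)))"
      unfolding tL_psum using a assms by (intro eps_mul_psum) simp_all
    also have "\<dots> = psum (cop W (unt W)) (\<lambda>c d. eps W (mul W a c) * eps W (mul W d w))"
      using a assms by (intro cop_cong) (simp_all add: mul_add eps_linear mult.commute)
    also have "\<dots> = eps W (mul W a w)" using a assms by (simp add: eps_mul)
    finally show ?thesis .
  qed
  then show ?thesis unfolding piL_psum by (intro cop_cong) simp_all
qed

lemma eps_piL: assumes "w \<in> car W" shows "eps W (piL W w) = eps W w"
proof -
  have "eps W (piL W w) = psum (cop W (unt W)) (\<lambda>a b. eps W (scl W (eps W (mul W a w)) b))"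
    unfolding piL_psum using assms by (intro linear_cop_psum[OF eps_linear_on]) simp_all
  also have "\<dots> = psum (cop W (unt W)) (\<lambda>a b. eps W (mul W (scl W (eps W b) a) w))"
    using assms by (intro cop_cong) (simp_all add: mul_add eps_linear mult.commute)
  also have "\<dots> = eps W (mul W (psum (cop W (unt W)) (\<lambda>a b. scl W (eps W b) a)) w)"
    using assms by (intro eps_mul_psum(2)[symmetric]) simp_all
  finally show ?thesis using assms by (simp add: counit)
qed

text \<open>
  \<open>\<Delta>(1)\<close> lies in \<open>W \<otimes> W\<^sup>L\<close>, as one sees by applying the counit to the middle leg of
  \<open>(\<Delta> \<otimes> id) \<Delta>(1) = (1 \<otimes> \<Delta>(1)) (\<Delta>(1) \<otimes> 1)\<close>.
\<close>
lemma cop_one_piL: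
  assumes F: "bilinear_on (car W) (scl W) t F" and t: "module t"
  shows "psum (cop W (unt W)) (\<lambda>a b. F a (piL W b)) = psum (cop W (unt W)) F"
proof -
  interpret t: module t by (rule t)
  have F1: "F (x + y) z = F x z + F y z" "F z (x + y) = F z x + F z y"
    "F (scl W c x) z = t c (F x z)" "F z (scl W c x) = t c (F z x)"
    if "x \<in> car W" "y \<in> car W" "z \<in> car W" for x y z c
    using F that by (auto simp: bilinear_on_def linear_on_def)
  have T: "trilinear_on (car W) (scl W) t (\<lambda>a b c. t (eps W b) (F a c))"
    by (simp add: trilinear_on_def bilinear_on_def linear_on_def F1 eps_linear t.scale_left_distrib
        t.scale_right_distrib mult.commute)
  have lin: "linear_on (car W) (scl W) t (F a)" "linear_on (car W) (scl W) t (\<lambda>x. F x a)" if "a \<in> car W" for a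
    using F that by (auto simp: bilinear_on_def)
  have "psum (cop W (unt W)) (\<lambda>a b. F a (piL W b)) =
      psum (cop W (unt W)) (\<lambda>a b. psum (cop W (unt W)) (\<lambda>a' b'. t (eps W (mul W a' b)) (F a b')))"
  proof (rule cop_cong)
    fix a b assume ab: "a \<in> car W" "b \<in> car W"
    have "F a (piL W b) = psum (cop W (unt W)) (\<lambda>a' b'. F a (scl W (eps W (mul W a' b)) b'))"
      unfolding piL_psum using ab by (intro linear_cop_psum[OF lin(1)]) simp_all
    also have "\<dots> = psum (cop W (unt W)) (\<lambda>a' b'. t (eps W (mul W a' b)) (F a b'))"
      using ab by (intro cop_cong) (simp_all add: F1)
    finally show "F a (piL W b) = \<dots>" .
  qed simp
  also have "\<dots> = psum (cop W (unt W)) (\<lambda>a' b'. psum (cop W (unt W)) (\<lambda>a b. t (eps W (mul W a' b)) (F a b')))"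
    by (rule psum_swap)
  also have "\<dots> = psum (cop W (unt W)) (\<lambda>x c. psum (cop W x) (\<lambda>a b. t (eps W b) (F a c)))"
    by (rule cop_one_iterated(2)[OF T, symmetric])
  also have "\<dots> = psum (cop W (unt W)) F"
  proof (rule cop_cong)
    fix x c assume xc: "x \<in> car W" "c \<in> car W"
    have "psum (cop W x) (\<lambda>a b. t (eps W b) (F a c)) = psum (cop W x) (\<lambda>a b. F (scl W (eps W b) a) c)"
      using xc by (intro cop_cong) (simp_all add: F1)
    also have "\<dots> = F (psum (cop W x) (\<lambda>a b. scl W (eps W b) a)) c"
      using xc by (intro linear_cop_psum[OF lin(2), symmetric]) simp_all
    finally show "psum (cop W x) (\<lambda>a b. t (eps W b) (F a c)) = F x c" using xc by (simp add: counit)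
  qed simp
  finally show ?thesis .
qed

definition is_antipode :: "('w \<Rightarrow> 'w) \<Rightarrow> bool" where
  "is_antipode S \<longleftrightarrow> (\<forall>w\<in>car W. S w \<in> car W) \<and> linear_on (car W) (scl W) (scl W) S \<and>
    (\<forall>w\<in>car W. psum (cop W w) (\<lambda>a b. mul W a (S b)) = piL W w \<and>
       psum (cop W w) (\<lambda>a b. mul W (S a) b) = piR W w \<and>
       psum (cop W w) (\<lambda>x c. psum (cop W x) (\<lambda>a b. mul W (mul W (S a) b) (S c))) = S w)"

text \<open>
  \<open>S(w) = S(w\<^sub>1) w\<^sub>2 S(w\<^sub>3) = S(w\<^sub>1) \<pi>\<^sup>L(w\<^sub>2) = S(w\<^sub>1) w\<^sub>2 S'(w\<^sub>3) = \<pi>\<^sup>R(w\<^sub>1) S'(w\<^sub>2) = S'(w)\<close>.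
\<close>
lemma antipode_unique:
  assumes S: "is_antipode S" and S': "is_antipode S'" and w: "w \<in> car W"
  shows "S w = S' w"
proof -
  have SC: "S x \<in> car W" "S' x \<in> car W" if "x \<in> car W" for x using S S' that by (auto simp: is_antipode_def)
  have Sl: "S (x + y) = S x + S y" "S (scl W c x) = scl W c (S x)" "S' (x + y) = S' x + S' y"
    "S' (scl W c x) = scl W c (S' x)" if "x \<in> car W" "y \<in> car W" for x y c
    using S S' that by (auto simp: is_antipode_def linear_on_def)
  have ax: "psum (cop W x) (\<lambda>a b. mul W a (S b)) = piL W x" "psum (cop W x) (\<lambda>a b. mul W a (S' b)) = piL W x"
    "psum (cop W x) (\<lambda>a b. mul W (S a) b) = piR W x" "psum (cop W x) (\<lambda>a b. mul W (S' a) b) = piR W x"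
    "psum (cop W x) (\<lambda>x c. psum (cop W x) (\<lambda>a b. mul W (mul W (S a) b) (S c))) = S x"
    "psum (cop W x) (\<lambda>x c. psum (cop W x) (\<lambda>a b. mul W (mul W (S' a) b) (S' c))) = S' x"
    if "x \<in> car W" for x using S S' that by (auto simp: is_antipode_def)
  have tri: "trilinear_on (car W) (scl W) (scl W) (\<lambda>a b c. mul W (mul W (P a) b) (Q c))"
    if "P = S \<or> P = S'" "Q = S \<or> Q = S'" for P Q
    using that by (auto simp: trilinear_on_def bilinear_on_def linear_on_def Sl SC mul_add)
  have left: "psum (cop W w) (\<lambda>x c. psum (cop W x) (\<lambda>a b. mul W (mul W (S a) b) (Q c))) =
      psum (cop W w) (\<lambda>a y. mul W (S a) (piL W y))" if Q: "Q = S \<or> Q = S'" for Q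
  proof -
    have QC: "Q x \<in> car W" if "x \<in> car W" for x using Q SC that by auto
    have "psum (cop W w) (\<lambda>x c. psum (cop W x) (\<lambda>a b. mul W (mul W (S a) b) (Q c))) =
        psum (cop W w) (\<lambda>a y. psum (cop W y) (\<lambda>b c. mul W (mul W (S a) b) (Q c)))"
      by (rule coassoc[OF tri w]) (use Q in auto)
    also have "\<dots> = psum (cop W w) (\<lambda>a y. mul W (S a) (piL W y))"
    proof (rule cop_cong[OF w])
      fix a y assume ay: "a \<in> car W" "y \<in> car W"
      have "psum (cop W y) (\<lambda>b c. mul W (mul W (S a) b) (Q c)) = psum (cop W y) (\<lambda>b c. mul W (S a) (mul W b (Q c)))"
        using ay by (intro cop_cong) (simp_all add: mul_assoc SC QC)
      also have "\<dots> = mul W (S a) (psum (cop W y) (\<lambda>b c. mul W b (Q c)))"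
        using ay by (intro linear_cop_psum[symmetric, OF mul_linear(1)]) (simp_all add: SC QC)
      also have "psum (cop W y) (\<lambda>b c. mul W b (Q c)) = piL W y" using Q ax ay by auto
      finally show "psum (cop W y) (\<lambda>b c. mul W (mul W (S a) b) (Q c)) = mul W (S a) (piL W y)" .
    qed
    finally show ?thesis .
  qed
  have right: "psum (cop W w) (\<lambda>x c. psum (cop W x) (\<lambda>a b. mul W (mul W (P a) b) (S' c))) =
      psum (cop W w) (\<lambda>x c. mul W (piR W x) (S' c))" if P: "P = S \<or> P = S'" for P
  proof (rule cop_cong[OF w])
    have PC: "P x \<in> car W" if "x \<in> car W" for x using P SC that by auto
    fix x c assume xc: "x \<in> car W" "c \<in> car W"
    have "psum (cop W x) (\<lambda>a b. mul W (mul W (P a) b) (S' c)) = mul W (psum (cop W x) (\<lambda>a b. mul W (P a) b)) (S' c)"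
      using xc by (intro linear_cop_psum[symmetric, OF mul_linear(2)]) (simp_all add: SC PC)
    also have "psum (cop W x) (\<lambda>a b. mul W (P a) b) = piR W x" using P ax xc by auto
    finally show "psum (cop W x) (\<lambda>a b. mul W (mul W (P a) b) (S' c)) = mul W (piR W x) (S' c)" .
  qed
  have "S w = psum (cop W w) (\<lambda>x c. psum (cop W x) (\<lambda>a b. mul W (mul W (S a) b) (S' c)))"
    using left[of S] left[of S'] ax(5)[OF w] by simp
  also have "\<dots> = S' w" using right[of S] right[of S'] ax(6)[OF w] by simp
  finally show ?thesis .
qed

end

locale weak_bialgebra_action = weak_bialgebra_space W
  for W :: "('k::field, 'w::ab_group_add, 'z) wba_scheme" +
  fixes s :: "'k \<Rightarrow> 'm::ring_1 \<Rightarrow> 'm" and act :: "'w \<Rightarrow> 'm \<Rightarrow> 'm"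
  assumes alg: "k_algebra s" and maa: "module_algebra_action s W act"
begin

sublocale vs: vector_space s using alg by (simp add: k_algebra_def)

lemma s_mult: "s a x * y = s a (x * y)" "x * s a y = s a (x * y)"
  using alg by (auto simp: k_algebra_def)

lemma s_psum: "s c (psum xs F) = psum xs (\<lambda>a b. s c (F a b))"
  by (rule psum_hom) (simp add: vs.scale_right_distrib)

lemma act_linear_on: "linear_on (car W) (scl W) s (\<lambda>w. act w m)"
  using maa by (auto simp: module_algebra_action_def)

lemma act_linear: "x \<in> car W \<Longrightarrow> y \<in> car W \<Longrightarrow> act (x + y) m = act x m + act y m"
  "x \<in> car W \<Longrightarrow> act (scl W c x) m = s c (act x m)"
  "w \<in> car W \<Longrightarrow> act w (m + m') = act w m + act w m'" "w \<in> car W \<Longrightarrow> act w (s c m) = s c (act w m)"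
  using maa by (auto simp: module_algebra_action_def linear_on_def)

lemma act_unt [simp]: "act (unt W) m = m"
  and act_mul: "x \<in> car W \<Longrightarrow> y \<in> car W \<Longrightarrow> act (mul W x y) m = act x (act y m)"
  and act_mult: "w \<in> car W \<Longrightarrow> act w (m * m') = psum (cop W w) (\<lambda>a b. act a m * act b m')"
  and act_one: "w \<in> car W \<Longrightarrow> act (piL W w) 1 = act w 1"
  using maa by (simp_all add: module_algebra_action_def psum_list_comp)

lemma act_psum: "w \<in> car W \<Longrightarrow> act w (psum xs F) = psum xs (\<lambda>a b. act w (F a b))"
  by (rule psum_hom) (simp add: act_linear)

text \<open>
  For \<open>l = \<pi>\<^sup>L(w)\<close> the axiom for \<open>(\<Delta> \<otimes> id) \<Delta>(1)\<close> yields \<open>\<Delta>(l) = \<Sum> 1\<^sub>1 l \<otimes> 1\<^sub>2\<close>.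
\<close>
lemma act_piL_mult:
  assumes w: "w \<in> car W"
  shows "act (piL W w) (m * m') = act (piL W w) m * m'"
proof -
  define T where "T a b c = s (eps W (mul W a w)) (act b m * act c m')" for a b c
  have T: "trilinear_on (car W) (scl W) s T"
    by (simp add: T_def trilinear_on_def bilinear_on_def linear_on_def act_linear eps_linear mul_add w
        s_mult vs.scale_left_distrib vs.scale_right_distrib distrib_left distrib_right mult.commute)
  have piL: "act (piL W w) z = psum (cop W (unt W)) (\<lambda>a b. s (eps W (mul W a w)) (act b z))" for z
    unfolding piL_psum using w
    by (subst linear_cop_psum[OF act_linear_on]) (simp_all add: act_linear cong: cop_cong)
  have "act (piL W w) (m * m') = psum (cop W (unt W)) (\<lambda>a y. psum (cop W y) (\<lambda>b c. T a b c))"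
    unfolding piL T_def by (rule cop_cong) (simp_all add: act_mult s_psum)
  also have "\<dots> = psum (cop W (unt W)) (\<lambda>a' b'. psum (cop W (unt W)) (\<lambda>a b. T a (mul W a' b) b'))"
    by (simp only: coassoc[OF T closed(4), symmetric] cop_one_iterated(2)[OF T])
  also have "\<dots> = psum (cop W (unt W)) (\<lambda>a' b'. act a' (act (piL W w) m) * act b' m')"
  proof (rule cop_cong)
    fix a' b' assume ab: "a' \<in> car W" "b' \<in> car W"
    have "psum (cop W (unt W)) (\<lambda>a b. T a (mul W a' b) b') =
        psum (cop W (unt W)) (\<lambda>a b. act a' (s (eps W (mul W a w)) (act b m)) * act b' m')"
      unfolding T_def using ab by (intro cop_cong) (simp_all add: act_mul act_linear s_mult)
    then show "psum (cop W (unt W)) (\<lambda>a b. T a (mul W a' b) b') = act a' (act (piL W w) m) * act b' m'"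
      unfolding piL using ab by (simp add: psum_mult_right act_psum)
  qed simp
  also have "\<dots> = act (unt W) (act (piL W w) m * m')" by (rule act_mult[symmetric]) simp
  finally show ?thesis by simp
qed

text \<open>
  For \<open>r = t\<^sup>L(w)\<close> the other half of that axiom yields \<open>\<Delta>(r) = \<Sum> 1\<^sub>1 \<otimes> 1\<^sub>2 r\<close>.
\<close>
lemma act_tL_mult:
  assumes w: "w \<in> car W"
  shows "act (tL W w) (m * m') = m * act (tL W w) m'"
proof -
  define T where "T a b c = s (eps W (mul W c w)) (act a m * act b m')" for a b c
  have T: "trilinear_on (car W) (scl W) s T"
    by (simp add: T_def trilinear_on_def bilinear_on_def linear_on_def act_linear eps_linear mul_add w
        s_mult vs.scale_left_distrib vs.scale_right_distrib distrib_left distrib_right mult.commute)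
  have tL: "act (tL W w) z = psum (cop W (unt W)) (\<lambda>a b. s (eps W (mul W b w)) (act a z))" for z
    unfolding tL_psum using w
    by (subst linear_cop_psum[OF act_linear_on]) (simp_all add: act_linear cong: cop_cong)
  have "act (tL W w) (m * m') = psum (cop W (unt W)) (\<lambda>x c. psum (cop W x) (\<lambda>a b. T a b c))"
    unfolding tL T_def by (rule cop_cong) (simp_all add: act_mult s_psum)
  also have "\<dots> = psum (cop W (unt W)) (\<lambda>a b. psum (cop W (unt W)) (\<lambda>a' b'. T a (mul W b a') b'))"
    by (rule cop_one_iterated(1)[OF T])
  also have "\<dots> = psum (cop W (unt W)) (\<lambda>a b. act a m * act b (act (tL W w) m'))"
  proof (rule cop_cong)
    fix a b assume ab: "a \<in> car W" "b \<in> car W"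
    have "psum (cop W (unt W)) (\<lambda>a' b'. T a (mul W b a') b') =
        psum (cop W (unt W)) (\<lambda>a' b'. act a m * act b (s (eps W (mul W b' w)) (act a' m')))"
      unfolding T_def using ab by (intro cop_cong) (simp_all add: act_mul act_linear s_mult)
    then show "psum (cop W (unt W)) (\<lambda>a' b'. T a (mul W b a') b') = act a m * act b (act (tL W w) m')"
      unfolding tL using ab by (simp add: psum_mult_left act_psum)
  qed simp
  also have "\<dots> = act (unt W) (m * act (tL W w) m')" by (rule act_mult[symmetric]) simp
  finally show ?thesis by simp
qed

lemma act_piL: "w \<in> car W \<Longrightarrow> act (piL W w) m = act w 1 * m"
  using act_piL_mult[of w 1 m] by (simp add: act_one)

lemma act_tL: "w \<in> car W \<Longrightarrow> act (tL W w) m = m * act w 1"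
  using act_tL_mult[of w m 1] act_one[of w] act_one[of "tL W w"] by (simp add: piL_tL)

lemma act_bimodule_end:
  assumes N: "N \<subseteq> invariants W act" and w: "w \<in> car W"
  shows "act w \<in> bimodule_end N"
proof -
  have inv: "act x n = act x 1 * n" if "x \<in> car W" "n \<in> N" for x n
    using N that act_piL[of x n] by (auto simp: invariants_def)
  \<comment> \<open>The invariant \<open>n\<close> is moved by \<open>t\<^sup>L(x)\<close> to \<open>(x \<triangleright> 1) n\<close> as well as to \<open>n (x \<triangleright> 1)\<close>.\<close>
  have comm: "act x 1 * n = n * act x 1" if "x \<in> car W" "n \<in> N" for x n
    using inv[of "tL W x" n] act_tL[of x n] act_tL[of x 1] that by simp
  have "act w (n * m) = n * act w m" if "n \<in> N" for n m
  proof -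
    have "act w (n * m) = psum (cop W w) (\<lambda>a b. n * (act a 1 * act b m))"
      unfolding act_mult[OF w] using that
      by (intro cop_cong[OF w]) (simp add: inv comm mult.assoc)
    then show ?thesis using act_mult[OF w, of 1 m] by (simp add: psum_mult_left)
  qed
  moreover have "act w (m * n) = act w m * n" if "n \<in> N" for n m
  proof -
    have "act w (m * n) = psum (cop W w) (\<lambda>a b. act a m * act b 1 * n)"
      unfolding act_mult[OF w] using that
      by (intro cop_cong[OF w]) (simp add: inv mult.assoc)
    then show ?thesis using act_mult[OF w, of m 1] by (simp add: psum_mult_right)
  qed
  ultimately show ?thesis using w by (simp add: bimodule_end_def act_linear)
qed

end

section \<open>The antipode and the action on the extension\<close>

lemma tensor_eq_reindex:
  assumes eq: "tensor_eq A B C ra la xs ys"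
    and C: "\<And>c. c \<in> C \<Longrightarrow> \<exists>c'\<in>C'. (\<forall>a\<in>A. ra a c = ra' a c') \<and> (\<forall>b\<in>B. la c b = la' c' b)"
  shows "tensor_eq A B C' ra' la' xs ys"
proof -
  have "formal_eq (tensor_rel A B C' ra' la') (map (\<lambda>x. x) xs) (map (\<lambda>x. x) ys)"
    using eq[unfolded tensor_eq_def]
  proof (rule formal_eq_map)
    fix xs ys assume "tensor_rel A B C ra la xs ys"
    then have "tensor_rel A B C' ra' la' xs ys"
    proof cases
      case (balanced a b c)
      then obtain c' where "c' \<in> C'" "ra a c = ra' a c'" "la c b = la' c' b" using C by blast
      with balanced show ?thesis using tensor_rel.balanced[of a A b B c' C' ra' la'] by simp
    qed (auto intro: tensor_rel.intros)
    then show "formal_eq (tensor_rel A B C' ra' la') (map (\<lambda>x. x) xs) (map (\<lambda>x. x) ys)"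
      by (simp add: formal_eq.base)
  qed
  then show ?thesis by (simp add: tensor_eq_def)
qed

context endomorphism_model begin

sublocale WA: weak_bialgebra_space A
  by unfold_locales (rule weak_bialgebra_A)

lemma kbal_bilinear: "bilinear_on C sc t B \<Longrightarrow> kbal B"
  by (rule kbalI) (auto simp: bilinear_on_def linear_on_def)

text \<open>
  The scalars \<open>\<epsilon>(1\<^sub>1 w) = \<phi>(w(1) e\<^sub>i)\<close> are the coordinates of \<open>w(1)\<close> with respect to the \<open>e\<^sup>i\<close>.
\<close>
lemma piL_A: assumes "w \<in> C" shows "piL A w = lf (al w 1) one"
proof -
  interpret v: vector_space sc by (rule fd_spaceD[OF fd_C])
  have "piL A w = bracket (\<lambda>a b. sc (ep (mu a w)) b) one one"
    unfolding WA.piL_psum A_simps using assms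
    by (intro cop_one kbalI) (simp_all add: ops_add ops_scale ep_linear
        v.scale_right_distrib v.scale_left_distrib mult.commute)
  also have "\<dots> = psum eb (\<lambda>e e'. lf (s (kap (\<phi> (al w 1 * e))) e') one)"
    unfolding bracket_def using assms by (intro psum_cong) (simp add: ops_scale)
  also have "\<dots> = lf (psum eb (\<lambda>e e'. s (kap (\<phi> (al w 1 * e))) e')) one"
    using assms by (intro lf_psum(1)[symmetric]) (auto intro!: R_scale)
  finally show ?thesis using assms by (simp add: eb_right')
qed

lemma tL_A: assumes "w \<in> C" shows "tL A w = rt (al w 1) one"
proof -
  interpret v: vector_space sc by (rule fd_spaceD[OF fd_C])
  have "tL A w = bracket (\<lambda>a b. sc (ep (mu b w)) a) one one"
    unfolding WA.tL_psum A_simps using assms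
    by (intro cop_one kbalI) (simp_all add: ops_add ops_scale ep_linear
        v.scale_right_distrib v.scale_left_distrib mult.commute)
  also have "\<dots> = psum eb (\<lambda>e e'. rt (s (kap (\<phi> (e' * al w 1))) e) one)"
    unfolding bracket_def using assms by (intro psum_cong) (simp add: ops_scale)
  also have "\<dots> = rt (psum eb (\<lambda>e e'. s (kap (\<phi> (e' * al w 1))) e)) one"
    using assms by (intro lf_psum(2)[symmetric]) (auto intro!: R_scale)
  finally show ?thesis using assms by (simp add: eb_left')
qed

lemma adj_1_R [simp]: "w \<in> C \<Longrightarrow> adj (al w) 1 \<in> R"
  by (simp add: adj_one_R)

lemma piR_A: assumes "w \<in> C" shows "piR A w = rt (adj (al w) 1) one"
proof -
  interpret v: vector_space sc by (rule fd_spaceD[OF fd_C])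
  have "piR A w = bracket (\<lambda>a b. sc (ep (mu w b)) a) one one"
    unfolding WA.piR_psum A_simps using assms
    by (intro cop_one kbalI) (simp_all add: ops_add ops_scale ep_linear
        v.scale_right_distrib v.scale_left_distrib mult.commute)
  also have "\<dots> = psum eb (\<lambda>e e'. rt (s (kap (\<phi> (e' * adj (al w) 1))) e) one)"
    unfolding bracket_def using assms by (intro psum_cong) (simp add: ops_scale phi_adj_one)
  also have "\<dots> = rt (psum eb (\<lambda>e e'. s (kap (\<phi> (e' * adj (al w) 1))) e)) one"
    using assms by (intro lf_psum(2)[symmetric]) (auto intro!: R_scale)
  finally show ?thesis using assms by (simp add: eb_left')
qed

text \<open>
  Unfolding the comultiplication and the adjoint leads to the sum evaluated in \<open>antipode_identity\<close>.
\<close>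
lemma antipode_left_apply:
  assumes w: "w \<in> C"
  shows "psum (cop A w) (\<lambda>a b. al a (adj (al b) z)) = al w 1 * z"
proof -
  have "psum (cop A w) (\<lambda>a b. al a (adj (al b) z)) =
      psum tb (\<lambda>t \<beta>. psum mb (\<lambda>m m'. theta (al w) t m * proj (\<beta> m' * z)))"
    unfolding cop_psum_def
  proof (rule psum_cong)
    fix t \<beta> assume t: "(t, \<beta>) \<in> set tb"
    have th: "theta (al w) t \<in> E" using t w theta_E by simp
    have "bracket (\<lambda>a b. al a (adj (al b) z)) (th w t) (la \<beta>) =
        psum eb (\<lambda>e e'. psum mb (\<lambda>m m'. theta (al w) t m * (e * \<phi> (e' * (\<beta> m' * z)))))"
      unfolding bracket_def
    proof (rule psum_cong)
      fix e e' assume e: "(e, e') \<in> set eb"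
      have "al (rt e (th w t)) (adj (al (lf e' (la \<beta>))) z) =
          theta (al w) t (psum mb (\<lambda>m m'. m * \<phi> (e' * (\<beta> m' * z)))) * e"
        using e w t by (simp add: al_ops(6)[OF _ t] adj_def mult.assoc)
      also have "\<dots> = psum mb (\<lambda>m m'. theta (al w) t m * (e * \<phi> (e' * (\<beta> m' * z))))"
        unfolding E_psum[OF th] psum_mult_right[symmetric] using e
        by (intro psum_cong) (simp add: ED(3)[OF th] phi_N mult.assoc R_commute[OF eb_in(1)[OF e] phi_N])
      finally show "al (rt e (th w t)) (adj (al (lf e' (la \<beta>))) z) = \<dots>" .
    qed
    also have "\<dots> = psum mb (\<lambda>m m'. theta (al w) t m * proj (\<beta> m' * z))"
      by (subst psum_swap) (simp add: psum_mult_left proj_def)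
    finally show "bracket (\<lambda>a b. al a (adj (al b) z)) (th w t) (la \<beta>) = \<dots>" .
  qed
  also have "\<dots> = al w 1 * z"
    using w by (subst psum_swap) (simp add: antipode_identity)
  finally show ?thesis .
qed

text \<open>
  \<open>\<Sum> m\<^sub>j \<phi>(a\<^sub>1(m\<^sup>j) a\<^sub>2(z)) = \<Sum> m\<^sub>j \<phi>(a(m\<^sup>j z))\<close>, and \<open>\<phi> \<circ> a\<close> is \<open>\<phi>\<close> after multiplication by \<open>S(a)(1)\<close>.
\<close>
lemma antipode_right_apply:
  assumes w: "w \<in> C"
  shows "psum (cop A w) (\<lambda>a b. adj (al a) (al b z)) = z * adj (al w) 1"
proof -
  have "psum (cop A w) (\<lambda>a b. adj (al a) (al b z)) =
      psum mb (\<lambda>m m'. psum (cop A w) (\<lambda>a b. m * \<phi> (al a m' * al b z)))"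
    unfolding adj_def by (rule psum_swap)
  also have "\<dots> = psum mb (\<lambda>m m'. m * \<phi> (m' * (z * adj (al w) 1)))"
    using w by (simp add: psum_mult_left phi_adj_one cop_apply mult.assoc flip: phi_psum)
  finally show ?thesis by (simp add: mb_left)
qed

text \<open>
  Tested against \<open>\<phi>(y _)\<close>: the adjoint moves \<open>S(x)(1)\<close> back to \<open>x\<close>, coassociativity leaves
  \<open>\<phi>(w\<^sub>1(y) w\<^sub>2(S(w\<^sub>3)(z)))\<close>, and the identity for \<open>w\<^sub>2 S(w\<^sub>3)\<close> turns this into \<open>\<phi>(w(y) z)\<close>.
\<close>
lemma antipode_triple_apply:
  assumes w: "w \<in> C"
  shows "psum (cop A w) (\<lambda>x c. adj (al c) z * adj (al x) 1) = adj (al w) z"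
proof (rule phi_nondegenerate)
  fix y
  have "\<phi> (y * psum (cop A w) (\<lambda>x c. adj (al c) z * adj (al x) 1)) =
      psum (cop A w) (\<lambda>x c. psum (cop A x) (\<lambda>a b. \<phi> (al a y * al b (adj (al c) z))))"
    unfolding psum_mult_left[symmetric] phi_psum
  proof (rule cop_A_cong[OF w])
    fix x c assume xc: "x \<in> C" "c \<in> C"
    have "\<phi> (y * (adj (al c) z * adj (al x) 1)) = \<phi> (al x (y * adj (al c) z))"
      using xc by (simp add: phi_adj_one mult.assoc)
    then show "\<phi> (y * (adj (al c) z * adj (al x) 1)) = psum (cop A x) (\<lambda>a b. \<phi> (al a y * al b (adj (al c) z)))"
      using xc by (simp add: cop_apply flip: phi_psum)
  qed
  also have "\<dots> = psum (cop A w) (\<lambda>a x. psum (cop A x) (\<lambda>b c. \<phi> (al a y * al b (adj (al c) z))))"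
    by (rule coassoc_A[OF _ w]) (auto simp: kbal3_def kbal_def al_add al_scale al_linear adj_add adj_scale
        phi_add phi_scale s_mult_left s_mult_right algebra_simps)
  also have "\<dots> = psum (cop A w) (\<lambda>a x. \<phi> (al a y * al x 1 * z))"
  proof (rule cop_A_cong[OF w])
    fix a x assume ax: "a \<in> C" "x \<in> C"
    then show "psum (cop A x) (\<lambda>b c. \<phi> (al a y * al b (adj (al c) z))) = \<phi> (al a y * al x 1 * z)"
      by (simp add: psum_mult_left antipode_left_apply mult.assoc flip: phi_psum)
  qed
  also have "\<dots> = \<phi> (al w y * z)"
    using w by (simp add: psum_mult_right cop_apply flip: phi_psum)
  also have "\<dots> = \<phi> (y * adj (al w) z)" using w by (simp add: phi_adj)
  finally show "\<phi> (y * psum (cop A w) (\<lambda>x c. adj (al c) z * adj (al x) 1)) = \<phi> (y * adj (al w) z)" .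
qed

lemma al_cop_psum:
  assumes "w \<in> C" "\<And>a b. a \<in> C \<Longrightarrow> b \<in> C \<Longrightarrow> F a b \<in> C"
  shows "al (psum (cop A w) F) m = psum (cop A w) (\<lambda>a b. al (F a b) m)"
  using assms cop_C by (intro al_psum) blast

lemma cop_psum_C:
  "w \<in> C \<Longrightarrow> (\<And>a b. a \<in> C \<Longrightarrow> b \<in> C \<Longrightarrow> F a b \<in> C) \<Longrightarrow> psum (cop A w) F \<in> C"
  using cop_C by (intro C_psum) blast

lemma antipode_left: assumes w: "w \<in> C" shows "psum (cop A w) (\<lambda>a b. mu a (ad b)) = piL A w"
proof (rule al_eqI)
  show "al (psum (cop A w) (\<lambda>a b. mu a (ad b))) m = al (piL A w) m" for m
    using antipode_left_apply[OF w, of m] w by (simp add: al_cop_psum piL_A cong: cop_A_cong)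
qed (use w in \<open>simp_all add: cop_psum_C piL_A\<close>)

lemma antipode_right: assumes w: "w \<in> C" shows "psum (cop A w) (\<lambda>a b. mu (ad a) b) = piR A w"
proof (rule al_eqI)
  show "al (psum (cop A w) (\<lambda>a b. mu (ad a) b)) m = al (piR A w) m" for m
    using antipode_right_apply[OF w, of m] w by (simp add: al_cop_psum piR_A cong: cop_A_cong)
qed (use w in \<open>simp_all add: cop_psum_C piR_A\<close>)

lemma antipode_piR: assumes w: "w \<in> C" shows "psum (cop A w) (\<lambda>x c. mu (piR A x) (ad c)) = ad w"
proof (rule al_eqI)
  show "al (psum (cop A w) (\<lambda>x c. mu (piR A x) (ad c))) m = al (ad w) m" for m
    using antipode_triple_apply[OF w, of m] w by (simp add: al_cop_psum piR_A cong: cop_A_cong)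
qed (use w in \<open>simp_all add: cop_psum_C piR_A\<close>)

lemma antipode_triple:
  assumes w: "w \<in> C"
  shows "psum (cop A w) (\<lambda>x c. psum (cop A x) (\<lambda>a b. mu (mu (ad a) b) (ad c))) = ad w"
proof -
  have "psum (cop A w) (\<lambda>x c. psum (cop A x) (\<lambda>a b. mu (mu (ad a) b) (ad c))) =
      psum (cop A w) (\<lambda>x c. mu (piR A x) (ad c))"
  proof (rule cop_A_cong[OF w])
    fix x c assume xc: "x \<in> C" "c \<in> C"
    show "psum (cop A x) (\<lambda>a b. mu (mu (ad a) b) (ad c)) = mu (piR A x) (ad c)"
      unfolding antipode_right[OF xc(1), symmetric] using xc
      by (intro WA.linear_cop_psum[of sc "\<lambda>y. mu y (ad c)" x, unfolded A_simps, symmetric])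
        (simp_all add: linear_on_def ops_add ops_scale)
  qed
  then show ?thesis using antipode_piR[OF w] by simp
qed

lemma is_antipode_A: "WA.is_antipode ad"
  unfolding WA.is_antipode_def A_simps
  by (auto simp: linear_on_def ops_add ops_scale antipode_left antipode_right antipode_triple)

lemma weak_hopf_algebra_A: "weak_hopf_algebra A"
  using is_antipode_A weak_bialgebra_A
  by (simp add: weak_hopf_algebra_def WA.is_antipode_def psum_list_comp)

lemma left_subalgebra_A: "left_subalgebra A = (\<lambda>r. lf r one) ` R"
proof -
  have "lf r one \<in> piL A ` C" if "r \<in> R" for r
    using that by (intro image_eqI[of _ _ "lf r one"]) (simp_all add: piL_A)
  then show ?thesis by (auto simp: left_subalgebra_def piL_A)
qed

lemma module_algebra_action_A: "module_algebra_action s A al"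
  unfolding module_algebra_action_def A_simps psum_list_comp
  by (auto simp: linear_on_def al_add al_scale al_linear cop_apply piL_A)

lemma invariants_A: "N \<subseteq> invariants A al"
proof -
  have "al w n = al (piL A w) n" if "w \<in> C" "n \<in> N" for w n
    using ED(3)[OF al_E[OF that(1)] that(2), of 1] that by (simp add: piL_A)
  then show ?thesis by (auto simp: invariants_def)
qed

lemma counit_restricts_A: "counit_restricts_to s R \<phi> A al"
  unfolding counit_restricts_to_def left_subalgebra_A A_simps
proof (intro conjI)
  show "bij_betw (\<lambda>l. al l 1) ((\<lambda>r. lf r one) ` R) R"
    by (rule bij_betw_byWitness[where f' = "\<lambda>r. lf r one"]) auto
qed (auto simp: kap_one)

lemma tensorL_eqI:
  assumes "set xs \<subseteq> C \<times> C" "set ys \<subseteq> C \<times> C"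
    and "\<And>x y. psum xs (\<lambda>a b. al a x * al b y) = psum ys (\<lambda>a b. al a x * al b y)"
  shows "tensorL_eq A xs ys"
  unfolding tensorL_eq_def A_simps left_subalgebra_A
proof (rule tensor_eq_reindex[OF balanced_tensorI[OF assms]])
  fix r assume r: "r \<in> R"
  have "rt r a = mu (tL A (lf r one)) a" "lf r a = mu (lf r one) a" if "a \<in> C" for a
    using r that by (auto simp: tL_A rt_lf intro!: al_eqI)
  with r show "\<exists>c'\<in>(\<lambda>r. lf r one) ` R. (\<forall>a\<in>C. rt r a = mu (tL A c') a) \<and> (\<forall>b\<in>C. lf r b = mu c' b)"
    by blast
qed

end

section \<open>Universality\<close>

locale comparison = endomorphism_model s N \<phi> mb eb tb ub C sc al + weak_bialgebra_action W s act
  for s :: "'k::field \<Rightarrow> 'm::ring_1 \<Rightarrow> 'm" and N \<phi> mb eb tb ub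
    and C :: "'c::ab_group_add set" and sc al
    and W :: "('k, 'w::ab_group_add, 'z) wba_scheme" and act +
  assumes inv: "N \<subseteq> invariants W act"
begin

definition lift :: "'w \<Rightarrow> 'c" where "lift w = la (act w)"

lemma lift_C [simp]: "w \<in> car W \<Longrightarrow> lift w \<in> C"
  and al_lift [simp]: "w \<in> car W \<Longrightarrow> al (lift w) m = act w m"
  using act_bimodule_end[OF inv] by (simp_all add: lift_def)

lemma lift_hom: "algebra_hom W (car W) A C lift"
  unfolding algebra_hom_def linear_on_def A_simps
  by (auto intro!: al_eqI simp: al_add al_scale act_linear act_mul)

lemma lift_unt: "lift (unt W) = one"
  using lift_hom by (simp add: algebra_hom_def)

lemma lift_mul: "x \<in> car W \<Longrightarrow> y \<in> car W \<Longrightarrow> lift (mul W x y) = mu (lift x) (lift y)"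
  using lift_hom by (simp add: algebra_hom_def)

lemma lift_linear: "linear_on (car W) (scl W) sc lift"
  using lift_hom by (simp add: algebra_hom_def)

lemma lift_piL: "w \<in> car W \<Longrightarrow> lift (piL W w) = lf (act w 1) one"
  using al_1[OF lift_C, of w] by (intro al_eqI) (simp_all add: act_piL)

lemma lift_tL: "w \<in> car W \<Longrightarrow> lift (tL W w) = rt (act w 1) one"
  using al_1[OF lift_C, of w] by (intro al_eqI) (simp_all add: act_tL)

lemma lift_pairs_C: "w \<in> car W \<Longrightarrow> set (map (\<lambda>(a, b). (lift a, lift b)) (cop W w)) \<subseteq> C \<times> C"
  using cop_car[of w] by auto

lemma lift_pairs_apply:
  assumes w: "w \<in> car W"
  shows "psum (map (\<lambda>(a, b). (lift a, lift b)) (cop W w)) (\<lambda>a b. al a x * al b y) = al (lift w) (x * y)"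
proof -
  have "psum (cop W w) (\<lambda>a b. al (lift a) x * al (lift b) y) = psum (cop W w) (\<lambda>a b. act a x * act b y)"
    by (rule cop_cong[OF w]) simp
  then show ?thesis unfolding psum_map using w by (simp add: act_mult)
qed

text \<open>
  The two comultiplications agree over \<open>R\<close> since both represent \<open>x \<otimes> y \<mapsto> w \<triangleright> (x y)\<close>.
\<close>
lemma lift_weak_left_morphism: "weak_left_morphism W A lift"
  unfolding weak_left_morphism_def
proof (intro conjI exI ballI)
  show "algebra_hom W (car W) A (car A) lift" using lift_hom by simp
  have sub: "left_subalgebra W \<subseteq> car W" using left_subalgebra_car by auto
  have "lift l \<in> left_subalgebra A" if "l \<in> left_subalgebra W" for l
    using that al_1[OF lift_C] unfolding left_subalgebra_def[of W] left_subalgebra_A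
    by (auto simp: lift_piL)
  with lift_hom sub show "algebra_hom W (left_subalgebra W) A (left_subalgebra A) lift"
    unfolding algebra_hom_def using linear_on_subset by blast
  show "lift l = lift l" for l ..
  show "lift (tL W l) = tL A (lift l)" if "l \<in> left_subalgebra W" for l
    using left_subalgebra_car[OF that] by (simp add: lift_tL tL_A)
  show "piL A (lift w) = lift (piL W w)" if "w \<in> car W" for w
    using that by (simp add: lift_piL piL_A)
  show "tensorL_eq A (cop A (lift w)) [(lift a, lift b). (a, b) \<leftarrow> cop W w]" if "w \<in> car W" for w
    by (rule tensorL_eqI) (simp_all only: cop_C lift_C that lift_pairs_C lift_pairs_apply cop_apply)
qed

lemma lift_unique:
  assumes "weak_left_morphism W A g" "\<And>w m. w \<in> car W \<Longrightarrow> al (g w) m = act w m" "w \<in> car W"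
  shows "g w = lift w"
  using assms by (intro al_eqI) (auto simp: weak_left_morphism_def algebra_hom_def)

end

context endomorphism_model begin

lemma universal_action_A: "universal_action TYPE('w::ab_group_add) s N A al"
  unfolding universal_action_def
proof (intro allI impI, elim conjE)
  fix W :: "('k, 'w) wba" and act
  assume W: "weak_bialgebra W" "module_algebra_action s W act" "N \<subseteq> invariants W act"
  interpret comparison s N \<phi> mb eb tb ub C sc al W act
    by unfold_locales (fact W alg)+
  show "\<exists>f. weak_left_morphism W A f \<and> (\<forall>w\<in>car W. \<forall>m. al (f w) m = act w m) \<and>
      (\<forall>g. weak_left_morphism W A g \<and> (\<forall>w\<in>car W. \<forall>m. al (g w) m = act w m) \<longrightarrow> (\<forall>w\<in>car W. g w = f w))"
  proof (intro exI[of _ lift] conjI allI impI ballI)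
    show "weak_left_morphism W A lift" by (rule lift_weak_left_morphism)
    show "al (lift w) m = act w m" if "w \<in> car W" for w m using that by simp
    fix g w
    assume g: "weak_left_morphism W A g \<and> (\<forall>w\<in>car W. \<forall>m. al (g w) m = act w m)" and w: "w \<in> car W"
    show "g w = lift w" by (rule lift_unique) (use g w in blast)+
  qed
qed

end

section \<open>Comparison of two solutions\<close>

text \<open>
  Here \<open>W\<close> is a second solution, and \<open>g\<close> is an action-preserving inverse of the morphism \<open>lift\<close>
  from \<open>W\<close> to \<open>A\<close>.
\<close>
locale wha_comparison = comparison s N \<phi> mb eb tb ub C sc al W act
  for s :: "'k::field \<Rightarrow> 'm::ring_1 \<Rightarrow> 'm" and N \<phi> mb eb tb ub
    and C :: "'c::ab_group_add set" and sc al
    and W :: "('k, 'w::ab_group_add) wha" and act +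
  fixes g :: "'c \<Rightarrow> 'w"
  assumes wha: "weak_hopf_algebra W"
    and counit_W: "counit_restricts_to s R \<phi> W act"
    and g_hom: "algebra_hom A C W (car W) g"
    and act_g: "a \<in> C \<Longrightarrow> act (g a) m = al a m"
    and g_lift [simp]: "x \<in> car W \<Longrightarrow> g (lift x) = x"
begin

lemma g_car [simp]: "a \<in> C \<Longrightarrow> g a \<in> car W"
  using g_hom by (simp add: algebra_hom_def)

lemma lift_g [simp]: "a \<in> C \<Longrightarrow> lift (g a) = a"
  by (rule al_eqI) (simp_all add: act_g)

lemma g_linear: "linear_on C sc (scl W) g"
  using g_hom by (simp add: algebra_hom_def)

lemma g_mu: "a \<in> C \<Longrightarrow> b \<in> C \<Longrightarrow> g (mu a b) = mul W (g a) (g b)"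
  using g_hom by (simp add: algebra_hom_def)

text \<open>
  Since \<open>\<epsilon> = \<epsilon> \<circ> \<pi>\<^sup>L\<close>, the counit is determined by its restriction to the left subalgebra.
\<close>
lemma eps_lift: assumes x: "x \<in> car W" shows "eps W x = ep (lift x)"
proof -
  have "piL W x \<in> left_subalgebra W" using x by (simp add: left_subalgebra_def)
  then have "\<phi> (act (piL W x) 1) = s (eps W (piL W x)) 1"
    using counit_W by (simp add: counit_restricts_to_def)
  then show ?thesis using x by (simp add: act_one eps_piL kap_s)
qed

lemma lift_bilinear:
  assumes "bilinear_on C sc t B"
  shows "bilinear_on (car W) (scl W) t (\<lambda>a b. B (lift a) (lift b))"
  using assms linear_onD[OF lift_linear] by (simp add: bilinear_on_def linear_on_def)

lemma module_sc: "module sc"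
  using fd_spaceD(1)[OF fd_C]
  by (simp add: vector_space_def module_def)

text \<open>
  \<open>\<Delta>(1) = \<Sum> 1\<^sub>1 \<otimes> \<pi>\<^sup>L(1\<^sub>2)\<close>, and \<open>lift\<close> maps \<open>\<pi>\<^sup>L(1\<^sub>2)\<close> to left multiplication by \<open>1\<^sub>2 \<triangleright> 1 \<in> R\<close>.
  Expanding this along \<open>\<Sum> e\<^sub>i \<otimes> e\<^sup>i\<close>, the coefficients are \<open>\<epsilon>(1\<^sub>2 l\<^sub>i)\<close> for \<open>l\<^sub>i \<in> W\<^sup>L\<close> with
  \<open>l\<^sub>i \<triangleright> 1 = e\<^sub>i\<close>, so \<open>t\<^sup>L(l\<^sub>i)\<close> remains in the first factor and is lifted to right multiplication by
  \<open>e\<^sub>i\<close>.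
\<close>
lemma cop_one_transfer:
  assumes B: "bilinear_on C sc sc B"
  shows "psum (cop W (unt W)) (\<lambda>a b. B (lift a) (lift b)) = bracket B one one"
proof -
  have B_scale: "B (sc c x) y = B x (sc c y)" if "x \<in> C" "y \<in> C" for x y c
    using kbalD(3)[OF kbal_bilinear[OF B] that] .
  have B_psum: "B x (psum xs F) = psum xs (\<lambda>a b. B x (F a b))"
    if "x \<in> C" "\<And>a b. (a, b) \<in> set xs \<Longrightarrow> F a b \<in> C" for x and xs :: "('m \<times> 'm) list" and F
    using B that fd_C
    by (intro linear_on_psum[of C sc sc]) (auto simp: bilinear_on_def)
  have "\<exists>l. l \<in> left_subalgebra W \<and> act l 1 = e" if "e \<in> R" for e
  proof -
    have "e \<in> (\<lambda>l. act l 1) ` left_subalgebra W"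
      using counit_W that by (simp add: counit_restricts_to_def bij_betw_def)
    then show ?thesis by blast
  qed
  then obtain l where l: "\<And>e. e \<in> R \<Longrightarrow> l e \<in> left_subalgebra W" "\<And>e. e \<in> R \<Longrightarrow> act (l e) 1 = e"
    by metis
  have lW: "l e \<in> car W" if "e \<in> R" for e using left_subalgebra_car l(1)[OF that] .
  define F where "F e e' a b = B (lift (scl W (eps W (mul W b (l e))) a)) (lf e' one)" for e e' a b
  have F: "bilinear_on (car W) (scl W) sc (F e e')" if e: "(e, e') \<in> set eb" for e e'
  proof -
    interpret v: vector_space sc by (rule fd_spaceD[OF fd_C])
    have lin: "linear_on C sc sc (\<lambda>x. B x (lf e' one))"
      using B e by (simp add: bilinear_on_def)
    have "F e e' a b = sc (eps W (mul W b (l e))) (B (lift a) (lf e' one))" if "a \<in> car W" "b \<in> car W" for a b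
      using that by (simp add: F_def linear_onD(2)[OF lift_linear] linear_onD(2)[OF lin])
    then show ?thesis using e lW
      by (simp add: bilinear_on_def linear_on_def linear_onD[OF lift_linear] linear_onD[OF lin] mul_add
          eps_linear v.scale_right_distrib v.scale_left_distrib mult.commute)
  qed
  have "psum (cop W (unt W)) (\<lambda>a b. B (lift a) (lift b)) =
      psum (cop W (unt W)) (\<lambda>a b. B (lift a) (lift (piL W b)))"
    by (rule cop_one_piL[OF lift_bilinear[OF B] module_sc, symmetric])
  also have "\<dots> = psum (cop W (unt W)) (\<lambda>a b. psum eb (\<lambda>e e'. F e e' a (piL W b)))"
  proof (rule cop_cong[OF closed(4)])
    fix a b assume ab: "a \<in> car W" "b \<in> car W"
    have bR: "act b 1 \<in> R" using al_1[OF lift_C[OF ab(2)]] ab by simp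
    have "lift (piL W b) = lf (psum eb (\<lambda>e e'. s (kap (\<phi> (act b 1 * e))) e')) one"
      using ab bR by (simp add: lift_piL eb_right')
    also have "\<dots> = psum eb (\<lambda>e e'. sc (kap (\<phi> (act b 1 * e))) (lf e' one))"
      using bR by (subst lf_psum(1)) (auto intro!: R_scale psum_cong simp: ops_scale)
    finally have "B (lift a) (lift (piL W b)) = psum eb (\<lambda>e e'. B (lift a) (sc (kap (\<phi> (act b 1 * e))) (lf e' one)))"
      using ab by (subst B_psum[symmetric]) auto
    also have "\<dots> = psum eb (\<lambda>e e'. F e e' a (piL W b))"
    proof (rule psum_cong)
      fix e e' assume e: "(e, e') \<in> set eb"
      have "act b 1 * e = act (mul W (piL W b) (l e)) 1"
        using e ab l lW by (simp add: act_mul act_piL)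
      then have "kap (\<phi> (act b 1 * e)) = eps W (mul W (piL W b) (l e))"
        using e ab lW by (simp add: eps_lift)
      then show "B (lift a) (sc (kap (\<phi> (act b 1 * e))) (lf e' one)) = F e e' a (piL W b)"
        using e ab by (simp add: F_def linear_onD(2)[OF lift_linear] B_scale)
    qed
    finally show "B (lift a) (lift (piL W b)) = psum eb (\<lambda>e e'. F e e' a (piL W b))" .
  qed
  also have "\<dots> = psum eb (\<lambda>e e'. psum (cop W (unt W)) (\<lambda>a b. F e e' a (piL W b)))"
    by (rule psum_swap)
  also have "\<dots> = psum eb (\<lambda>e e'. B (rt e one) (lf e' one))"
  proof (rule psum_cong)
    fix e e' assume e: "(e, e') \<in> set eb"
    have lin: "linear_on (car W) (scl W) sc (\<lambda>x. B (lift x) (lf e' one))"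
      using B e linear_onD[OF lift_linear] by (simp add: bilinear_on_def linear_on_def)
    have "psum (cop W (unt W)) (\<lambda>a b. F e e' a (piL W b)) = psum (cop W (unt W)) (F e e')"
      by (rule cop_one_piL[OF F[OF e] module_sc])
    also have "\<dots> = B (lift (tL W (l e))) (lf e' one)"
      unfolding tL_psum using lW e
      by (subst linear_cop_psum[OF lin]) (simp_all add: F_def[abs_def])
    finally show "psum (cop W (unt W)) (\<lambda>a b. F e e' a (piL W b)) = B (rt e one) (lf e' one)"
      using e l lW by (simp add: lift_tL)
  qed
  finally show ?thesis by (simp add: bracket_def)
qed

text \<open>
  \<open>\<Delta>(x) = \<Delta>(1) \<Delta>(x)\<close> reduces the claim to the unit.
\<close>
lemma cop_transfer:
  assumes B: "bilinear_on C sc sc B" and x: "x \<in> car W"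
  shows "psum (cop A (lift x)) B = psum (cop W x) (\<lambda>a b. B (lift a) (lift b))"
proof -
  have "psum (cop A (lift x)) B = psum (cop W x) (\<lambda>a b. bracket B (lift a) (lift b))"
    using cop_psum[OF kbal_bilinear[OF B] lift_C[OF x] lift_pairs_C[OF x] lift_pairs_apply[OF x]]
    by (simp add: psum_map)
  also have "\<dots> = psum (cop W x) (\<lambda>a b. psum (cop W (unt W)) (\<lambda>a' b'. B (lift (mul W a' a)) (lift (mul W b' b))))"
  proof (rule cop_cong[OF x])
    fix a b assume ab: "a \<in> car W" "b \<in> car W"
    have one: "mu one y = y" if "y \<in> C" for y using that by (auto intro!: al_eqI)
    have "bilinear_on C sc sc (\<lambda>u v. B (mu u (lift a)) (mu v (lift b)))"
      using B ab by (simp add: bilinear_on_def linear_on_def ops_add ops_scale)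
    from cop_one_transfer[OF this]
    have "psum (cop W (unt W)) (\<lambda>a' b'. B (mu (lift a') (lift a)) (mu (lift b') (lift b))) = bracket B (lift a) (lift b)"
      unfolding bracket_def using ab by (simp add: rt_lf one cong: psum_cong_map)
    moreover have "psum (cop W (unt W)) (\<lambda>a' b'. B (lift (mul W a' a)) (lift (mul W b' b))) =
        psum (cop W (unt W)) (\<lambda>a' b'. B (mu (lift a') (lift a)) (mu (lift b') (lift b)))"
      using ab by (intro cop_cong) (simp_all add: lift_mul)
    ultimately show "bracket B (lift a) (lift b) = psum (cop W (unt W)) (\<lambda>a' b'. B (lift (mul W a' a)) (lift (mul W b' b)))"
      by simp
  qed
  also have "\<dots> = psum (cop W (unt W)) (\<lambda>a' b'. psum (cop W x) (\<lambda>a b. B (lift (mul W a' a)) (lift (mul W b' b))))"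
    by (rule psum_swap)
  also have "\<dots> = psum (cop W (mul W (unt W) x)) (\<lambda>a b. B (lift a) (lift b))"
    by (rule cop_mul[OF lift_bilinear[OF B], symmetric])
      (use x in simp_all)
  finally show ?thesis using x by simp
qed

lemma cop_g:
  assumes w: "w \<in> C"
  shows "tensor2_eq (scl W) (car W) (cop W (g w)) [(g a, g b). (a, b) \<leftarrow> cop A w]"
proof -
  let ?l = "map (\<lambda>(a, b). (lift a, lift b)) (cop W (g w))"
  have "tensor2_eq sc C (cop A w) ?l"
  proof (rule tensor2_eqI)
    interpret v: vector_space sc by (rule fd_spaceD[OF fd_C])
    show "fd_space sc C" by (rule fd_C)
    show "set (cop A w) \<subseteq> C \<times> C" by (rule cop_C[OF w])
    show "set ?l \<subseteq> C \<times> C" by (rule lift_pairs_C) (use w in simp)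
    fix h assume h: "linear_on C sc (*) h"
    have "bilinear_on C sc sc (\<lambda>a b. sc (h b) a)"
      by (simp add: bilinear_on_def linear_on_def linear_onD[OF h] v.scale_right_distrib v.scale_left_distrib mult.commute)
    from cop_transfer[OF this, of "g w"] w
    show "psum (cop A w) (\<lambda>a b. sc (h b) a) = psum ?l (\<lambda>a b. sc (h b) a)" by (simp add: psum_map)
  qed
  moreover have "g ` C \<subseteq> car W" by auto
  ultimately have "tensor2_eq (scl W) (car W) (map (\<lambda>(a, b). (g a, g b)) (cop A w)) (map (\<lambda>(a, b). (g a, g b)) ?l)"
    using g_linear by (intro tensor2_eq_map[of sc C]) simp_all
  moreover have "map (\<lambda>(a, b). (g a, g b)) ?l = map (\<lambda>x. x) (cop W (g w))"
    unfolding map_map using cop_car[OF g_car[OF w]] by (intro map_cong[OF HOL.refl]) auto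
  ultimately show ?thesis unfolding tensor2_eq_def by (simp add: formal_eq.sym)
qed

lemma cop_psum_lift:
  assumes B: "bilinear_on C sc sc B" and BC: "\<And>a b. a \<in> C \<Longrightarrow> b \<in> C \<Longrightarrow> B a b \<in> C" and x: "x \<in> car W"
  shows "psum (cop W x) (\<lambda>a b. g (B (lift a) (lift b))) = g (psum (cop A (lift x)) B)"
  unfolding cop_transfer[OF B x] using cop_car[OF x] BC
  by (intro linear_on_psum[OF g_linear fd_C, symmetric])
    (auto intro!: BC lift_C)

lemma g_piL: "x \<in> car W \<Longrightarrow> g (piL A (lift x)) = piL W x"
  using g_lift[of "piL W x"] by (simp add: lift_piL piL_A)

text \<open>
  \<open>\<pi>\<^sup>R\<close> is expressed by \<open>\<Delta>(1)\<close> and the counit, both of which have been compared.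
\<close>
lemma g_piR: assumes x: "x \<in> car W" shows "g (piR A (lift x)) = piR W x"
proof -
  interpret v: vector_space sc by (rule fd_spaceD[OF fd_C])
  define B where "B a b = sc (ep (mu (lift x) b)) a" for a b
  have B: "bilinear_on C sc sc B"
    using x by (simp add: B_def bilinear_on_def linear_on_def ops_add ops_scale ep_linear
        v.scale_right_distrib v.scale_left_distrib mult.commute del: al_ops)
  have "g (piR A (lift x)) = g (psum (cop A (lift (unt W))) B)"
    by (simp add: WA.piR_psum B_def[abs_def] lift_unt del: al_ops)
  also have "\<dots> = psum (cop W (unt W)) (\<lambda>a b. g (B (lift a) (lift b)))"
    by (rule cop_psum_lift[OF B, symmetric]) (simp_all add: B_def)
  also have "\<dots> = piR W x"
    unfolding piR_psum
    using x by (intro cop_cong)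
      (simp_all add: B_def linear_onD(2)[OF g_linear] eps_lift lift_mul del: al_ops)
  finally show ?thesis .
qed

lemma is_antipode_transported: "is_antipode (\<lambda>x. g (ad (lift x)))"
proof -
  have lin: "linear_on (car W) (scl W) (scl W) (\<lambda>x. g (ad (lift x)))"
    by (simp add: linear_on_def linear_onD[OF lift_linear] linear_onD[OF g_linear] ops_add ops_scale)
  have m: "mul W y (g a) = g (mu (lift y) a)" "mul W (g a) y = g (mu a (lift y))" if "y \<in> car W" "a \<in> C" for y a
    using that by (simp_all add: g_mu)
  have 1: "psum (cop W w) (\<lambda>a b. mul W a (g (ad (lift b)))) = piL W w" if w: "w \<in> car W" for w
  proof -
    have "psum (cop W w) (\<lambda>a b. mul W a (g (ad (lift b)))) = psum (cop W w) (\<lambda>a b. g (mu (lift a) (ad (lift b))))"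
      by (rule cop_cong[OF w]) (simp add: m)
    also have "\<dots> = g (psum (cop A (lift w)) (\<lambda>a b. mu a (ad b)))"
      by (rule cop_psum_lift[OF _ _ w]) (simp_all add: bilinear_on_def linear_on_def ops_add ops_scale)
    finally show ?thesis using w by (simp add: antipode_left g_piL)
  qed
  have 2: "psum (cop W w) (\<lambda>a b. mul W (g (ad (lift a))) b) = piR W w" if w: "w \<in> car W" for w
  proof -
    have "psum (cop W w) (\<lambda>a b. mul W (g (ad (lift a))) b) = psum (cop W w) (\<lambda>a b. g (mu (ad (lift a)) (lift b)))"
      by (rule cop_cong[OF w]) (simp add: m)
    also have "\<dots> = g (psum (cop A (lift w)) (\<lambda>a b. mu (ad a) b))"
      by (rule cop_psum_lift[OF _ _ w]) (simp_all add: bilinear_on_def linear_on_def ops_add ops_scale)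
    finally show ?thesis using w by (simp add: antipode_right g_piR)
  qed
  have 3: "psum (cop W w) (\<lambda>x c. psum (cop W x) (\<lambda>a b. mul W (mul W (g (ad (lift a))) b) (g (ad (lift c))))) = g (ad (lift w))"
    if w: "w \<in> car W" for w
  proof -
    have piR_lin: "linear_on C sc sc (piR A)"
      unfolding linear_on_def by (auto intro!: al_eqI simp: piR_A adj_add adj_scale al_add al_scale R_add R_scale
        distrib_left s_mult_right)
    have "psum (cop W w) (\<lambda>x c. psum (cop W x) (\<lambda>a b. mul W (mul W (g (ad (lift a))) b) (g (ad (lift c))))) =
        psum (cop W w) (\<lambda>x c. g (mu (piR A (lift x)) (ad (lift c))))"
    proof (rule cop_cong[OF w])
      fix x c assume xc: "x \<in> car W" "c \<in> car W"
      have "psum (cop W x) (\<lambda>a b. mul W (mul W (g (ad (lift a))) b) (g (ad (lift c)))) =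
          mul W (psum (cop W x) (\<lambda>a b. mul W (g (ad (lift a))) b)) (g (ad (lift c)))"
        using xc by (intro linear_cop_psum[symmetric, OF mul_linear(2)]) simp_all
      also have "\<dots> = mul W (g (piR A (lift x))) (g (ad (lift c)))" using xc by (simp add: 2 g_piR)
      also have "\<dots> = g (mu (piR A (lift x)) (ad (lift c)))" using xc by (simp add: g_mu piR_A)
      finally show "psum (cop W x) (\<lambda>a b. mul W (mul W (g (ad (lift a))) b) (g (ad (lift c)))) =
          g (mu (piR A (lift x)) (ad (lift c)))" .
    qed
    also have "\<dots> = g (psum (cop A (lift w)) (\<lambda>x c. mu (piR A x) (ad c)))"
      by (rule cop_psum_lift[OF _ _ w])
        (simp_all add: bilinear_on_def linear_on_def ops_add ops_scale linear_onD[OF piR_lin] WA.pi_car(2)[unfolded A_simps])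
    finally show ?thesis using w by (simp add: antipode_piR)
  qed
  show ?thesis unfolding is_antipode_def using lin 1 2 3 by simp
qed

lemma antip_g: "a \<in> C \<Longrightarrow> g (ad a) = antip W (g a)"
proof -
  assume a: "a \<in> C"
  have "is_antipode (antip W)"
    using wha by (simp add: is_antipode_def weak_hopf_algebra_def psum_list_comp)
  from antipode_unique[OF is_antipode_transported this g_car[OF a]] show ?thesis using a by simp
qed

lemma wha_iso_g: "wha_iso A W g"
  unfolding wha_iso_def A_simps
proof (intro conjI ballI)
  show "bij_betw g C (car W)" by (rule bij_betw_byWitness[where f' = lift]) auto
  show "algebra_hom A C W (car W) g" by (rule g_hom)
qed (auto simp: cop_g antip_g eps_lift)

end

text \<open>
  Weak left morphisms intertwine the left subalgebras and the target maps, hence the balancing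
  relations.
\<close>
lemma tensorL_eq_map:
  assumes W: "weak_bialgebra W" and g: "weak_left_morphism W W' g" and eq: "tensorL_eq W xs ys"
  shows "tensorL_eq W' (map (\<lambda>(a, b). (g a, g b)) xs) (map (\<lambda>(a, b). (g a, g b)) ys)"
  unfolding tensorL_eq_def tensor_eq_def
proof (rule formal_eq_map[OF eq[unfolded tensorL_eq_def tensor_eq_def]])
  interpret weak_bialgebra_space W by unfold_locales (rule W)
  have hom: "g x \<in> car W'" "g (x + y) = g x + g y" "g (mul W x y) = mul W' (g x) (g y)" if "x \<in> car W" "y \<in> car W" for x y
    using g that by (auto simp: weak_left_morphism_def algebra_hom_def linear_on_def)
  have g0: "g 0 = 0" using hom(2)[of 0 0] by simp
  have l: "g l \<in> left_subalgebra W'" "g (tL W l) = tL W' (g l)" if "l \<in> left_subalgebra W" for l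
    using g that by (auto simp: weak_left_morphism_def algebra_hom_def)
  fix xs ys
  assume "tensor_rel (car W) (car W) (left_subalgebra W) (\<lambda>w l. mul W (tL W l) w) (mul W) xs ys"
  then have "tensor_rel (car W') (car W') (left_subalgebra W') (\<lambda>w l. mul W' (tL W' l) w) (mul W')
      (map (\<lambda>(a, b). (g a, g b)) xs) (map (\<lambda>(a, b). (g a, g b)) ys)"
  proof cases
    case (balanced a b c)
    have "c \<in> car W" using balanced by (intro left_subalgebra_car)
    with balanced l[of c] show ?thesis
      using tensor_rel.balanced[of "g a" "car W'" "g b" "car W'" "g c" "left_subalgebra W'" "\<lambda>w l. mul W' (tL W' l) w" "mul W'"]
      by (simp add: hom)
  qed (auto simp: hom g0 intro: tensor_rel.intros)
  then show "formal_eq (tensor_rel (car W') (car W') (left_subalgebra W') (\<lambda>w l. mul W' (tL W' l) w) (mul W'))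
      (map (\<lambda>(a, b). (g a, g b)) xs) (map (\<lambda>(a, b). (g a, g b)) ys)" by (rule formal_eq.base)
qed

lemma weak_left_morphism_comp:
  assumes W2: "weak_bialgebra W2" and f: "weak_left_morphism W1 W2 f" and g: "weak_left_morphism W2 W3 g"
  shows "weak_left_morphism W1 W3 (\<lambda>x. g (f x))"
proof -
  interpret weak_bialgebra_space W2 by unfold_locales (rule W2)
  from f obtain \<omega> where F: "algebra_hom W1 (car W1) W2 (car W2) f"
    "algebra_hom W1 (left_subalgebra W1) W2 (left_subalgebra W2) \<omega>"
    "\<And>l. l \<in> left_subalgebra W1 \<Longrightarrow> f l = \<omega> l" "\<And>l. l \<in> left_subalgebra W1 \<Longrightarrow> f (tL W1 l) = tL W2 (\<omega> l)"
    "\<And>w. w \<in> car W1 \<Longrightarrow> piL W2 (f w) = \<omega> (piL W1 w)"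
    "\<And>w. w \<in> car W1 \<Longrightarrow> tensorL_eq W2 (cop W2 (f w)) [(f a, f b). (a, b) \<leftarrow> cop W1 w]"
    unfolding weak_left_morphism_def by blast
  from g obtain \<eta> where G: "algebra_hom W2 (car W2) W3 (car W3) g"
    "algebra_hom W2 (left_subalgebra W2) W3 (left_subalgebra W3) \<eta>"
    "\<And>l. l \<in> left_subalgebra W2 \<Longrightarrow> g l = \<eta> l" "\<And>l. l \<in> left_subalgebra W2 \<Longrightarrow> g (tL W2 l) = tL W3 (\<eta> l)"
    "\<And>w. w \<in> car W2 \<Longrightarrow> piL W3 (g w) = \<eta> (piL W2 w)"
    "\<And>w. w \<in> car W2 \<Longrightarrow> tensorL_eq W3 (cop W3 (g w)) [(g a, g b). (a, b) \<leftarrow> cop W2 w]"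
    unfolding weak_left_morphism_def by blast
  have comp: "algebra_hom W1 D1 W3 D3 (\<lambda>x. q (p x))"
    if "algebra_hom W1 D1 W2 D2 p" "algebra_hom W2 D2 W3 D3 q" for D1 D2 D3 p q
    using that by (simp add: algebra_hom_def linear_on_def)
  have fC: "f w \<in> car W2" if "w \<in> car W1" for w using F(1) that by (simp add: algebra_hom_def)
  have wl: "\<omega> l \<in> left_subalgebra W2" if "l \<in> left_subalgebra W1" for l using F(2) that by (simp add: algebra_hom_def)
  show ?thesis unfolding weak_left_morphism_def
  proof (intro conjI exI[of _ "\<lambda>x. \<eta> (\<omega> x)"] ballI)
    show "algebra_hom W1 (car W1) W3 (car W3) (\<lambda>x. g (f x))" by (rule comp[OF F(1) G(1)])
    show "algebra_hom W1 (left_subalgebra W1) W3 (left_subalgebra W3) (\<lambda>x. \<eta> (\<omega> x))" by (rule comp[OF F(2) G(2)])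
    fix w assume w: "w \<in> car W1"
    show "piL W3 (g (f w)) = \<eta> (\<omega> (piL W1 w))" using w by (simp add: G fC F)
    have "tensorL_eq W3 (map (\<lambda>(a, b). (g a, g b)) (cop W2 (f w))) (map (\<lambda>(a, b). (g a, g b)) [(f a, f b). (a, b) \<leftarrow> cop W1 w])"
      by (rule tensorL_eq_map[OF W2 g F(6)[OF w]])
    with G(6)[OF fC[OF w]] show "tensorL_eq W3 (cop W3 (g (f w))) [(g (f a), g (f b)). (a, b) \<leftarrow> cop W1 w]"
      unfolding tensorL_eq_def tensor_eq_def by (simp add: comp_def case_prod_unfold formal_eq.trans)
  qed (simp_all add: F G wl)
qed

section \<open>Transport of structure\<close>

lemma tensor3_eq_map:
  assumes "tensor3_eq s V xs ys" "linear_on V s t f" "f ` V \<subseteq> U" "0 \<in> V"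
  shows "tensor3_eq t U (map (\<lambda>(a, b, c). (f a, f b, f c)) xs) (map (\<lambda>(a, b, c). (f a, f b, f c)) ys)"
  unfolding tensor3_eq_def
proof (rule formal_eq_map[OF assms(1)[unfolded tensor3_eq_def]])
  fix xs ys assume "tensor3_rel s V xs ys"
  then have "tensor3_eq t U (map (\<lambda>(a, b, c). (f a, f b, f c)) xs) (map (\<lambda>(a, b, c). (f a, f b, f c)) ys)"
  proof cases
    case (slots_12 xs' ys' c)
    have "tensor2_eq s V xs' ys'" using slots_12 by (simp add: tensor2_eq_def formal_eq.base)
    from tensor3_eq_slots(1)[OF tensor2_eq_map[OF this assms(2-4)], of "f c"] slots_12 assms(3)
    show ?thesis by (simp add: comp_def case_prod_unfold image_subset_iff)
  next
    case (slots_23 xs' ys' a)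
    have "tensor2_eq s V xs' ys'" using slots_23 by (simp add: tensor2_eq_def formal_eq.base)
    from tensor3_eq_slots(2)[OF tensor2_eq_map[OF this assms(2-4)], of "f a"] slots_23 assms(3)
    show ?thesis by (simp add: comp_def case_prod_unfold image_subset_iff)
  qed
  then show "formal_eq (tensor3_rel t U) (map (\<lambda>(a, b, c). (f a, f b, f c)) xs) (map (\<lambda>(a, b, c). (f a, f b, f c)) ys)"
    by (simp add: tensor3_eq_def)
qed

text \<open>
  The universal property of a solution refers to weak bialgebras in one type.  In order to apply it to
  the solution itself, the structure is carried over along a linear bijection \<open>h\<close>.
\<close>
locale wba_transport = weak_bialgebra_space W
  for W :: "('k::field, 'w::ab_group_add, 'z) wba_scheme" +
  fixes C :: "'c::ab_group_add set" and sc :: "'k \<Rightarrow> 'c \<Rightarrow> 'c" and h :: "'c \<Rightarrow> 'w"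
  assumes fd_C: "fd_space sc C" and h_linear: "linear_on C sc (scl W) h" and h_bij: "bij_betw h C (car W)"
begin

definition k :: "'w \<Rightarrow> 'c" where "k = inv_into C h"

abbreviation kk :: "('w \<times> 'w) list \<Rightarrow> ('c \<times> 'c) list" where "kk \<equiv> map (\<lambda>(a, b). (k a, k b))"

lemma h_car [simp]: "x \<in> C \<Longrightarrow> h x \<in> car W" and k_C [simp]: "y \<in> car W \<Longrightarrow> k y \<in> C"
  and h_k [simp]: "y \<in> car W \<Longrightarrow> h (k y) = y" and k_h [simp]: "x \<in> C \<Longrightarrow> k (h x) = x"
  using h_bij unfolding k_def
  by (auto simp: bij_betw_def inv_into_into f_inv_into_f)

lemma C_closed [simp]: "0 \<in> C" "x \<in> C \<Longrightarrow> y \<in> C \<Longrightarrow> x + y \<in> C" "x \<in> C \<Longrightarrow> sc c x \<in> C"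
  using fd_spaceD[OF fd_C] by auto

lemma h_lin: "x \<in> C \<Longrightarrow> y \<in> C \<Longrightarrow> h (x + y) = h x + h y" "x \<in> C \<Longrightarrow> h (sc c x) = scl W c (h x)"
  using h_linear by (auto simp: linear_on_def)

lemma h_inj: "x \<in> C \<Longrightarrow> y \<in> C \<Longrightarrow> h x = h y \<Longrightarrow> x = y"
  using k_h by metis

lemma k_linear: "linear_on (car W) (scl W) sc k"
  unfolding linear_on_def by (auto intro!: h_inj simp: h_lin)

definition T :: "('k, 'c) wba" where
  "T = \<lparr>car = C, scl = sc, mul = (\<lambda>x y. k (mul W (h x) (h y))), unt = k (unt W),
    cop = (\<lambda>x. kk (cop W (h x))), eps = (\<lambda>x. eps W (h x))\<rparr>"

lemma T_simps [simp]: "car T = C" "scl T = sc" "mul T x y = k (mul W (h x) (h y))" "unt T = k (unt W)"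
  "cop T x = kk (cop W (h x))" "eps T x = eps W (h x)"
  by (simp_all add: T_def)

lemma k_image: "k ` car W \<subseteq> C"
  by auto

lemma tensor2_k: "tensor2_eq (scl W) (car W) xs ys \<Longrightarrow>
    tensor2_eq sc C (kk xs) (kk ys)"
  by (rule tensor2_eq_map[OF _ k_linear k_image]) simp_all

lemma tensor3_k: "tensor3_eq (scl W) (car W) xs ys \<Longrightarrow>
    tensor3_eq sc C (map (\<lambda>(a, b, c). (k a, k b, k c)) xs) (map (\<lambda>(a, b, c). (k a, k b, k c)) ys)"
  by (rule tensor3_eq_map[OF _ k_linear k_image]) simp_all

lemma concat_cop_left:
  assumes w: "w \<in> car W"
  shows "[(a, b, c). (x, c) \<leftarrow> kk (cop W w), (a, b) \<leftarrow> kk (cop W (h x))] =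
    map (\<lambda>(a, b, c). (k a, k b, k c)) [(a, b, c). (x, c) \<leftarrow> cop W w, (a, b) \<leftarrow> cop W x]"
  by (auto simp: map_concat comp_def case_prod_unfold intro!: arg_cong[of _ _ concat]
      dest!: subsetD[OF cop_car[OF w]])

lemma concat_cop_right:
  assumes w: "w \<in> car W"
  shows "[(a, b, c). (a, y) \<leftarrow> kk (cop W w), (b, c) \<leftarrow> kk (cop W (h y))] =
    map (\<lambda>(a, b, c). (k a, k b, k c)) [(a, b, c). (a, y) \<leftarrow> cop W w, (b, c) \<leftarrow> cop W y]"
  by (auto simp: map_concat comp_def case_prod_unfold intro!: arg_cong[of _ _ concat]
      dest!: subsetD[OF cop_car[OF w]])

lemma k_psum:
  assumes "w \<in> car W" "\<And>a b. a \<in> car W \<Longrightarrow> b \<in> car W \<Longrightarrow> F a b \<in> car W"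
  shows "k (psum (cop W w) F) = psum (cop W w) (\<lambda>a b. k (F a b))"
  by (rule linear_cop_psum[OF k_linear assms])

lemma k_scl: "x \<in> car W \<Longrightarrow> sc c (k x) = k (scl W c x)"
  using k_linear by (simp add: linear_on_def)

lemma fin_dim_algebra_T: "fin_dim_algebra T"
  unfolding fin_dim_algebra_def T_simps
proof (intro conjI ballI)
  show "vector_space sc" "\<exists>B. finite B \<and> C = module.span sc B" using fd_C by (auto simp: fd_space_def)
qed (auto simp: linear_on_def mul_assoc intro!: h_inj simp: h_lin mul_add)

lemma coalgebra_T: "coalgebra T"
  unfolding coalgebra_def T_simps psum_list_comp
proof (intro conjI ballI allI)
  fix w assume w: "w \<in> C"
  then have hw: "h w \<in> car W" by simp
  show "set (kk (cop W (h w))) \<subseteq> C \<times> C"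
    using cop_car[OF hw] by auto
  have "psum (cop W (h w)) (\<lambda>a b. sc (eps W (h (k a))) (k b)) = k (psum (cop W (h w)) (\<lambda>a b. scl W (eps W a) b))"
    using w by (subst k_psum) (auto simp: k_scl intro!: cop_cong)
  then show "psum (kk (cop W (h w))) (\<lambda>a. sc (eps W (h a))) = w"
    using w by (simp add: psum_map counit)
  have "psum (cop W (h w)) (\<lambda>a b. sc (eps W (h (k b))) (k a)) = k (psum (cop W (h w)) (\<lambda>a b. scl W (eps W b) a))"
    using w by (subst k_psum) (auto simp: k_scl intro!: cop_cong)
  then show "psum (kk (cop W (h w))) (\<lambda>a b. sc (eps W (h b)) a) = w"
    using w by (simp add: psum_map counit)
  show "tensor3_eq sc C
     [(a, b, c). (x, c) \<leftarrow> kk (cop W (h w)), (a, b) \<leftarrow> kk (cop W (h x))]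
     [(a, b, c). (a, y) \<leftarrow> kk (cop W (h w)), (b, c) \<leftarrow> kk (cop W (h y))]"
    unfolding concat_cop_left[OF hw] concat_cop_right[OF hw]
    by (rule tensor3_k) (use coalgebra hw in \<open>simp add: coalgebra_def\<close>)
next
  fix x y assume xy: "x \<in> C" "y \<in> C"
  have "tensor2_eq (scl W) (car W) (cop W (h x + h y)) (cop W (h x) @ cop W (h y))"
    using coalgebra xy by (simp add: coalgebra_def)
  from tensor2_k[OF this] xy
  show "tensor2_eq sc C (kk (cop W (h (x + y))))
      (kk (cop W (h x)) @ kk (cop W (h y)))"
    by (simp add: h_lin)
next
  fix c x assume x: "x \<in> C"
  have "tensor2_eq (scl W) (car W) (cop W (scl W c (h x))) [(scl W c a, b). (a, b) \<leftarrow> cop W (h x)]"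
    using coalgebra x by (simp add: coalgebra_def)
  from tensor2_k[OF this]
  have "tensor2_eq sc C (kk (cop W (scl W c (h x)))) (map (\<lambda>(a, b). (k (scl W c a), k b)) (cop W (h x)))"
    unfolding map_map by (simp add: comp_def case_prod_unfold)
  moreover have "[(sc c a, b). (a, b) \<leftarrow> kk (cop W (h x))] =
      map (\<lambda>(a, b). (k (scl W c a), k b)) (cop W (h x))"
    by (auto simp: k_scl dest!: subsetD[OF cop_car[OF h_car[OF x]]])
  ultimately show "tensor2_eq sc C (kk (cop W (h (sc c x))))
      [(sc c a, b). (a, b) \<leftarrow> kk (cop W (h x))]"
    using x by (simp only: h_lin)
qed (use eps_linear in \<open>auto simp: linear_on_def h_lin\<close>)

lemma eps_mul': "x \<in> car W \<Longrightarrow> y \<in> car W \<Longrightarrow> z \<in> car W \<Longrightarrow>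
    psum (cop W y) (\<lambda>a b. eps W (mul W x b) * eps W (mul W a z)) = eps W (mul W (mul W x y) z)"
  using wba by (simp add: weak_bialgebra_def psum_list_comp)

lemma weak_bialgebra_T: "weak_bialgebra T"
  unfolding weak_bialgebra_def T_simps psum_list_comp
proof (intro conjI ballI)
  show "fin_dim_algebra T" by (rule fin_dim_algebra_T)
  show "coalgebra T" by (rule coalgebra_T)
next
  fix x y assume xy: "x \<in> C" "y \<in> C"
  have eq: "kk [(mul W a a', mul W b b'). (a, b) \<leftarrow> cop W (h x), (a', b') \<leftarrow> cop W (h y)] =
    [(k (mul W (h a) (h a')), k (mul W (h b) (h b'))). (a, b) \<leftarrow> kk (cop W (h x)),
      (a', b') \<leftarrow> kk (cop W (h y))]"
    by (auto simp: map_concat comp_def case_prod_unfold intro!: arg_cong[of _ _ concat]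
        dest!: subsetD[OF cop_car[OF h_car[OF xy(1)]]] subsetD[OF cop_car[OF h_car[OF xy(2)]]])
  have "tensor2_eq (scl W) (car W) (cop W (mul W (h x) (h y)))
        [(mul W a a', mul W b b'). (a, b) \<leftarrow> cop W (h x), (a', b') \<leftarrow> cop W (h y)]"
    using wba xy by (simp add: weak_bialgebra_def)
  from tensor2_k[OF this] xy
  show "tensor2_eq sc C (kk (cop W (h (k (mul W (h x) (h y))))))
    [(k (mul W (h a) (h a')), k (mul W (h b) (h b'))). (a, b) \<leftarrow> kk (cop W (h x)),
      (a', b') \<leftarrow> kk (cop W (h y))]"
    unfolding eq by simp
next
  fix x y z assume xyz: "x \<in> C" "y \<in> C" "z \<in> C"
  have "psum (cop W (h y)) (\<lambda>a b. eps W (h (k (mul W (h x) (h (k a))))) * eps W (h (k (mul W (h (k b)) (h z))))) =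
      psum (cop W (h y)) (\<lambda>a b. eps W (mul W (h x) a) * eps W (mul W b (h z)))"
    using xyz by (intro cop_cong) simp_all
  then show "psum (kk (cop W (h y)))
      (\<lambda>a b. eps W (h (k (mul W (h x) (h a)))) * eps W (h (k (mul W (h b) (h z))))) =
      eps W (h (k (mul W (h (k (mul W (h x) (h y)))) (h z))))"
    using xyz by (simp add: psum_map eps_mul)
  have "psum (cop W (h y)) (\<lambda>a b. eps W (h (k (mul W (h x) (h (k b))))) * eps W (h (k (mul W (h (k a)) (h z))))) =
      psum (cop W (h y)) (\<lambda>a b. eps W (mul W (h x) b) * eps W (mul W a (h z)))"
    using xyz by (intro cop_cong) simp_all
  then show "psum (kk (cop W (h y)))
      (\<lambda>a b. eps W (h (k (mul W (h x) (h b)))) * eps W (h (k (mul W (h a) (h z))))) =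
      eps W (h (k (mul W (h (k (mul W (h x) (h y)))) (h z))))"
    using xyz by (simp add: psum_map eps_mul')
next
  let ?c = "kk (cop W (h (k (unt W))))"
  have c: "?c = kk (cop W (unt W))" by simp
  have 1: "tensor3_eq (scl W) (car W)
       [(mul W a (unt W), mul W b a', mul W (unt W) b'). (a, b) \<leftarrow> cop W (unt W), (a', b') \<leftarrow> cop W (unt W)]
       [(a, b, c). (x, c) \<leftarrow> cop W (unt W), (a, b) \<leftarrow> cop W x]"
    and 2: "tensor3_eq (scl W) (car W)
       [(mul W (unt W) a, mul W a' b, mul W b' (unt W)). (a', b') \<leftarrow> cop W (unt W), (a, b) \<leftarrow> cop W (unt W)]
       [(a, b, c). (x, c) \<leftarrow> cop W (unt W), (a, b) \<leftarrow> cop W x]"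
    using wba by (simp_all add: weak_bialgebra_def)
  have eq: "map (\<lambda>(a, b, c). (k a, k b, k c))
      [(mul W a (unt W), mul W b a', mul W (unt W) b'). (a, b) \<leftarrow> cop W (unt W), (a', b') \<leftarrow> cop W (unt W)] =
    [(k (mul W (h a) (h (k (unt W)))), k (mul W (h b) (h a')), k (mul W (h (k (unt W))) (h b'))).
      (a, b) \<leftarrow> ?c, (a', b') \<leftarrow> ?c]"
    "map (\<lambda>(a, b, c). (k a, k b, k c))
      [(mul W (unt W) a, mul W a' b, mul W b' (unt W)). (a', b') \<leftarrow> cop W (unt W), (a, b) \<leftarrow> cop W (unt W)] =
    [(k (mul W (h (k (unt W))) (h a)), k (mul W (h a') (h b)), k (mul W (h b') (h (k (unt W))))).
      (a', b') \<leftarrow> ?c, (a, b) \<leftarrow> ?c]"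
    unfolding c
    by (auto simp: map_concat comp_def case_prod_unfold intro!: arg_cong[of _ _ concat]
        dest!: subsetD[OF cop_car[OF closed(4)]])
  show "tensor3_eq sc C
    [(k (mul W (h a) (h (k (unt W)))), k (mul W (h b) (h a')), k (mul W (h (k (unt W))) (h b'))).
      (a, b) \<leftarrow> ?c, (a', b') \<leftarrow> ?c]
    [(a, b, c). (x, c) \<leftarrow> ?c, (a, b) \<leftarrow> kk (cop W (h x))]"
    using tensor3_k[OF 1] unfolding eq concat_cop_left[OF closed(4), symmetric] c .
  show "tensor3_eq sc C
    [(k (mul W (h (k (unt W))) (h a)), k (mul W (h a') (h b)), k (mul W (h b') (h (k (unt W))))).
      (a', b') \<leftarrow> ?c, (a, b) \<leftarrow> ?c]
    [(a, b, c). (x, c) \<leftarrow> ?c, (a, b) \<leftarrow> kk (cop W (h x))]"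
    using tensor3_k[OF 2] unfolding eq concat_cop_left[OF closed(4), symmetric] c .
qed

lemma h_piL: "w \<in> C \<Longrightarrow> h (piL T w) = piL W (h w)"
  and h_tL: "w \<in> C \<Longrightarrow> h (tL T w) = tL W (h w)"
proof -
  assume w: "w \<in> C"
  have "piL T w = k (piL W (h w))"
  proof -
    have "piL T w = psum (kk (cop W (unt W))) (\<lambda>a b. sc (eps W (h (k (mul W (h a) (h w))))) b)"
      by (simp only: piL_def psum_list_comp T_simps h_k closed)
    also have "\<dots> = psum (cop W (unt W)) (\<lambda>a b. k (scl W (eps W (mul W a (h w))) b))"
      unfolding psum_map using w by (intro cop_cong) (simp_all add: k_scl)
    also have "\<dots> = k (piL W (h w))"
      unfolding piL_psum using w by (intro k_psum[symmetric]) simp_all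
    finally show ?thesis .
  qed
  then show "h (piL T w) = piL W (h w)" using w by simp
  have "tL T w = k (tL W (h w))"
  proof -
    have "tL T w = psum (kk (cop W (unt W))) (\<lambda>a b. sc (eps W (h (k (mul W (h b) (h w))))) a)"
      by (simp only: tL_def psum_list_comp T_simps h_k closed)
    also have "\<dots> = psum (cop W (unt W)) (\<lambda>a b. k (scl W (eps W (mul W b (h w))) a))"
      unfolding psum_map using w by (intro cop_cong) (simp_all add: k_scl)
    also have "\<dots> = k (tL W (h w))"
      unfolding tL_psum using w by (intro k_psum[symmetric]) simp_all
    finally show ?thesis .
  qed
  then show "h (tL T w) = tL W (h w)" using w by simp
qed

lemma weak_left_morphism_h: "weak_left_morphism T W h"
  unfolding weak_left_morphism_def
proof (intro conjI exI ballI)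
  interpret T: weak_bialgebra_space T by unfold_locales (rule weak_bialgebra_T)
  have sub: "l \<in> C" if "l \<in> left_subalgebra T" for l using T.left_subalgebra_car[OF that] by simp
  have hl: "h l \<in> left_subalgebra W" if "l \<in> left_subalgebra T" for l
    using that by (auto simp: left_subalgebra_def h_piL)
  show "algebra_hom T (car T) W (car W) h" "algebra_hom T (left_subalgebra T) W (left_subalgebra W) h"
    using sub hl by (simp_all add: algebra_hom_def linear_on_def h_lin)
  show "h l = h l" for l ..
  show "h (tL T l) = tL W (h l)" if "l \<in> left_subalgebra T" for l using sub[OF that] by (rule h_tL)
  fix w assume w: "w \<in> car T"
  then show "piL W (h w) = h (piL T w)" by (simp add: h_piL)
  from \<open>w \<in> car T\<close> have w: "w \<in> C" by simp
  have "map (\<lambda>(a, b). (h a, h b)) (cop T w) = cop W (h w)"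
    unfolding T_simps map_map by (rule map_idI) (auto dest!: subsetD[OF cop_car[OF h_car[OF w]]])
  then show "tensorL_eq W (cop W (h w)) [(h a, h b). (a, b) \<leftarrow> cop T w]"
    by (simp add: tensorL_eq_def tensor_eq_def formal_eq.refl)
qed

lemma module_algebra_action_T:
  assumes "module_algebra_action s W act"
  shows "module_algebra_action s T (\<lambda>x. act (h x))"
  using assms unfolding module_algebra_action_def psum_list_comp
  by (auto simp: linear_on_def h_lin h_piL psum_map intro!: cop_cong)

lemma invariants_T: "invariants W act \<subseteq> invariants T (\<lambda>x. act (h x))"
  by (auto simp: invariants_def h_piL)

end

section \<open>Coordinates\<close>

text \<open>
  Every finite dimensional space is isomorphic to a subspace of the finitely supported sequences.
\<close>
definition finsupp_scale :: "'k::field \<Rightarrow> (nat \<Rightarrow>\<^sub>0 'k) \<Rightarrow> (nat \<Rightarrow>\<^sub>0 'k)" where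
  "finsupp_scale c p = Poly_Mapping.map ((*) c) p"

lemma lookup_finsupp_scale [simp]: "Poly_Mapping.lookup (finsupp_scale c p) i = c * Poly_Mapping.lookup p i"
  by (simp add: finsupp_scale_def Poly_Mapping.map.rep_eq when_def)

lemma vector_space_finsupp: "vector_space finsupp_scale"
  by unfold_locales (auto intro!: poly_mapping_eqI simp: lookup_add algebra_simps)

lemma fd_space_coordinates:
  fixes s :: "'k::field \<Rightarrow> 'a::ab_group_add \<Rightarrow> 'a"
  assumes V: "fd_space s V"
  obtains C :: "(nat \<Rightarrow>\<^sub>0 'k) set" and h
  where "fd_space finsupp_scale C" "linear_on C finsupp_scale s h" "bij_betw h C V"
proof -
  interpret vector_space s using V unfolding fd_space_def by blast
  interpret P: vector_space finsupp_scale by (rule vector_space_finsupp)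
  obtain B0 where B0: "finite B0" "V = span B0" using V unfolding fd_space_def by blast
  obtain B where B: "B \<subseteq> B0" "independent B" "span B = V"
    using maximal_independent_subset[of B0] B0 by (metis span_mono span_span subset_antisym)
  have fB: "finite B" using B B0 finite_subset by blast
  obtain n and b :: "nat \<Rightarrow> 'a" where b: "bij_betw b {..<n} B"
    using ex_bij_betw_nat_finite[OF fB] by (auto simp: atLeast0LessThan)
  define C :: "(nat \<Rightarrow>\<^sub>0 'k) set" where "C = {p. \<forall>i\<ge>n. Poly_Mapping.lookup p i = 0}"
  define h where "h p = (\<Sum>i<n. s (Poly_Mapping.lookup p i) (b i))" for p
  define r where "r v i = representation B v (b i)" for v i
  have bB: "b i \<in> B" if "i < n" for i using b that by (auto simp: bij_betw_def)
  have bV: "b i \<in> V" if "i < n" for i using bB[OF that] B span_base by auto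
  have hV: "h p \<in> V" for p
    unfolding h_def using bV B by (metis (no_types, lifting) lessThan_iff span_scale span_sum)
  have hC: "linear_on C finsupp_scale s h"
    by (simp add: linear_on_def h_def lookup_add scale_left_distrib sum.distrib scale_sum_right)
  have rh: "r (h p) j = Poly_Mapping.lookup p j" if "j < n" for p j
  proof -
    have "r (h p) j = (\<Sum>i<n. representation B (s (Poly_Mapping.lookup p i) (b i)) (b j))"
      unfolding r_def h_def using B bV by (subst representation_sum) (auto simp: span_scale)
    also have "\<dots> = (\<Sum>i<n. if i = j then Poly_Mapping.lookup p i else 0)"
    proof (rule sum.cong)
      fix i assume "i \<in> {..<n}"
      then have i: "i < n" by simp
      have "i = j" if "b i = b j" using b i \<open>j < n\<close> that by (auto simp: bij_betw_def inj_on_def)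
      then show "representation B (s (Poly_Mapping.lookup p i) (b i)) (b j) = (if i = j then Poly_Mapping.lookup p i else 0)"
        using B bV[OF i] bB[OF i] by (auto simp: representation_scale representation_basis)
    qed simp
    finally show ?thesis using that by simp
  qed
  have hr: "(\<Sum>i<n. s (r v i) (b i)) = v" if v: "v \<in> V" for v
  proof -
    have "(\<Sum>i<n. s (r v i) (b i)) = (\<Sum>d\<in>B. s (representation B v d) d)"
      unfolding r_def using b by (rule sum.reindex_bij_betw)
    then show ?thesis using sum_representation_eq[OF B(2), of v B] B v fB by auto
  qed
  have "bij_betw h C V"
    unfolding bij_betw_def
  proof
    show "inj_on h C"
    proof (rule inj_onI, rule poly_mapping_eqI)
      fix p q i assume pq: "p \<in> C" "q \<in> C" "h p = h q"
      show "Poly_Mapping.lookup p i = Poly_Mapping.lookup q i"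
        using rh[of i p] rh[of i q] pq by (cases "i < n") (auto simp: C_def)
    qed
    show "h ` C = V"
    proof
      show "V \<subseteq> h ` C"
      proof
        fix v assume v: "v \<in> V"
        let ?p = "\<Sum>i<n. Poly_Mapping.single i (r v i)"
        have l: "Poly_Mapping.lookup ?p j = (if j < n then r v j else 0)" for j
          by (simp add: lookup_sum lookup_single when_def)
        have "h ?p = v" unfolding h_def using hr[OF v] by (simp add: l)
        moreover have "?p \<in> C" by (simp add: C_def l)
        ultimately show "v \<in> h ` C" by force
      qed
    qed (use hV in auto)
  qed
  moreover have "fd_space finsupp_scale C"
    unfolding fd_space_def
  proof (intro conjI exI)
    let ?S = "(\<lambda>i. Poly_Mapping.single i (1::'k)) ` {..<n}"
    show "vector_space finsupp_scale" by (rule vector_space_finsupp)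
    show "finite ?S" by simp
    show "C = P.span ?S"
    proof
      have "P.subspace C" by (auto simp: P.subspace_def C_def lookup_add)
      then show "P.span ?S \<subseteq> C"
        by (intro P.span_minimal) (auto simp: C_def lookup_single when_def)
      show "C \<subseteq> P.span ?S"
      proof
        fix p assume p: "p \<in> C"
        have "p = (\<Sum>i<n. finsupp_scale (Poly_Mapping.lookup p i) (Poly_Mapping.single i 1))"
          using p by (intro poly_mapping_eqI)
            (auto simp: lookup_sum lookup_single when_def C_def if_distrib[of "(*) _"] cong: if_cong)
        also have "\<dots> \<in> P.span ?S" by (intro P.span_sum P.span_scale P.span_base) auto
        finally show "p \<in> P.span ?S" .
      qed
    qed
  qed
  ultimately show ?thesis using hC that by blast
qed

lemma psum_fun_apply: "psum xs F x = psum xs (\<lambda>a b. F a b x)"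
  by (induction xs) auto

context depth_two_frobenius begin

text \<open>
  \<open>E\<close> is generated over \<open>R\<close> by the \<open>\<beta>\<close>, and \<open>R\<close> over \<open>K\<close> by the \<open>e\<^sub>i\<close>.
\<close>
lemma fd_space_bimodule_end: "fd_space (\<lambda>c (f :: 'm \<Rightarrow> 'm) x. s c (f x)) E"
proof -
  interpret F: vector_space "\<lambda>c (f :: 'm \<Rightarrow> 'm) x. s c (f x)"
    by unfold_locales (auto simp: fun_eq_iff vs.scale_right_distrib vs.scale_left_distrib)
  let ?S = "(\<lambda>(e, \<beta>) x. e * \<beta> x) ` (fst ` set eb \<times> snd ` set tb)"
  have S: "(\<lambda>x. e * \<beta> x) \<in> ?S" if "(e, e') \<in> set eb" "(t, \<beta>) \<in> set tb" for e e' t \<beta>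
    using that by force
  have "f \<in> F.span ?S" if f: "f \<in> E" for f
  proof -
    have "f = psum tb (\<lambda>t \<beta>. psum eb (\<lambda>e e'. \<lambda>x. s (kap (\<phi> (e' * theta f t 1))) (e * \<beta> x)))"
    proof
      fix x
      have "f x = psum tb (\<lambda>t \<beta>. theta f t 1 * \<beta> x)" using theta_expand[OF f] by simp
      also have "\<dots> = psum tb (\<lambda>t \<beta>. psum eb (\<lambda>e e'. s (kap (\<phi> (e' * theta f t 1))) (e * \<beta> x)))"
      proof (rule psum_cong)
        fix t \<beta> assume t: "(t, \<beta>) \<in> set tb"
        have r: "theta f t 1 \<in> R" by (rule E_R[OF theta_E[OF f t] R_1])
        have "theta f t 1 * \<beta> x = psum eb (\<lambda>e e'. e * \<phi> (e' * theta f t 1) * \<beta> x)"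
          by (simp only: psum_mult_right eb_left[OF r])
        also have "\<dots> = psum eb (\<lambda>e e'. s (kap (\<phi> (e' * theta f t 1))) (e * \<beta> x))"
        proof (rule psum_cong)
          fix e e' assume "(e, e') \<in> set eb"
          then have "e' * theta f t 1 \<in> R" using eb_R r R_mult by blast
          then show "e * \<phi> (e' * theta f t 1) * \<beta> x = s (kap (\<phi> (e' * theta f t 1))) (e * \<beta> x)"
            using kap_R(2)[of "e' * theta f t 1" e] by (simp flip: s_mult_left)
        qed
        finally show "theta f t 1 * \<beta> x = \<dots>" .
      qed
      finally show "f x = psum tb (\<lambda>t \<beta>. psum eb (\<lambda>e e'. \<lambda>x. s (kap (\<phi> (e' * theta f t 1))) (e * \<beta> x))) x"
        by (simp only: psum_fun_apply)
    qed
    also have "\<dots> \<in> F.span ?S"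
    proof (intro psum_in[of "F.span ?S"] F.span_zero F.span_add)
      fix t \<beta> e e' assume "(t, \<beta>) \<in> set tb" "(e, e') \<in> set eb"
      then show "(\<lambda>x. s (kap (\<phi> (e' * theta f t 1))) (e * \<beta> x)) \<in> F.span ?S"
        using S by (intro F.span_scale[of "\<lambda>x. e * \<beta> x"] F.span_base)
    qed
    finally show ?thesis .
  qed
  moreover have "F.span ?S \<subseteq> E"
  proof (rule F.span_minimal)
    show "?S \<subseteq> E" using eb_R tb_end by (auto intro!: E_left)
    show "F.subspace E"
      using E_zero E_add E_smult by (auto simp: F.subspace_def zero_fun_def plus_fun_def)
  qed
  ultimately have "E = F.span ?S" by auto
  moreover have "finite ?S" by auto
  ultimately show ?thesis unfolding fd_space_def using F.vector_space_axioms by blast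
qed

end

section \<open>Depth two quasibases\<close>

lemma tensor_class_eq_iff: "tensor_class N xs = tensor_class N ys \<longleftrightarrow> tensor_eq UNIV UNIV N (*) (*) xs ys"
proof
  assume "tensor_class N xs = tensor_class N ys"
  moreover have "ys \<in> tensor_class N ys" by (simp add: tensor_class_def tensor_eq_def formal_eq.refl)
  ultimately show "tensor_eq UNIV UNIV N (*) (*) xs ys" by (auto simp: tensor_class_def)
next
  assume eq: "tensor_eq UNIV UNIV N (*) (*) xs ys"
  then show "tensor_class N xs = tensor_class N ys"
    unfolding tensor_class_def tensor_eq_def
    using formal_eq.trans[OF eq[unfolded tensor_eq_def]] formal_eq.trans[OF formal_eq.sym[OF eq[unfolded tensor_eq_def]]]
    by blast
qed

text \<open>
  The operations of the bimodule \<open>M \<otimes>\<^sub>N M\<close> are defined as unions over representatives; this evaluates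
  them on any one of these.
\<close>
lemma tensor_class_const:
  assumes "\<And>ys. tensor_eq UNIV UNIV N (*) (*) xs ys \<Longrightarrow> f ys = f xs"
  shows "(\<Union>ys\<in>tensor_class N xs. f ys) = f xs"
proof -
  have "xs \<in> tensor_class N xs" by (simp add: tensor_class_def tensor_eq_def formal_eq.refl)
  then have ne: "tensor_class N xs \<noteq> {}" by blast
  have "(\<Union>ys\<in>tensor_class N xs. f ys) = (\<Union>ys\<in>tensor_class N xs. f xs)"
    using assms by (intro SUP_cong) (simp_all add: tensor_class_def)
  then show ?thesis using ne by simp
qed

lemma tensor_class_append: "badd (tensor_bimodule N) (tensor_class N xs) (tensor_class N ys) = tensor_class N (xs @ ys)"
proof -
  have "(\<Union>zs\<in>tensor_class N ys. tensor_class N (us @ zs)) = tensor_class N (us @ ys)" for us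
  proof (rule tensor_class_const)
    fix zs assume "tensor_eq UNIV UNIV N (*) (*) ys zs"
    from formal_eq.append[OF formal_eq.refl formal_eq.sym[OF this[unfolded tensor_eq_def]]]
    show "tensor_class N (us @ zs) = tensor_class N (us @ ys)"
      by (simp add: tensor_class_eq_iff tensor_eq_def)
  qed
  moreover have "(\<Union>us\<in>tensor_class N xs. tensor_class N (us @ ys)) = tensor_class N (xs @ ys)"
  proof (rule tensor_class_const)
    fix us assume "tensor_eq UNIV UNIV N (*) (*) xs us"
    from formal_eq.append[OF formal_eq.sym[OF this[unfolded tensor_eq_def]] formal_eq.refl]
    show "tensor_class N (us @ ys) = tensor_class N (xs @ ys)"
      by (simp add: tensor_class_eq_iff tensor_eq_def)
  qed
  ultimately show ?thesis by (simp add: tensor_bimodule_def)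
qed

lemma tensor_eq_lact: "tensor_eq UNIV UNIV N (*) (*) xs ys \<Longrightarrow>
    tensor_eq UNIV UNIV N (*) (*) (map (\<lambda>(a, b). ((m::'m::ring_1) * a, b)) xs) (map (\<lambda>(a, b). (m * a, b)) ys)"
  unfolding tensor_eq_def
proof (erule formal_eq_map)
  fix xs ys assume "tensor_rel UNIV UNIV N (*) (*) xs ys"
  then have "tensor_rel UNIV UNIV N (*) (*) (map (\<lambda>(a, b). (m * a, b)) xs) (map (\<lambda>(a, b). (m * a, b)) ys)"
  proof cases
    case (balanced a b c)
    then show ?thesis using tensor_rel.balanced[of "m * a" UNIV b UNIV c N "(*)" "(*)"] by (simp add: mult.assoc)
  qed (auto simp: distrib_left intro: tensor_rel.intros)
  then show "formal_eq (tensor_rel UNIV UNIV N (*) (*)) (map (\<lambda>(a, b). (m * a, b)) xs) (map (\<lambda>(a, b). (m * a, b)) ys)"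
    by (rule formal_eq.base)
qed

lemma tensor_eq_ract: "tensor_eq UNIV UNIV N (*) (*) xs ys \<Longrightarrow>
    tensor_eq UNIV UNIV N (*) (*) (map (\<lambda>(a, b). (a, b * (m::'m::ring_1))) xs) (map (\<lambda>(a, b). (a, b * m)) ys)"
  unfolding tensor_eq_def
proof (erule formal_eq_map)
  fix xs ys assume "tensor_rel UNIV UNIV N (*) (*) xs ys"
  then have "tensor_rel UNIV UNIV N (*) (*) (map (\<lambda>(a, b). (a, b * m)) xs) (map (\<lambda>(a, b). (a, b * m)) ys)"
  proof cases
    case (balanced a b c)
    then show ?thesis using tensor_rel.balanced[of a UNIV "b * m" UNIV c N "(*)" "(*)"] by (simp add: mult.assoc)
  qed (auto simp: distrib_right intro: tensor_rel.intros)
  then show "formal_eq (tensor_rel UNIV UNIV N (*) (*)) (map (\<lambda>(a, b). (a, b * m)) xs) (map (\<lambda>(a, b). (a, b * m)) ys)"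
    by (rule formal_eq.base)
qed

lemma tensor_class_lact: "lact (tensor_bimodule N) m (tensor_class N xs) = tensor_class N (map (\<lambda>(a, b). (m * a, b)) xs)"
  unfolding tensor_bimodule_def bimodule.simps
proof (rule tensor_class_const)
  fix ys assume "tensor_eq UNIV UNIV N (*) (*) xs ys"
  from formal_eq.sym[OF tensor_eq_lact[OF this, unfolded tensor_eq_def]]
  show "tensor_class N (map (\<lambda>(a, b). (m * a, b)) ys) = tensor_class N (map (\<lambda>(a, b). (m * a, b)) xs)"
    by (simp add: tensor_class_eq_iff tensor_eq_def)
qed

lemma tensor_class_ract: "ract (tensor_bimodule N) (tensor_class N xs) m = tensor_class N (map (\<lambda>(a, b). (a, b * m)) xs)"
  unfolding tensor_bimodule_def bimodule.simps
proof (rule tensor_class_const)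
  fix ys assume "tensor_eq UNIV UNIV N (*) (*) xs ys"
  from formal_eq.sym[OF tensor_eq_ract[OF this, unfolded tensor_eq_def]]
  show "tensor_class N (map (\<lambda>(a, b). (a, b * m)) ys) = tensor_class N (map (\<lambda>(a, b). (a, b * m)) xs)"
    by (simp add: tensor_class_eq_iff tensor_eq_def)
qed

lemma tensor_class_psum:
  assumes "tensor_class N xs = tensor_class N ys" "balanced_map N H"
  shows "psum xs H = psum ys H"
  using assms(2) by (intro tensor_eq_psum[OF assms(1)[unfolded tensor_class_eq_iff]])
    (auto simp: balanced_map_def)

definition unit_vector :: "nat \<Rightarrow> 'm::ring_1 \<Rightarrow> nat \<Rightarrow> 'm" where
  "unit_vector k m = (\<lambda>i. if i = k then m else 0)"

abbreviation power_bimodule :: "nat \<Rightarrow> ('m::ring_1, nat \<Rightarrow> 'm) bimodule" where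
  "power_bimodule n \<equiv> direct_power n regular_bimodule"

lemma power_bimodule_simps:
  "v \<in> bcarrier (power_bimodule n) \<longleftrightarrow> (\<forall>i\<ge>n. v i = 0)"
  "badd (power_bimodule n) v w = (\<lambda>i. if i < n then v i + w i else 0)"
  "lact (power_bimodule n) m v = (\<lambda>i. if i < n then m * v i else 0)"
  "ract (power_bimodule n) v m = (\<lambda>i. if i < n then v i * m else 0)"
  by (simp_all add: direct_power_def regular_bimodule_def cong: if_cong)

lemma unit_vector_carrier: "k < n \<Longrightarrow> unit_vector k m \<in> bcarrier (power_bimodule n)"
  and unit_vector_lact: "k < n \<Longrightarrow> lact (power_bimodule n) m' (unit_vector k m) = unit_vector k (m' * m)"
  and unit_vector_ract: "k < n \<Longrightarrow> ract (power_bimodule n) (unit_vector k m) m' = unit_vector k (m * m')"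
  by (auto simp: power_bimodule_simps unit_vector_def)

text \<open>An additive map out of a power is determined by its values on multiples of unit vectors.\<close>

lemma power_hom_expand:
  assumes g: "\<And>v w. v \<in> bcarrier (power_bimodule n) \<Longrightarrow> w \<in> bcarrier (power_bimodule n) \<Longrightarrow>
      g (badd (power_bimodule n) v w) = badd (tensor_bimodule N) (g v) (g w)"
    and g0: "g (\<lambda>i. 0) = tensor_class N []"
    and gk: "\<And>k. k < n \<Longrightarrow> g (unit_vector k (v k)) = tensor_class N (ts k)"
    and v: "v \<in> bcarrier (power_bimodule n)"
  shows "g v = tensor_class N (concat (map ts [0..<n]))"
proof -
  have "g (\<lambda>i. if i < j then v i else 0) = tensor_class N (concat (map ts [0..<j]))" if "j \<le> n" for j
    using that
  proof (induction j)
    case 0 then show ?case using g0 by simp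
  next
    case (Suc j)
    have c: "(\<lambda>i. if i < j then v i else 0) \<in> bcarrier (power_bimodule n)"
      "unit_vector j (v j) \<in> bcarrier (power_bimodule n)"
      using Suc.prems unit_vector_carrier[of j n] by (auto simp: power_bimodule_simps)
    have "(\<lambda>i. if i < Suc j then v i else 0) =
        badd (power_bimodule n) (\<lambda>i. if i < j then v i else 0) (unit_vector j (v j))"
      using Suc.prems by (auto simp: power_bimodule_simps unit_vector_def fun_eq_iff less_Suc_eq)
    then have "g (\<lambda>i. if i < Suc j then v i else 0) =
        badd (tensor_bimodule N) (g (\<lambda>i. if i < j then v i else 0)) (g (unit_vector j (v j)))"
      by (simp only: g[OF c])
    then show ?case using Suc by (simp add: gk tensor_class_append)
  qed
  from this[of n] have "g (\<lambda>i. if i < n then v i else 0) = tensor_class N (concat (map ts [0..<n]))" by simp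
  moreover have "(\<lambda>i. if i < n then v i else 0) = v"
    using v by (auto simp: power_bimodule_simps fun_eq_iff)
  ultimately show ?thesis by simp
qed

lemma tensor_class_carrier [simp]: "tensor_class N xs \<in> bcarrier (tensor_bimodule N)"
  by (simp add: tensor_bimodule_def)

lemma psum_concat_upt: "psum (concat (map ts [0..<n])) H = (\<Sum>k\<leftarrow>[0..<n]. psum (ts k) H)"
  by (induction n) auto

lemma psum_map_pairs: "psum (map (\<lambda>k. (a k, b k)) ks) F = (\<Sum>k\<leftarrow>ks. F (a k) (b k))"
  by (induction ks) auto

text \<open>
  Coordinates of \<open>M \<otimes>\<^sub>N M\<close> as a direct summand of the \<open>n\<close>-th power of \<open>M\<close>: \<open>f k\<close> is the \<open>k\<close>-th
  component of the embedding, \<open>g k\<close> the restriction of the retraction to the \<open>k\<close>-th copy of \<open>M\<close>.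
\<close>
locale summand_coordinates =
  fixes N P Q :: "'m::ring_1 set" and n :: nat
    and f :: "nat \<Rightarrow> ('m \<times> 'm) list set \<Rightarrow> 'm" and g :: "nat \<Rightarrow> 'm \<Rightarrow> ('m \<times> 'm) list set"
  assumes f_add: "k < n \<Longrightarrow> x \<in> bcarrier (tensor_bimodule N) \<Longrightarrow> y \<in> bcarrier (tensor_bimodule N) \<Longrightarrow> f k (badd (tensor_bimodule N) x y) = f k x + f k y"
    and f_lact: "k < n \<Longrightarrow> x \<in> bcarrier (tensor_bimodule N) \<Longrightarrow> p \<in> P \<Longrightarrow> f k (lact (tensor_bimodule N) p x) = p * f k x"
    and f_ract: "k < n \<Longrightarrow> x \<in> bcarrier (tensor_bimodule N) \<Longrightarrow> q \<in> Q \<Longrightarrow> f k (ract (tensor_bimodule N) x q) = f k x * q"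
    and g_lact: "k < n \<Longrightarrow> p \<in> P \<Longrightarrow> g k p = lact (tensor_bimodule N) p (g k 1)"
    and g_ract: "k < n \<Longrightarrow> q \<in> Q \<Longrightarrow> g k q = ract (tensor_bimodule N) (g k 1) q"
    and g_carrier: "k < n \<Longrightarrow> g k m \<in> bcarrier (tensor_bimodule N)"
    and expand: "x \<in> bcarrier (tensor_bimodule N) \<Longrightarrow> (\<And>k. k < n \<Longrightarrow> g k (f k x) = tensor_class N (ts k)) \<Longrightarrow>
      x = tensor_class N (concat (map ts [0..<n]))"
begin

abbreviation "T \<equiv> tensor_bimodule N"

lemma T_class: "tensor_class N xs \<in> bcarrier T" "badd T (tensor_class N xs) (tensor_class N ys) = tensor_class N (xs @ ys)"
  "lact T m (tensor_class N xs) = tensor_class N (map (\<lambda>(a, b). (m * a, b)) xs)"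
  "ract T (tensor_class N xs) m = tensor_class N (map (\<lambda>(a, b). (a, b * m)) xs)"
  by (simp_all add: tensor_class_append tensor_class_lact tensor_class_ract)

lemma representatives: "\<exists>t. \<forall>k<n. g k 1 = tensor_class N (t k)"
proof -
  have "\<exists>t. g k 1 = tensor_class N t" if "k < n" for k
    using g_carrier[OF that, of 1] by (auto simp: tensor_bimodule_def)
  then show ?thesis by metis
qed

lemma central_tensor_representative:
  assumes k: "k < n" and t: "g k 1 = tensor_class N t" and N: "N \<subseteq> P" "N \<subseteq> Q"
  shows "central_tensor N t"
  unfolding central_tensor_def
proof (intro allI impI)
  fix H :: "'m \<Rightarrow> 'm \<Rightarrow> 'm" and m assume H: "balanced_map N H" and m: "m \<in> N"
  have "tensor_class N (map (\<lambda>(p, q). (m * p, q)) t) = tensor_class N (map (\<lambda>(p, q). (p, q * m)) t)"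
    using g_lact[OF k, of m] g_ract[OF k, of m] m N by (auto simp: t T_class)
  from tensor_class_psum[OF this H] show "psum t (\<lambda>p q. H (m * p) q) = psum t (\<lambda>p q. H p (q * m))"
    by (simp add: psum_map)
qed

end

lemma direct_summand_power:
  fixes N P Q :: "'m::ring_1 set"
  assumes "direct_summand P Q (tensor_bimodule N) (power_bimodule n)" and PQ: "0 \<in> P \<or> 0 \<in> Q"
  shows "\<exists>f g. summand_coordinates N P Q n f g"
proof -
  let ?T = "tensor_bimodule N" and ?P = "power_bimodule n :: ('m, nat \<Rightarrow> 'm) bimodule"
  from assms obtain f g where f: "bimodule_hom P Q ?T ?P f" and g: "bimodule_hom P Q ?P ?T g"
    and gf: "\<And>x. x \<in> bcarrier ?T \<Longrightarrow> g (f x) = x"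
    unfolding direct_summand_def by blast
  have fC: "f x \<in> bcarrier ?P" and f_add: "y \<in> bcarrier ?T \<Longrightarrow> f (badd ?T x y) = badd ?P (f x) (f y)"
    and f_l: "p \<in> P \<Longrightarrow> f (lact ?T p x) = lact ?P p (f x)" and f_r: "q \<in> Q \<Longrightarrow> f (ract ?T x q) = ract ?P (f x) q"
    if "x \<in> bcarrier ?T" for x y p q using f that by (auto simp: bimodule_hom_def)
  have g_add: "w \<in> bcarrier ?P \<Longrightarrow> g (badd ?P v w) = badd ?T (g v) (g w)" and gC: "g v \<in> bcarrier ?T"
    and g_l: "p \<in> P \<Longrightarrow> g (lact ?P p v) = lact ?T p (g v)" and g_r: "q \<in> Q \<Longrightarrow> g (ract ?P v q) = ract ?T (g v) q"
    if "v \<in> bcarrier ?P" for v w p q using g that by (auto simp: bimodule_hom_def)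
  \<comment> \<open>Acting by \<open>0\<close> sends both the zero tensor and its image to zero.\<close>
  have "f (tensor_class N []) = (\<lambda>i. 0)"
    using PQ f_l[of "tensor_class N []" 0] f_r[of "tensor_class N []" 0]
    by (auto simp: tensor_class_lact tensor_class_ract power_bimodule_simps cong: if_cong)
  then have g0: "g (\<lambda>i. 0) = tensor_class N []" using gf[of "tensor_class N []"] by simp
  have "summand_coordinates N P Q n (\<lambda>k x. f x k) (\<lambda>k m. g (unit_vector k m))"
  proof
    fix k p assume "k < n" "p \<in> P"
    then show "g (unit_vector k p) = lact ?T p (g (unit_vector k 1))"
      using g_l[OF unit_vector_carrier, of k p 1] by (simp add: unit_vector_lact)
  next
    fix k q assume "k < n" "q \<in> Q"
    then show "g (unit_vector k q) = ract ?T (g (unit_vector k 1)) q"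
      using g_r[OF unit_vector_carrier, of k q 1] by (simp add: unit_vector_ract)
  next
    fix x and ts :: "nat \<Rightarrow> ('m \<times> 'm) list"
    assume x: "x \<in> bcarrier ?T" and ts: "\<And>k. k < n \<Longrightarrow> g (unit_vector k (f x k)) = tensor_class N (ts k)"
    from power_hom_expand[of n g N "f x" ts] show "x = tensor_class N (concat (map ts [0..<n]))"
      by (simp add: g_add g0 ts fC gf x)
  next
    show "g (unit_vector k m) \<in> bcarrier ?T" if "k < n" for k m using that by (intro gC unit_vector_carrier)
  qed (simp_all add: f_add f_l f_r power_bimodule_simps)
  then show ?thesis by blast
qed

text \<open>
  Take \<open>\<beta>\<^sub>k(y)\<close> to be the \<open>k\<close>-th component of \<open>y \<otimes> 1\<close>, and \<open>t\<^sub>k\<close> the image of the \<open>k\<close>-th unit vector.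
\<close>
lemma left_depth_two_quasibasis_exists:
  fixes N :: "'m::ring_1 set"
  assumes "direct_summand N UNIV (tensor_bimodule N) (power_bimodule n)"
  shows "\<exists>tb. left_depth_two_quasibasis N tb"
proof -
  obtain f g where "summand_coordinates N N UNIV n f g" using direct_summand_power[OF assms] by blast
  then interpret summand_coordinates N N UNIV n f g .
  define \<beta> where "\<beta> k x = f k (tensor_class N [(x, 1)])" for k x
  have \<beta>: "\<beta> k \<in> bimodule_end N" if k: "k < n" for k
    unfolding bimodule_end_def
  proof (clarify, intro conjI allI ballI)
    fix x y
    have "tensor_class N [(x + y, 1)] = tensor_class N ([(x, 1)] @ [(y, 1)])"
      unfolding tensor_class_eq_iff tensor_eq_def by (simp add: formal_eq.base tensor_rel.add_left)
    then show "\<beta> k (x + y) = \<beta> k x + \<beta> k y"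
      using f_add[OF k T_class(1) T_class(1), of "[(x, 1)]" "[(y, 1)]"] by (simp add: \<beta>_def T_class)
  next
    fix m x assume m: "m \<in> N"
    then show "\<beta> k (m * x) = m * \<beta> k x"
      using f_lact[OF k T_class(1), of m "[(x, 1)]"] by (simp add: \<beta>_def T_class)
    have "tensor_class N [(x * m, 1)] = tensor_class N [(x, m)]"
      using tensor_rel.balanced[of x UNIV 1 UNIV m N "(*)" "(*)"] m
      unfolding tensor_class_eq_iff tensor_eq_def by (simp add: formal_eq.base)
    then show "\<beta> k (x * m) = \<beta> k x * m"
      using f_ract[OF k T_class(1), of m "[(x, 1)]"] by (simp add: \<beta>_def T_class)
  qed
  obtain t where "\<forall>k<n. g k 1 = tensor_class N (t k)" using representatives by blast
  then have t: "g k 1 = tensor_class N (t k)" if "k < n" for k using that by blast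
  have basis: "psum (map (\<lambda>k. (t k, \<beta> k)) [0..<n]) (\<lambda>t \<beta>. psum t (\<lambda>p q. H p (q * \<beta> y))) = H y 1"
    if H: "balanced_map N H" for H :: "'m \<Rightarrow> 'm \<Rightarrow> 'm" and y
  proof -
    have "g k (\<beta> k y) = tensor_class N (map (\<lambda>(p, q). (p, q * \<beta> k y)) (t k))" if "k < n" for k
      using g_ract[OF that, of "\<beta> k y"] that by (simp add: t T_class)
    then have "tensor_class N [(y, 1)] = tensor_class N (concat (map (\<lambda>k. map (\<lambda>(p, q). (p, q * \<beta> k y)) (t k)) [0..<n]))"
      by (intro expand T_class) (simp add: \<beta>_def)
    from tensor_class_psum[OF this H] show ?thesis by (simp add: psum_concat_upt psum_map psum_map_pairs)
  qed
  show ?thesis unfolding left_depth_two_quasibasis_def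
    by (rule exI[of _ "map (\<lambda>k. (t k, \<beta> k)) [0..<n]"])
      (use \<beta> central_tensor_representative[OF _ t] basis in auto)
qed

lemma right_depth_two_quasibasis_exists:
  fixes N :: "'m::ring_1 set"
  assumes "direct_summand UNIV N (tensor_bimodule N) (power_bimodule n)"
  shows "\<exists>ub. right_depth_two_quasibasis N ub"
proof -
  obtain f g where "summand_coordinates N UNIV N n f g" using direct_summand_power[OF assms] by blast
  then interpret summand_coordinates N UNIV N n f g .
  define \<gamma> where "\<gamma> k x = f k (tensor_class N [(1, x)])" for k x
  have \<gamma>: "\<gamma> k \<in> bimodule_end N" if k: "k < n" for k
    unfolding bimodule_end_def
  proof (clarify, intro conjI allI ballI)
    fix x y
    have "tensor_class N [(1, x + y)] = tensor_class N ([(1, x)] @ [(1, y)])"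
      unfolding tensor_class_eq_iff tensor_eq_def by (simp add: formal_eq.base tensor_rel.add_right)
    then show "\<gamma> k (x + y) = \<gamma> k x + \<gamma> k y"
      using f_add[OF k T_class(1) T_class(1), of "[(1, x)]" "[(1, y)]"] by (simp add: \<gamma>_def T_class)
  next
    fix m x assume m: "m \<in> N"
    then show "\<gamma> k (x * m) = \<gamma> k x * m"
      using f_ract[OF k T_class(1), of m "[(1, x)]"] by (simp add: \<gamma>_def T_class)
    have "tensor_class N [(m, x)] = tensor_class N [(1, m * x)]"
      using tensor_rel.balanced[of 1 UNIV x UNIV m N "(*)" "(*)"] m
      unfolding tensor_class_eq_iff tensor_eq_def by (simp add: formal_eq.base)
    then show "\<gamma> k (m * x) = m * \<gamma> k x"
      using f_lact[OF k T_class(1), of m "[(1, x)]"] by (simp add: \<gamma>_def T_class)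
  qed
  obtain u where "\<forall>k<n. g k 1 = tensor_class N (u k)" using representatives by blast
  then have u: "g k 1 = tensor_class N (u k)" if "k < n" for k using that by blast
  have basis: "psum (map (\<lambda>k. (u k, \<gamma> k)) [0..<n]) (\<lambda>u \<gamma>. psum u (\<lambda>p q. H (\<gamma> y * p) q)) = H 1 y"
    if H: "balanced_map N H" for H :: "'m \<Rightarrow> 'm \<Rightarrow> 'm" and y
  proof -
    have "g k (\<gamma> k y) = tensor_class N (map (\<lambda>(p, q). (\<gamma> k y * p, q)) (u k))" if "k < n" for k
      using g_lact[OF that, of "\<gamma> k y"] that by (simp add: u T_class)
    then have "tensor_class N [(1, y)] = tensor_class N (concat (map (\<lambda>k. map (\<lambda>(p, q). (\<gamma> k y * p, q)) (u k)) [0..<n]))"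
      by (intro expand T_class) (simp add: \<gamma>_def)
    from tensor_class_psum[OF this H] show ?thesis by (simp add: psum_concat_upt psum_map psum_map_pairs)
  qed
  show ?thesis unfolding right_depth_two_quasibasis_def
    by (rule exI[of _ "map (\<lambda>k. (u k, \<gamma> k)) [0..<n]"])
      (use \<gamma> central_tensor_representative[OF _ u] basis in auto)
qed

section \<open>The universal weak Hopf algebra\<close>

lemma depth_two_frobenius_data:
  fixes s :: "'k::field \<Rightarrow> 'm::ring_1 \<Rightarrow> 'm"
  assumes alg: "k_algebra s" and sub: "subalgebra s N" and d2: "depth_two N"
    and frob: "frobenius_map N UNIV \<phi>"
    and ind: "index_one_frobenius_map s (centralizer UNIV N) \<phi>"
  obtains mb eb tb ub where "depth_two_frobenius s N \<phi> mb eb tb ub"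
proof -
  have N1: "1 \<in> N" using sub by (simp add: subalgebra_def)
  obtain mb where mb: "quasibasis UNIV \<phi> mb" using frob by (auto simp: frobenius_map_def)
  obtain eb where eb: "quasibasis (centralizer UNIV N) \<phi> eb" "(\<Sum>(a, b)\<leftarrow>eb. a * b) = 1"
    using ind by (auto simp: index_one_frobenius_map_def)
  obtain n n' where n: "direct_summand N UNIV (tensor_bimodule N) (power_bimodule n)"
    "direct_summand UNIV N (tensor_bimodule N) (power_bimodule n')"
    using d2 by (auto simp: depth_two_def)
  have bimod: "\<phi> (x * y * z) = x * \<phi> y * z" if "x \<in> N" "z \<in> N" for x y z
    using frob that by (simp add: frobenius_map_def)
  obtain tb ub where "left_depth_two_quasibasis N tb" "right_depth_two_quasibasis N ub"
    using left_depth_two_quasibasis_exists[OF n(1)] right_depth_two_quasibasis_exists[OF n(2)] by blast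
  note quasibases = this
  have "depth_two_frobenius s N \<phi> mb eb tb ub"
  proof
    show "\<phi> x \<in> N" "\<phi> (x + y) = \<phi> x + \<phi> y" for x y using frob by (simp_all add: frobenius_map_def)
    show "\<phi> (m * x) = m * \<phi> x" "\<phi> (x * m) = \<phi> x * m" if "m \<in> N" for m x
      using bimod[OF that N1, of x] bimod[OF N1 that, of x] by simp_all
    show "\<phi> r \<in> scalars s" if "r \<in> centralizer UNIV N" for r
      using ind that by (simp add: index_one_frobenius_map_def frobenius_map_def)
    show "psum mb (\<lambda>m m'. m * \<phi> (m' * x)) = x" "psum mb (\<lambda>m m'. \<phi> (x * m) * m') = x" for x
      using mb by (simp_all add: quasibasis_def psum_list_comp)
    show "psum eb (\<lambda>e e'. e * \<phi> (e' * r)) = r" "psum eb (\<lambda>e e'. \<phi> (r * e) * e') = r"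
      if "r \<in> centralizer UNIV N" for r
      using eb(1) that by (simp_all add: quasibasis_def psum_list_comp)
    show "psum eb (\<lambda>e e'. e * e') = 1" using eb(2) by (simp add: psum_list_comp)
    show "e \<in> centralizer UNIV N \<and> e' \<in> centralizer UNIV N" if "(e, e') \<in> set eb" for e e'
      using eb(1) that by (auto simp: quasibasis_def)
  qed (fact alg sub quasibases)+
  then show ?thesis by (rule that)
qed

context depth_two_frobenius begin

lemma endomorphism_model_exists:
  obtains C :: "(nat \<Rightarrow>\<^sub>0 'k) set" and al
  where "endomorphism_model s N \<phi> mb eb tb ub C finsupp_scale al"
proof -
  obtain C :: "(nat \<Rightarrow>\<^sub>0 'k) set" and h where
    h: "fd_space finsupp_scale C" "linear_on C finsupp_scale (\<lambda>c (f :: 'm \<Rightarrow> 'm) x. s c (f x)) h" "bij_betw h C E"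
    by (rule fd_space_coordinates[OF fd_space_bimodule_end])
  have "endomorphism_model s N \<phi> mb eb tb ub C finsupp_scale h"
    by unfold_locales (use h in \<open>simp_all add: linear_on_def\<close>)
  then show ?thesis by (rule that)
qed

end

text \<open>
  Forgetting the antipode, as the universal property is stated for weak bialgebras.
\<close>
lemma weak_bialgebra_truncate: "weak_bialgebra (wba.truncate W) = weak_bialgebra W"
  by (simp add: weak_bialgebra_def fin_dim_algebra_def coalgebra_def wba.defs)

lemma piL_truncate: "piL (wba.truncate W) = piL W" and tL_truncate: "tL (wba.truncate W) = tL W"
  by (simp_all add: piL_def tL_def wba.defs fun_eq_iff)

lemma car_truncate: "car (wba.truncate W) = car W"
  by (simp add: wba.defs)

lemma module_algebra_action_truncate: "module_algebra_action s (wba.truncate W) act = module_algebra_action s W act"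
  unfolding module_algebra_action_def piL_truncate by (simp add: wba.defs)

lemma invariants_truncate: "invariants (wba.truncate W) act = invariants W act"
  by (simp add: invariants_def piL_truncate car_truncate)

lemma weak_left_morphism_truncate: "weak_left_morphism (wba.truncate W) W' f = weak_left_morphism W W' f"
  unfolding weak_left_morphism_def algebra_hom_def left_subalgebra_def piL_truncate tL_truncate
  by (simp add: wba.defs)

lemma (in endomorphism_model) is_solution_A: "is_solution s N \<phi> A al"
  unfolding is_solution_def
  by (intro conjI weak_hopf_algebra_A module_algebra_action_A invariants_A universal_action_A counit_restricts_A)

theorem theorem2p3:
  fixes s :: "'k::field \<Rightarrow> 'm::ring_1 \<Rightarrow> 'm"
    and N :: "'m set"
    and \<phi> :: "'m \<Rightarrow> 'm"
  assumes "k_algebra s"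
    and "subalgebra s N"
    and "depth_two N"
    and "frobenius_extension N UNIV"
    and "separable_algebra s (centralizer UNIV N)"
    and "center N = scalars s"
    and "frobenius_map N UNIV \<phi>"
    and "index_one_frobenius_map s (centralizer UNIV N) \<phi>"
  shows "\<exists>(A :: ('k, nat \<Rightarrow>\<^sub>0 'k) wha) \<alpha>.
    is_solution s N \<phi> A \<alpha> \<and>
    universal_action TYPE('w::ab_group_add) s N A \<alpha> \<and>
    (\<forall>(A' :: ('k, 'v::ab_group_add) wha) \<alpha>'. is_solution s N \<phi> A' \<alpha>' \<longrightarrow>
      (\<exists>f. wha_iso A A' f \<and> (\<forall>a\<in>car A. \<forall>m. \<alpha>' (f a) m = \<alpha> a m)))"
proof -
  obtain mb eb tb ub where "depth_two_frobenius s N \<phi> mb eb tb ub"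
    by (rule depth_two_frobenius_data[OF assms(1-3,7,8)])
  then interpret depth_two_frobenius s N \<phi> mb eb tb ub .
  obtain C :: "(nat \<Rightarrow>\<^sub>0 'k) set" and al where "endomorphism_model s N \<phi> mb eb tb ub C finsupp_scale al"
    by (rule endomorphism_model_exists)
  then interpret endomorphism_model s N \<phi> mb eb tb ub C finsupp_scale al .
  have unique: "\<exists>f. wha_iso A A' f \<and> (\<forall>a\<in>car A. \<forall>m. \<alpha>' (f a) m = al a m)"
    if sol: "is_solution s N \<phi> A' \<alpha>'" for A' :: "('k, 'v) wha" and \<alpha>'
  proof -
    have A': "weak_hopf_algebra A'" "module_algebra_action s A' \<alpha>'" "N \<subseteq> invariants A' \<alpha>'"
      "universal_action TYPE(nat \<Rightarrow>\<^sub>0 'k) s N A' \<alpha>'" "counit_restricts_to s R \<phi> A' \<alpha>'"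
      using sol by (simp_all add: is_solution_def)
    have wA': "weak_bialgebra A'" using A'(1) by (simp add: weak_hopf_algebra_def)
    interpret cmp: comparison s N \<phi> mb eb tb ub C finsupp_scale al A' \<alpha>'
      by unfold_locales (fact wA' A' alg)+
    have "weak_bialgebra (wba.truncate A)" "module_algebra_action s (wba.truncate A) al" "N \<subseteq> invariants (wba.truncate A) al"
      by (simp_all only: weak_bialgebra_truncate module_algebra_action_truncate invariants_truncate
          weak_bialgebra_A module_algebra_action_A invariants_A)
    with A'(4) obtain g where "weak_left_morphism (wba.truncate A) A' g"
      and "\<forall>w\<in>car (wba.truncate A). \<forall>m. \<alpha>' (g w) m = al w m"
      unfolding universal_action_def by blast
    then have g: "weak_left_morphism A A' g" "\<And>a m. a \<in> C \<Longrightarrow> \<alpha>' (g a) m = al a m"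
      by (simp_all add: weak_left_morphism_truncate car_truncate)
    \<comment> \<open>A copy \<open>T.T\<close> of \<open>A'\<close> in the type to which the universal property of \<open>A'\<close> applies.\<close>
    obtain C' :: "(nat \<Rightarrow>\<^sub>0 'k) set" and h where
      h: "fd_space finsupp_scale C'" "linear_on C' finsupp_scale (scl A') h" "bij_betw h C' (car A')"
      by (rule fd_space_coordinates[OF weak_bialgebra_space.fd[OF cmp.weak_bialgebra_space_axioms]])
    interpret T: wba_transport A' C' finsupp_scale h
      by unfold_locales (fact h)+
    obtain f where "\<forall>p. weak_left_morphism T.T A' p \<and> (\<forall>w\<in>car T.T. \<forall>m. \<alpha>' (p w) m = \<alpha>' (h w) m) \<longrightarrow> (\<forall>w\<in>car T.T. p w = f w)"
      using A'(4)[unfolded universal_action_def, rule_format, of T.T "\<lambda>x. \<alpha>' (h x)"]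
        T.weak_bialgebra_T T.module_algebra_action_T[OF A'(2)] order_trans[OF A'(3) T.invariants_T] by blast
    then have f: "\<forall>w\<in>C'. p w = f w"
      if "weak_left_morphism T.T A' p" "\<And>w m. w \<in> C' \<Longrightarrow> \<alpha>' (p w) m = \<alpha>' (h w) m" for p
      using that by simp
    \<comment> \<open>Both \<open>h\<close> and \<open>g \<circ> lift \<circ> h\<close> are action-preserving morphisms from the copy to \<open>A'\<close>.\<close>
    have fh: "\<forall>w\<in>C'. h w = f w" by (rule f[OF T.weak_left_morphism_h]) simp
    have "weak_left_morphism T.T A' (\<lambda>x. g (cmp.lift (h x)))"
      by (rule weak_left_morphism_comp[OF weak_bialgebra_A
            weak_left_morphism_comp[OF wA' T.weak_left_morphism_h cmp.lift_weak_left_morphism] g(1)])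
    then have "\<forall>w\<in>C'. g (cmp.lift (h w)) = f w"
      by (rule f) (simp add: g(2) cmp.lift_C cmp.al_lift)
    with fh have gl: "g (cmp.lift x) = x" if "x \<in> car A'" for x
      using T.k_C[OF that] T.h_k[OF that] by metis
    interpret wha_comparison s N \<phi> mb eb tb ub C finsupp_scale al A' \<alpha>' g
      by unfold_locales (use A' g gl in \<open>simp_all add: weak_left_morphism_def\<close>)
    show ?thesis using wha_iso_g g(2) by (intro exI[of _ g]) simp
  qed
  show ?thesis
    by (intro exI[of _ A] exI[of _ al] conjI allI impI is_solution_A universal_action_A unique)
qed

end
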